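(* Let $n\ge 2$ and let $G$ be a permutation group acting on the set $\mathbb{Z}_n$. The following are equivalent: (i) $G=\mathrm{Aut}(\mathrm{Cay}(\mathbb{Z}_n,S))$ for some subset $S\subseteq\mathbb{Z}_n$ such that the circulant graph $\mathrm{Cay}(\mathbb{Z}_n,S)$ is rational. (ii) $G$ is permutation isomorphic to a generalized wreath product $\prod_{([r],\preceq)}S_{n_i}$, where $([r],\preceq)$ is an increasing poset and $n_1,\dots,n_r\in\mathbb{N}$ satisfy: (a) $n=n_1\cdots n_r$; (b) $n_i\ge 2$ for all $i\in[r]$; (c) $\gcd(n_i,n_j)=1$ for all $i,j\in[r]$ with $i\not\preceq j$.
   Context: $\mathbb{Z}_n$ is the additive cyclic group of order $n$. For $S\subseteq\mathbb{Z}_n$, the Cayley (circulant) graph $\mathrm{Cay}(\mathbb{Z}_n,S)$ is the directed graph with vertex set $\mathbb{Z}_n$ and arc set $\{(x,s+x): x\in\mathbb{Z}_n, s\in S\}$; its automorphism group is the group of permutations of $\mathbb{Z}_n$ preserving the arc set. A graph is rational if all eigenvalues of its adjacency matrix are rational numbers. $[r]=\{1,\dots,r\}$, $S_m$ is the symmetric group on $[m]$. A poset $([r],\preceq)$ is increasing if $i\preceq j$ implies $i\le j$ (as integers). Write $i\prec j$ for $i\preceq j$, $i\ne j$. Generalized wreath product: given a poset $([r],\preceq)$ and permutation groups $K_i\le\mathrm{Sym}(X_i)$ with $|X_i|\ge 2$, let $X=\prod_{i=1}^r X_i$, write $x=(x_1,\dots,x_r)$. For $i\in[r]$ let $A_i=\{j: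 i\prec j\}$, $X^i=\prod_{j\in A_i}X_j$ (a one-point set if $A_i=\emptyset$), and $\pi^i:X\to X^i$ the projection. Let $P_i$ be the group of all functions $f:X^i\to K_i$ (pointwise multiplication), acting on $X$ by $(x^f)_i=x_i^{f(\pi^i(x))}$ and $(x^f)_j=x_j$ for $j\ne i$. The generalized wreath product $\prod_{([r],\preceq)}K_i$ is the permutation group on $X$ equal to the set of products $\{f_1f_2\cdots f_r: f_i\in P_i\}$ (which is a group). Here $K_i=S_{n_i}$ acting on $X_i=[n_i]$. Permutation groups $K\le\mathrm{Sym}(Y)$, $K'\le\mathrm{Sym}(Y')$ are permutation isomorphic if there is a bijection $Y\to Y'$ conjugating $K$ onto $K'$.
   Formalization: Condition (c) is read for incomparable i, j (literally it forces pairwise coprime n_i, false for C_4, n=4); for (ii)⇒(i) with equality, G must contain the translations of Z_n, otherwise (i) is asserted up to permutation isomorphism. *)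

theory Defs
  imports
    Complex_Main
    "HOL-Algebra.Bij"
    "HOL-Algebra.Elementary_Groups"
    "Graph_Theory.Pair_Digraph"
    "Jordan_Normal_Form.Char_Poly"
begin

(* The symmetric group on a set Y is BijGroup Y: its elements are functions that are undefined
   outside Y, and its multiplication is g \<otimes> f = g after f. *)

subsection \<open>Circulant graphs\<close>

definition cayley_digraph :: "('a, 'b) monoid_scheme \<Rightarrow> 'a set \<Rightarrow> 'a pair_pre_digraph" where
  "cayley_digraph H S =
     \<lparr>pverts = carrier H, parcs = {(x, s \<otimes>\<^bsub>H\<^esub> x) | x s. x \<in> carrier H \<and> s \<in> S}\<rparr>"

abbreviation circulant :: "nat \<Rightarrow> int set \<Rightarrow> int pair_pre_digraph" where
  "circulant n S \<equiv> cayley_digraph (integer_mod_group n) S"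

definition digraph_auts :: "'a pair_pre_digraph \<Rightarrow> ('a \<Rightarrow> 'a) set" where
  "digraph_auts \<Gamma> =
     {g \<in> carrier (BijGroup (pverts \<Gamma>)).
        \<forall>x\<in>pverts \<Gamma>. \<forall>y\<in>pverts \<Gamma>. (g x, g y) \<in> parcs \<Gamma> \<longleftrightarrow> (x, y) \<in> parcs \<Gamma>}"

(* For digraphs with vertex set {0..<int n}, the carrier of integer_mod_group n (n > 0).
   The entries are complex, so that all eigenvalues of the (possibly non-symmetric) matrix count. *)

definition adjacency_mat :: "nat \<Rightarrow> int pair_pre_digraph \<Rightarrow> complex mat" where
  "adjacency_mat n \<Gamma> = mat n n (\<lambda>(i, j). if (int i, int j) \<in> parcs \<Gamma> then 1 else 0)"

definition rational_circulant :: "nat \<Rightarrow> int set \<Rightarrow> bool" where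
  "rational_circulant n S \<longleftrightarrow>
     (\<forall>c. eigenvalue (adjacency_mat n (circulant n S)) c \<longrightarrow> c \<in> \<rat>)"

definition group_translations :: "('a, 'b) monoid_scheme \<Rightarrow> ('a \<Rightarrow> 'a) set" where
  "group_translations H = (\<lambda>s. \<lambda>x\<in>carrier H. s \<otimes>\<^bsub>H\<^esub> x) ` carrier H"


subsection \<open>Permutation isomorphism\<close>

definition perm_isomorphic ::
  "'a set \<Rightarrow> ('a \<Rightarrow> 'a) set \<Rightarrow> 'b set \<Rightarrow> ('b \<Rightarrow> 'b) set \<Rightarrow> bool" where
  "perm_isomorphic Y K Y' K' \<longleftrightarrow>
     (\<exists>\<phi>. bij_betw \<phi> Y Y' \<and>
          K' = (\<lambda>g. \<lambda>y\<in>Y'. \<phi> (g (inv_into Y \<phi> y))) ` K)"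


subsection \<open>Generalized wreath products\<close>

(* The pairs of the relation R are the (i, j) with i below j. *)

definition increasing_poset :: "nat \<Rightarrow> nat rel \<Rightarrow> bool" where
  "increasing_poset r R \<longleftrightarrow> partial_order_on {1..r} R \<and> (\<forall>(i, j)\<in>R. i \<le> j)"

definition strictly_above :: "nat rel \<Rightarrow> nat \<Rightarrow> nat set" where
  "strictly_above R i = {j. (i, j) \<in> R \<and> i \<noteq> j}"

definition gwp_domain :: "nat \<Rightarrow> (nat \<Rightarrow> 'a set) \<Rightarrow> (nat \<Rightarrow> 'a) set" where
  "gwp_domain r X = (\<Pi>\<^sub>E i\<in>{1..r}. X i)"

(* The group P_i as a set of permutations of the product; restrict x (strictly_above R i) is the
   projection \<pi>^i(x). *)

definition gwp_factor ::
  "nat \<Rightarrow> nat rel \<Rightarrow> (nat \<Rightarrow> 'a set) \<Rightarrow> (nat \<Rightarrow> ('a \<Rightarrow> 'a) set) \<Rightarrow> nat \<Rightarrow> ((nat \<Rightarrow> 'a) \<Rightarrow> (nat \<Rightarrow> 'a)) set"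
  where
  "gwp_factor r R X K i =
     {(\<lambda>x\<in>gwp_domain r X. x(i := f (restrict x (strictly_above R i)) (x i))) | f.
        f \<in> (\<Pi>\<^sub>E j\<in>strictly_above R i. X j) \<rightarrow> K i}"

(* Permutations act on the right in the products f_1 f_2 ... f_r, so f_1 is applied first. *)

definition gen_wreath_product ::
  "nat \<Rightarrow> nat rel \<Rightarrow> (nat \<Rightarrow> 'a set) \<Rightarrow> (nat \<Rightarrow> ('a \<Rightarrow> 'a) set) \<Rightarrow> ((nat \<Rightarrow> 'a) \<Rightarrow> (nat \<Rightarrow> 'a)) set"
  where
  "gen_wreath_product r R X K =
     {fold (\<lambda>i h. compose (gwp_domain r X) (f i) h) [1..<Suc r] (\<lambda>x\<in>gwp_domain r X. x) | f.
        \<forall>i\<in>{1..r}. f i \<in> gwp_factor r R X K i}"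

end

(*
  By congruences between the eigenvalues modulo large primes, a circulant graph on Z_n is rational iff membership in
  its connection set S depends only on gcd(x, n). Then the automorphism group contains the holomorph of
  Z_n, and by Schur's method the orbits of the stabilizer of 0 are determined by the set L of divisors d
  of n for which congruence modulo d is invariant; so the automorphism group consists of all
  permutations preserving the congruences modulo the elements of L. The set L is a sublattice of the
  divisor lattice, hence distributive, and Birkhoff's theorem writes its elements as products of
  weights m_j over the up-sets of a poset. Mixed-radix digits turn the congruences into agreement
  on up-sets of coordinates, and the permutations preserving these are the generalized wreath product.
  Conversely, a sublattice L of divisors is recovered from the connection set of those x for which the
  largest element of L dividing x has even rank.
*)
theory Submission
  imports Defs "HOL-Number_Theory.Cong"
begin

section \<open>Residues and the Frobenius congruence\<close>

text \<open>Schur's method draws its force from the primes that divide \<open>d\<close>. For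
  \<open>p\<close> prime to \<open>d\<close>, taking the \<open>p\<close>-th power of an invariant
  set in the group ring only reproduces multiplication by a unit, which lies in the group already.
  For \<open>p\<close> dividing \<open>d\<close>, multiplication by \<open>p\<close> collapses each
  coset of the subgroup of order \<open>p\<close> to a point, and counting modulo \<open>p\<close>
  shows which of these cosets an invariant set cuts. A coset that is cut contains exactly one
  multiple of the full \<open>p\<close>-part of \<open>d\<close>, and the cut is recorded there. The
  converse rests on the forward direction. The automorphism group of any rational circulant is
  already known to be that of a lattice of divisors, so unwanted automorphisms are excluded as soon
  as the lattice belonging to the parity set contains every prescribed divisor.\<close>

lemma bij_betw_mod:
  fixes h :: "int \<Rightarrow> int"
  assumes "d > 0" and h: "\<And>x y. d dvd h x - h y \<Longrightarrow> d dvd x - y"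
  shows "bij_betw (\<lambda>x. h x mod d) {0..<d} {0..<d}"
proof -
  have "inj_on (\<lambda>x. h x mod d) {0..<d}"
  proof (rule inj_onI)
    fix x y assume "x \<in> {0..<d}" "y \<in> {0..<d}" "h x mod d = h y mod d"
    then have "d dvd x - y" using h by (simp add: mod_eq_dvd_iff)
    then have "x mod d = y mod d" by (simp add: mod_eq_dvd_iff)
    then show "x = y" using \<open>x \<in> _\<close> \<open>y \<in> _\<close> by simp
  qed
  moreover have "(\<lambda>x. h x mod d) ` {0..<d} \<subseteq> {0..<d}" using assms(1) by auto
  ultimately show ?thesis by (simp add: bij_betw_def endo_inj_surj)
qed

text \<open>The change of variables for sums over residues: it serves for translations, reflections
  and multiplications by units. Injectivity of \<open>h\<close> modulo \<open>d\<close> suffices,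
  because the set of residues is finite.\<close>

lemma sum_residues_bij:
  fixes f :: "int \<Rightarrow> 'a :: comm_monoid_add"
  assumes "d > 0" and f: "\<And>x y. d dvd x - y \<Longrightarrow> f x = f y"
    and h: "\<And>x y. d dvd h x - h y \<Longrightarrow> d dvd x - y"
  shows "(\<Sum>x\<in>{0..<d}. f (h x)) = (\<Sum>x\<in>{0..<d}. f x)"
proof -
  have bij: "bij_betw (\<lambda>x. h x mod d) {0..<d} {0..<d}"
    by (rule bij_betw_mod[OF assms(1) h])
  have "f (h x) = f (h x mod d)" for x
    by (rule f) (simp add: mod_eq_dvd_iff[symmetric])
  then have "(\<Sum>x\<in>{0..<d}. f (h x)) = (\<Sum>x\<in>{0..<d}. f (h x mod d))" by simp
  also have "\<dots> = (\<Sum>x\<in>{0..<d}. f x)" by (rule sum.reindex_bij_betw[OF bij])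
  finally show ?thesis .
qed

text \<open>The witness is \<open>u + d * k\<close>, where \<open>k\<close> collects the primes of
  \<open>N\<close> that do not divide \<open>u\<close>. A prime of \<open>N\<close> dividing
  \<open>u\<close> divides neither \<open>d\<close> nor \<open>k\<close>; one that does not divide
  \<open>u\<close> divides \<open>k\<close>. Either way it misses the sum.\<close>

lemma unit_lift:
  fixes u d N :: int
  assumes "coprime u d" "d dvd N" "N \<noteq> 0"
  obtains u' where "[u' = u] (mod d)" "coprime u' N"
proof -
  define k where "k = \<Prod>{p. prime p \<and> p dvd N \<and> \<not> p dvd u}"
  have fin: "finite {p. prime p \<and> p dvd N \<and> \<not> p dvd u}"
    by (rule finite_subset[OF _ finite_divisors_int[OF assms(3)]]) auto
  have "coprime (u + d * k) N"
  proof (rule ccontr)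
    assume nc: "\<not> ?thesis"
    have "gcd (u + d * k) N \<noteq> 0" using assms(3) by simp
    moreover have "\<not> is_unit (gcd (u + d * k) N)" using nc is_unit_gcd by blast
    ultimately obtain p where "prime p" "p dvd gcd (u + d * k) N"
      using prime_divisor_exists by blast
    then have p: "prime p" "p dvd u + d * k" "p dvd N" by simp_all
    show False
    proof (cases "p dvd u")
      case True
      then have "p dvd d * k" using p(2) by (simp add: dvd_add_right_iff)
      moreover have "\<not> p dvd d"
        using True assms(1) p(1) by (meson not_coprimeI not_prime_unit)
      ultimately have "p dvd k" using p(1) prime_dvd_mult_iff by blast
      then obtain q where "prime q" "\<not> q dvd u" "p dvd q"
        using p(1) fin unfolding k_def by (auto simp: prime_dvd_prod_iff)
      then show ?thesis using True p(1) primes_dvd_imp_eq by metis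
    next
      case False
      then have "p dvd k" unfolding k_def using p fin by (intro dvd_prodI[of _ _ "\<lambda>x. x", simplified]) auto
      then show ?thesis using False p(2) by (meson dvd_add_left_iff dvd_mult)
    qed
  qed
  moreover have "[u + d * k = u] (mod d)" by (simp add: cong_def)
  ultimately show ?thesis using that by blast
qed

text \<open>After division by the common gcd both numbers are units modulo \<open>d div e\<close>,
  and their quotient lifts to a unit modulo \<open>N\<close>. The larger modulus matters: the group
  acts modulo \<open>n\<close>, while the orbits are studied modulo divisors
  \<open>d\<close>.\<close>

lemma gcd_eq_imp_unit_multiple:
  fixes x y d N :: int
  assumes "gcd x d = gcd y d" "d dvd N" "N > 0"
  obtains u where "coprime u N" "d dvd u * x - y"
proof -
  define e where "e = gcd x d"
  have d0: "d \<noteq> 0" using assms by auto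
  have e: "e \<noteq> 0" "e dvd x" "e dvd y" "e dvd d"
    using d0 by (simp_all add: e_def) (simp add: assms(1))
  then obtain x' y' d' where xyd: "x = e * x'" "y = e * y'" "d = e * d'" by (meson dvdE)
  have g: "gcd x' d' = 1" "gcd y' d' = 1"
  proof -
    have "e \<ge> 0" by (simp add: e_def)
    moreover have "gcd (e * x') (e * d') = e" by (metis e_def xyd(1,3))
    moreover have "gcd (e * y') (e * d') = e" by (metis e_def assms(1) xyd(2,3))
    ultimately have "e * gcd x' d' = e" "e * gcd y' d' = e"
      by (simp_all add: gcd_mult_left)
    then show "gcd x' d' = 1" "gcd y' d' = 1" using e(1) by simp_all
  qed
  then obtain v where v: "[x' * v = 1] (mod d')"
    using cong_solve_coprime_int coprime_iff_gcd_eq_1 by metis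
  have "coprime (y' * v) d'"
    using g v by (metis cong_imp_coprime cong_sym coprime_1_left coprime_iff_gcd_eq_1 coprime_mult_left_iff)
  moreover have "d' dvd N" using assms(2) xyd(3) by (metis dvd_mult_right)
  ultimately obtain u where u: "[u = y' * v] (mod d')" "coprime u N"
    using unit_lift assms(3) by (metis less_irrefl)
  have "[u * x' = y' * v * x'] (mod d')" using u(1) by (rule cong_scalar_right)
  also have "y' * v * x' = y' * (x' * v)" by simp
  also have "[y' * (x' * v) = y' * 1] (mod d')" using v by (rule cong_scalar_left)
  finally have "d' dvd u * x' - y'" by (simp add: cong_iff_dvd_diff)
  then have "d dvd u * x - y"
    unfolding xyd by (metis mult.left_commute mult_dvd_mono dvd_refl right_diff_distrib)
  then show ?thesis using that u(2) by blast
qed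

section \<open>The Frobenius congruence and group rings of cyclic groups\<close>

lemma freshmans_dream_two:
  fixes x y :: "'a :: comm_ring_1"
  assumes "prime p"
  obtains c where "(x + y) ^ p = x ^ p + y ^ p + of_nat p * c"
proof -
  have p: "p > 0" using assms prime_gt_0_nat by blast
  have "(x + y) ^ p = (\<Sum>k\<le>p. of_nat (p choose k) * x ^ k * y ^ (p - k))"
    by (rule binomial_ring)
  also have "{..p} = insert 0 (insert p {0<..<p})" using p by auto
  also have "(\<Sum>k\<in>\<dots>. of_nat (p choose k) * x ^ k * y ^ (p - k)) =
     y ^ p + x ^ p + (\<Sum>k\<in>{0<..<p}. of_nat (p choose k) * x ^ k * y ^ (p - k))"
    using p by simp
  also have "(\<Sum>k\<in>{0<..<p}. of_nat (p choose k) * x ^ k * y ^ (p - k)) =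
     (\<Sum>k\<in>{0<..<p}. of_nat p * (of_nat ((p choose k) div p) * x ^ k * y ^ (p - k)))"
  proof (intro sum.cong refl)
    fix k assume "k \<in> {0<..<p}"
    then have "p dvd p choose k" using assms by (intro dvd_choose_prime) auto
    then have "(of_nat (p choose k) :: 'a) = of_nat p * of_nat ((p choose k) div p)"
      by (metis dvd_mult_div_cancel of_nat_mult)
    then show "of_nat (p choose k) * x ^ k * y ^ (p - k) =
        of_nat p * (of_nat ((p choose k) div p) * x ^ k * y ^ (p - k))" by (simp add: mult.assoc)
  qed
  also have "\<dots> = of_nat p * (\<Sum>k\<in>{0<..<p}. of_nat ((p choose k) div p) * x ^ k * y ^ (p - k))"
    by (simp add: sum_distrib_left)
  finally show ?thesis using that by (simp add: add.commute)
qed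

text \<open>The explicit cofactor replaces a congruence so that the identity survives ring
  homomorphisms: for integer polynomials it is later read off coefficientwise, and also evaluated at
  a root of unity.\<close>

lemma freshmans_dream_family:
  fixes f :: "'b \<Rightarrow> 'a :: comm_ring_1"
  assumes "prime p"
  obtains c where "(\<Sum>s\<in>A. f s) ^ p = (\<Sum>s\<in>A. f s ^ p) + of_nat p * c"
proof -
  have p: "p > 0" using assms prime_gt_0_nat by blast
  have "\<exists>c. (\<Sum>s\<in>A. f s) ^ p = (\<Sum>s\<in>A. f s ^ p) + of_nat p * c"
  proof (induction A rule: infinite_finite_induct)
    case (insert a A)
    then obtain c where c: "(\<Sum>s\<in>A. f s) ^ p = (\<Sum>s\<in>A. f s ^ p) + of_nat p * c" by blast
    obtain c' where "(f a + (\<Sum>s\<in>A. f s)) ^ p = f a ^ p + (\<Sum>s\<in>A. f s) ^ p + of_nat p * c'"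
      using freshmans_dream_two[OF assms] .
    then have "(\<Sum>s\<in>insert a A. f s) ^ p = (\<Sum>s\<in>insert a A. f s ^ p) + of_nat p * (c + c')"
      using insert c by (simp add: algebra_simps)
    then show ?case by blast
  qed (use p in \<open>auto simp: zero_power intro!: exI[of _ 0]\<close>)
  then show ?thesis using that by blast
qed

text \<open>The coefficient at \<open>y\<close> of the image of \<open>P\<close> in Z[X]/(X^d - 1),
  the integral group ring of Z_d. Polynomials serve as representatives, so powers in the group ring
  are ordinary powers.\<close>

definition residue_coeff :: "int \<Rightarrow> int \<Rightarrow> int poly \<Rightarrow> int" where
  "residue_coeff d y P = (\<Sum>i\<le>degree P. if d dvd int i - y then coeff P i else 0)"

lemma residue_coeff_eq:
  assumes "degree P \<le> B"
  shows "residue_coeff d y P = (\<Sum>i\<le>B. if d dvd int i - y then coeff P i else 0)"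
  unfolding residue_coeff_def
  by (rule sum.mono_neutral_left) (use assms in \<open>auto simp: Polynomial.coeff_eq_0\<close>)

lemma residue_coeff_add: "residue_coeff d y (P + Q) = residue_coeff d y P + residue_coeff d y Q"
proof -
  let ?B = "max (degree P) (degree Q)"
  have "degree (P + Q) \<le> ?B" by (rule degree_add_le_max)
  then show ?thesis
    by (simp add: residue_coeff_eq[of _ ?B] flip: sum.distrib) (rule sum.cong, auto)
qed

lemma residue_coeff_0 [simp]: "residue_coeff d y 0 = 0"
  unfolding residue_coeff_def by (rule sum.neutral, simp)

lemma residue_coeff_sum: "residue_coeff d y (\<Sum>s\<in>A. f s) = (\<Sum>s\<in>A. residue_coeff d y (f s))"
  by (induction A rule: infinite_finite_induct) (auto simp: residue_coeff_add)

lemma residue_coeff_of_nat_mult: "residue_coeff d y (of_nat k * P) = int k * residue_coeff d y P"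
  by (induction k) (auto simp: residue_coeff_add algebra_simps)

lemma residue_coeff_monom: "residue_coeff d y (monom 1 k) = (if d dvd int k - y then 1 else 0)"
proof -
  have "residue_coeff d y (monom 1 k) =
      (\<Sum>i\<in>{..k}. if k = i then (if d dvd int k - y then 1 else 0) else 0)"
    by (subst residue_coeff_eq[of _ k], simp add: degree_monom_eq) (rule sum.cong, simp_all)
  then show ?thesis by simp
qed

lemma residue_coeff_mult_monom:
  "residue_coeff d y (monom 1 k * P) = residue_coeff d (y - int k) P"
proof (cases "P = 0")
  case False
  have "degree (monom 1 k * P) \<le> k + degree P"
    by (metis degree_monom_le add_le_mono1 degree_mult_le le_trans)
  then have "residue_coeff d y (monom 1 k * P) =
      (\<Sum>i\<le>k + degree P. if d dvd int i - y then coeff (monom 1 k * P) i else 0)"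
    by (rule residue_coeff_eq)
  also have "\<dots> = (\<Sum>i\<in>{k..k + degree P}. if d dvd int i - y then coeff (monom 1 k * P) i else 0)"
    by (rule sum.mono_neutral_right) (auto simp: coeff_monom_mult)
  also have "\<dots> = (\<Sum>i\<in>{0..degree P}. if d dvd int (i + k) - y then coeff (monom 1 k * P) (i + k) else 0)"
    using sum.shift_bounds_cl_nat_ivl[of "\<lambda>i. if d dvd int i - y then coeff (monom 1 k * P) i else 0" 0 k "degree P"]
    by (simp add: add.commute)
  also have "\<dots> = residue_coeff d (y - int k) P"
    unfolding residue_coeff_def atLeast0AtMost
    by (intro sum.cong refl) (simp add: Polynomial.coeff_monom_mult, simp add: algebra_simps)
  finally show ?thesis .
qed simp

lemma residue_coeff_cong:
  assumes "d dvd y - y'"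
  shows "residue_coeff d y P = residue_coeff d y' P"
proof -
  have "d dvd int i - y \<longleftrightarrow> d dvd int i - y'" for i
  proof -
    have "int i - y' = (int i - y) + (y - y')" by simp
    then show ?thesis using assms by (metis dvd_add_left_iff)
  qed
  then show ?thesis by (simp add: residue_coeff_def)
qed

section \<open>Permutation groups containing the holomorph of a cyclic group\<close>

lemma int_subgroup_principal:
  fixes H :: "int set"
  assumes diff: "\<And>x y. x \<in> H \<Longrightarrow> y \<in> H \<Longrightarrow> x - y \<in> H" and d: "d \<in> H" "d > 0"
  obtains k where "k > 0" "\<And>x. x \<in> H \<longleftrightarrow> k dvd x"
proof -
  define k where "k = (LEAST k. k > 0 \<and> int k \<in> H)"
  have "\<exists>k. k > 0 \<and> int k \<in> H" using d by (intro exI[of _ "nat d"]) auto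
  then have k: "k > 0" "int k \<in> H" unfolding k_def by (rule LeastI2_ex, simp)+
  have least: "k \<le> j" if "j > 0" "int j \<in> H" for j
    unfolding k_def by (rule Least_le) (use that in auto)
  have zero: "0 \<in> H" using diff[OF d(1) d(1)] by simp
  have add: "x + y \<in> H" if "x \<in> H" "y \<in> H" for x y
    using diff[OF that(1) diff[OF zero that(2)]] by simp
  have nat_mult: "int j * int k \<in> H" for j
    by (induction j) (use zero add[OF k(2)] in \<open>auto simp: distrib_right\<close>)
  have mult: "c * int k \<in> H" for c
  proof (cases "c \<ge> 0")
    case True then show ?thesis using nat_mult[of "nat c"] by simp
  next
    case False then show ?thesis using diff[OF zero nat_mult[of "nat (- c)"]] by simp
  qed
  have "x \<in> H \<longleftrightarrow> int k dvd x" for x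
  proof
    assume x: "x \<in> H"
    have "x mod int k = x - x div int k * int k" by (simp add: minus_div_mult_eq_mod)
    then have "x mod int k \<in> H" using diff[OF x mult] by simp
    moreover have "x mod int k \<ge> 0" "x mod int k < int k" using k(1) by simp_all
    ultimately have "\<not> x mod int k > 0"
      using least[of "nat (x mod int k)"] by (metis le_nat_iff nat_0_le not_le of_nat_0_less_iff)
    then show "int k dvd x" using \<open>x mod int k \<ge> 0\<close> by (simp add: dvd_eq_mod_eq_0)
  next
    assume "int k dvd x"
    then show "x \<in> H" using mult by (metis dvdE mult.commute)
  qed
  then show ?thesis using that[of "int k"] k(1) by auto
qed

section \<open>Greatest common divisors under shifts by \<open>d div p\<close>\<close>

lemma gcd_mult_coprime:
  fixes x P m :: int
  assumes "coprime P m"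
  shows "gcd x (P * m) = gcd x P * gcd x m"
proof (rule zdvd_antisym_nonneg)
  have "gcd x (P * m) dvd P * m" by simp
  then obtain b c where bc: "gcd x (P * m) = b * c" "b dvd P" "c dvd m"
    using division_decomp by blast
  have "b dvd x" "c dvd x" by (metis bc(1) dvd_mult_left dvd_mult_right gcd_dvd1)+
  then show "gcd x (P * m) dvd gcd x P * gcd x m" unfolding bc(1) using bc by (simp add: mult_dvd_mono)
  have "coprime (gcd x P) (gcd x m)" using assms by (meson coprime_divisors gcd_dvd2)
  then show "gcd x P * gcd x m dvd gcd x (P * m)"
    by (intro gcd_greatest divides_mult mult_dvd_mono) auto
qed auto

lemma gcd_add_multiple:
  fixes x y c :: int
  assumes "c dvd y"
  shows "gcd (x + y) c = gcd x c"
  using assms by (metis dvd_def gcd_add_mult gcd.commute add.commute mult.commute)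

text \<open>For \<open>d = p * P' * m\<close> the shift \<open>P' * m\<close> is
  \<open>d div p\<close>. If \<open>P'\<close> does not divide \<open>x\<close>, the
  \<open>p\<close>-adic valuation of \<open>x\<close> is less than \<open>b\<close> and a multiple
  of \<open>P'\<close> cannot change it; the part of the gcd prime to \<open>p\<close> sees a
  multiple of \<open>m\<close>. Hence gcd classes are unions of cosets of the subgroup of order
  \<open>p\<close> here.\<close>

lemma gcd_shift_not_dvd:
  fixes p P' m x j :: int
  assumes p: "prime p" and P': "P' = p ^ b" and m: "coprime p m" and x: "\<not> P' dvd x"
  shows "gcd (x + j * (P' * m)) (p * P' * m) = gcd x (p * P' * m)"
proof -
  have red: "gcd z (p * P') = gcd z P'" if "\<not> P' dvd z" for z
  proof -
    obtain k where k: "k \<le> Suc b" "gcd z (p * P') = p ^ k"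
      using divides_primepow[OF p, of "gcd z (p * P')" "Suc b"] P' by auto
    have "k \<noteq> Suc b" using that k P' by (metis dvd_mult_right gcd_dvd1 power_Suc)
    then have "p ^ k dvd P'" unfolding P' using k(1) by (intro le_imp_power_dvd) simp
    then have "gcd z (p * P') dvd P'" by (simp only: k(2))
    then have "gcd z (p * P') dvd gcd z P'" by simp
    moreover have "gcd z P' dvd gcd z (p * P')" by (simp add: gcd_dvdI2)
    ultimately show ?thesis by (intro zdvd_antisym_nonneg) auto
  qed
  have cop: "coprime (p * P') m" using m by (simp add: P')
  have "\<not> P' dvd x + j * (P' * m)" using x by (metis dvd_add_left_iff dvd_mult dvd_triv_left)
  then show ?thesis
    unfolding gcd_mult_coprime[OF cop] using x by (simp add: red gcd_add_multiple)
qed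

text \<open>At a multiple of the full \<open>p\<close>-part, every nonzero shift brings the
  \<open>p\<close>-part of the gcd down to exactly \<open>P'\<close>, whatever the shift. All the
  nonzero translates therefore share one gcd class, which depends on \<open>x\<close> only through
  \<open>gcd x m\<close>.\<close>

lemma gcd_shift_dvd:
  fixes p P' m x y j i :: int
  assumes p: "prime p" and P': "P' = p ^ b" and m: "coprime p m"
    and x: "p * P' dvd x" and y: "p * P' dvd y" and xy: "gcd x m = gcd y m"
    and j: "\<not> p dvd j" and i: "\<not> p dvd i"
  shows "gcd (x + j * (P' * m)) (p * P' * m) = gcd (y + i * (P' * m)) (p * P' * m)"
proof -
  have "P' \<ge> 0" using p P' prime_ge_0_int by simp
  then have red: "gcd (z + l * (P' * m)) (p * P') = P'" if "p * P' dvd z" "\<not> p dvd l" for z l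
  proof -
    have "coprime p (l * m)" using that(2) m p by (simp add: prime_imp_coprime)
    then have "gcd (l * m * P') (p * P') = P'"
      using \<open>P' \<ge> 0\<close> by (simp add: gcd_mult_right coprime_commute)
    moreover have "gcd (l * (P' * m) + z) (p * P') = gcd (l * (P' * m)) (p * P')"
      using that(1) by (rule gcd_add_multiple)
    ultimately show ?thesis by (simp add: ac_simps)
  qed
  have cop: "coprime (p * P') m" using m by (simp add: P')
  show ?thesis
    unfolding gcd_mult_coprime[OF cop] using red[OF x j] red[OF y i] xy
    by (simp add: gcd_add_multiple)
qed

text \<open>A permutation of the residues modulo \<open>n\<close> is represented by its lifts to the integers. The same
  functions then also represent the permutations that it induces modulo divisors of \<open>n\<close>.\<close>
locale cyclic_perms =
  fixes n :: int and G :: "(int \<Rightarrow> int) set"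
  assumes n_pos: "n > 0"
    and inj: "g \<in> G \<Longrightarrow> n dvd g x - g y \<longleftrightarrow> n dvd x - y"
    and comp: "g \<in> G \<Longrightarrow> h \<in> G \<Longrightarrow> (\<lambda>x. g (h x)) \<in> G"
    and shift: "(\<lambda>x. x + s) \<in> G"
    and inverse: "g \<in> G \<Longrightarrow> \<exists>h\<in>G. \<forall>x. n dvd h (g x) - x"
    and unit: "coprime u n \<Longrightarrow> (\<lambda>x. u * x) \<in> G"
begin

text \<open>Because all translations are present, every block system of \<open>G\<close> is a
  congruence; these \<open>d\<close> index the block systems.\<close>

definition compat :: "int \<Rightarrow> bool" where
  "compat d \<longleftrightarrow> d > 0 \<and> d dvd n \<and> (\<forall>g\<in>G. \<forall>x y. d dvd x - y \<longrightarrow> d dvd g x - g y)"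

text \<open>For compatible \<open>d\<close> these are the unions of basic sets of the Schur ring of
  the group induced on Z_d. The basic sets themselves are the orbits \<open>orb d t\<close>.\<close>

definition invariant :: "int \<Rightarrow> int set \<Rightarrow> bool" where
  "invariant d T \<longleftrightarrow> (\<forall>x y. d dvd x - y \<longrightarrow> x \<in> T \<longrightarrow> y \<in> T) \<and>
     (\<forall>g\<in>G. d dvd g 0 \<longrightarrow> (\<forall>x\<in>T. g x \<in> T))"

definition orb :: "int \<Rightarrow> int \<Rightarrow> int set" where
  "orb d t = {x. \<exists>g\<in>G. d dvd g 0 \<and> d dvd g t - x}"

lemma compatD:
  assumes "compat d"
  shows "d > 0" "d dvd n" "\<And>g x y. g \<in> G \<Longrightarrow> d dvd x - y \<Longrightarrow> d dvd g x - g y"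
  using assms by (auto simp: compat_def)

lemma invariantD:
  assumes "invariant d T"
  shows "\<And>x y. d dvd x - y \<Longrightarrow> x \<in> T \<longleftrightarrow> y \<in> T"
    "\<And>g x. g \<in> G \<Longrightarrow> d dvd g 0 \<Longrightarrow> x \<in> T \<Longrightarrow> g x \<in> T"
  using assms unfolding invariant_def by (meson dvd_diff_commute)+

lemma G_shift: "g \<in> G \<Longrightarrow> (\<lambda>x. g (x + a) + b) \<in> G"
  using comp[OF shift[of b] comp[OF _ shift[of a]]] by simp

lemma compat_iff:
  assumes "compat d" "g \<in> G"
  shows "d dvd g x - g y \<longleftrightarrow> d dvd x - y"
proof
  assume *: "d dvd g x - g y"
  obtain h where h: "h \<in> G" "\<And>x. n dvd h (g x) - x" using inverse[OF assms(2)] by blast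
  have hd: "d dvd h (g x) - x" for x using h(2) compatD(2)[OF assms(1)] dvd_trans by blast
  have "x - y = (h (g x) - h (g y)) - (h (g x) - x) + (h (g y) - y)" by simp
  moreover have "d dvd h (g x) - h (g y)" using compatD(3)[OF assms(1) h(1) *] .
  ultimately show "d dvd x - y" using hd by (metis dvd_add dvd_diff)
qed (use compatD(3)[OF assms] in blast)

lemma surjective:
  assumes "g \<in> G"
  shows "\<exists>w. n dvd g w - z"
proof -
  obtain h where h: "h \<in> G" "\<And>x. n dvd h (g x) - x" using inverse[OF assms] by blast
  have "n dvd h (g (h z)) - h z" using h(2) .
  then show ?thesis using inj[OF h(1)] by blast
qed

lemma compat_1: "compat 1" by (simp add: compat_def)

lemma compat_n: "compat n" using n_pos inj by (simp add: compat_def)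

lemma compat_lcm: "compat a \<Longrightarrow> compat b \<Longrightarrow> compat (lcm a b)"
  unfolding compat_def by (auto simp: lcm_pos_int)

text \<open>The map sending \<open>z\<close> to \<open>g (z + x) - g x\<close> lies in
  \<open>G\<close> and fixes 0, so stability of \<open>T\<close> under the stabilizer of 0 means
  that all of \<open>G\<close> preserves the Cayley digraph of \<open>T\<close>. The reverse
  implication is the same argument for an inverse of \<open>g\<close>.\<close>

lemma invariant_diff:
  assumes "compat d" "invariant d T" "g \<in> G"
  shows "g y - g x \<in> T \<longleftrightarrow> y - x \<in> T"
proof
  have *: "g y - g x \<in> T" if "g \<in> G" "y - x \<in> T" for g x y
    using invariantD(2)[OF assms(2) G_shift[OF that(1), of x "- g x"] _ that(2)] by simp
  show "y - x \<in> T \<Longrightarrow> g y - g x \<in> T" using *[OF assms(3)] .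
  assume "g y - g x \<in> T"
  obtain h where h: "h \<in> G" "\<And>x. n dvd h (g x) - x" using inverse[OF assms(3)] by blast
  have "h (g y) - h (g x) \<in> T" by (rule *) fact+
  moreover have "d dvd (h (g y) - h (g x)) - (y - x)"
  proof -
    have "(h (g y) - h (g x)) - (y - x) = (h (g y) - y) - (h (g x) - x)" by simp
    then show ?thesis using h(2) compatD(2)[OF assms(1)] by (metis dvd_diff dvd_trans)
  qed
  ultimately show "y - x \<in> T" using invariantD(1)[OF assms(2)] by blast
qed

text \<open>Multiplications by units fix 0 and are transitive on each gcd class modulo
  \<open>d\<close>. Through this lemma the rationality of the graph enters Schur's method.\<close>

lemma invariant_gcd:
  assumes "compat d" "invariant d T" "gcd x d = gcd y d"
  shows "x \<in> T \<longleftrightarrow> y \<in> T"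
proof -
  have "y \<in> T" if "gcd x d = gcd y d" "x \<in> T" for x y
  proof -
    note eq = that(1)
    obtain u where u: "coprime u n" "d dvd u * x - y"
      using gcd_eq_imp_unit_multiple[OF eq compatD(2)[OF assms(1)] n_pos] .
    show ?thesis
      using invariantD(2)[OF assms(2) unit[OF u(1)] _ that(2)] invariantD(1)[OF assms(2) u(2)] by simp
  qed
  then show ?thesis using assms(3) by metis
qed

lemma invariant_Un: "invariant d S \<Longrightarrow> invariant d T \<Longrightarrow> invariant d (S \<union> T)"
  unfolding invariant_def by blast

lemma orb_self: "t \<in> orb d t"
  unfolding orb_def using shift[of 0] by force

lemma orb_trans:
  assumes "compat d" "x \<in> orb d y" "y \<in> orb d z"
  shows "x \<in> orb d z"
proof -
  obtain g h where g: "g \<in> G" "d dvd g 0" "d dvd g y - x" and h: "h \<in> G" "d dvd h 0" "d dvd h z - y"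
    using assms(2,3) by (auto simp: orb_def)
  have "d dvd g (h 0) - g 0" "d dvd g (h z) - g y"
    using compatD(3)[OF assms(1) g(1)] h by auto
  then have "d dvd g (h 0)" "d dvd g (h z) - x"
    using g by (metis diff_add_cancel dvd_add, metis diff_add_cancel add_diff_eq dvd_add)
  then show ?thesis using comp[OF g(1) h(1)] by (auto simp: orb_def)
qed

lemma invariant_orb:
  assumes "compat d"
  shows "invariant d (orb d t)"
  unfolding invariant_def
proof (intro conjI allI impI ballI)
  fix x y assume "d dvd x - y" "x \<in> orb d t"
  then obtain g where "g \<in> G" "d dvd g 0" "d dvd g t - x" by (auto simp: orb_def)
  moreover have "g t - y = (g t - x) + (x - y)" by simp
  ultimately show "y \<in> orb d t" using \<open>d dvd x - y\<close> by (metis (mono_tags, lifting) dvd_add mem_Collect_eq orb_def)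
next
  fix g x assume g: "g \<in> G" "d dvd g 0" and x: "x \<in> orb d t"
  have "g x \<in> orb d x" using g by (auto simp: orb_def)
  then show "g x \<in> orb d t" using orb_trans[OF assms] x by blast
qed

lemma orb_in_invariant:
  assumes "compat d" "invariant d T" "x \<in> orb d t"
  shows "x \<in> T \<longleftrightarrow> t \<in> T"
proof -
  obtain g where g: "g \<in> G" "d dvd g 0" "d dvd g t - x" using assms(3) by (auto simp: orb_def)
  have "d dvd (g t - g 0) - x"
    using dvd_diff[OF g(3,2)] by (simp add: algebra_simps)
  then have "x \<in> T \<longleftrightarrow> g t - g 0 \<in> T" using invariantD(1)[OF assms(2)] by blast
  also have "\<dots> \<longleftrightarrow> t - 0 \<in> T" by (rule invariant_diff[OF assms(1,2) g(1)])
  finally show ?thesis by simp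
qed

text \<open>The subgroup of Z_d generated by an invariant set is a block. The set \<open>H\<close>
  of those \<open>h\<close> whose addition to the argument changes no \<open>g\<close> modulo
  \<open>k\<close> is a group. It contains \<open>A\<close>, because \<open>g (x + a) - g x\<close>
  lies again in \<open>A\<close> and so is divisible by \<open>k\<close>; hence it contains every
  multiple of \<open>k\<close>.\<close>

lemma compat_generated:
  assumes "compat d" "invariant d A"
  obtains k where "compat k" "k dvd d" "\<And>a. a \<in> A \<Longrightarrow> k dvd a"
    "\<And>c. c dvd d \<Longrightarrow> (\<And>a. a \<in> A \<Longrightarrow> c dvd a) \<Longrightarrow> c dvd k"
proof -
  define k where "k = Gcd (insert d A)"
  have kd: "k dvd d" unfolding k_def by (rule Gcd_dvd) simp
  have ka: "k dvd a" if "a \<in> A" for a unfolding k_def by (rule Gcd_dvd) (use that in simp)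
  have k0: "k > 0"
  proof -
    have "k \<noteq> 0" using kd compatD(1)[OF assms(1)] by auto
    moreover have "k \<ge> 0" by (simp add: k_def)
    ultimately show ?thesis by simp
  qed
  define H where "H = {h. \<forall>g\<in>G. \<forall>x. k dvd g (x + h) - g x}"
  have dH: "d \<in> H"
    unfolding H_def using compatD(3)[OF assms(1), where x = "_ + d"] dvd_trans[OF kd] by simp
  moreover have "x - y \<in> H" if "x \<in> H" "y \<in> H" for x y
  proof -
    have "k dvd g (z + (x - y)) - g z" if g: "g \<in> G" for g z
    proof -
      have "k dvd g ((z - y) + x) - g (z - y)" "k dvd g ((z - y) + y) - g (z - y)"
        using \<open>x \<in> H\<close> \<open>y \<in> H\<close> g unfolding H_def by blast+
      moreover have "z - y + x = z + (x - y)" "z - y + y = z" by simp_all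
      ultimately have "k dvd (g (z + (x - y)) - g (z - y)) - (g z - g (z - y))"
        by (metis dvd_diff)
      then show ?thesis by simp
    qed
    then show ?thesis by (simp add: H_def)
  qed
  ultimately obtain h where h: "h > 0" "\<And>x. x \<in> H \<longleftrightarrow> h dvd x"
    using int_subgroup_principal[of H d] compatD(1)[OF assms(1)] by blast
  have "A \<subseteq> H"
  proof
    fix a assume a: "a \<in> A"
    have "g (x + a) - g x \<in> A" if "g \<in> G" for g x
      using invariant_diff[OF assms that, of "x + a" x] a by simp
    then show "a \<in> H" using ka by (simp add: H_def)
  qed
  then have "h dvd k" unfolding k_def using h(2) dH by (intro Gcd_greatest) auto
  have "compat k"
    unfolding compat_def
  proof (intro conjI ballI allI impI)
    show "k dvd n" using kd compatD(2)[OF assms(1)] dvd_trans by blast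
    fix g x y assume "g \<in> G" "k dvd x - y"
    then have "x - y \<in> H" using h(2) \<open>h dvd k\<close> dvd_trans by blast
    then have "k dvd g (y + (x - y)) - g y" using \<open>g \<in> G\<close> unfolding H_def by blast
    then show "k dvd g x - g y" by simp
  qed (rule k0)
  moreover have "c dvd k" if "c dvd d" "\<And>a. a \<in> A \<Longrightarrow> c dvd a" for c
    unfolding k_def by (rule Gcd_greatest) (use that in auto)
  ultimately show ?thesis using that[of k] kd ka by blast
qed

text \<open>By Bezout, congruence modulo the gcd is the composite of the two congruences: between
  \<open>x\<close> and \<open>y\<close> there is a point congruent to \<open>x\<close> modulo
  \<open>a\<close> and to \<open>y\<close> modulo \<open>b\<close>.\<close>

lemma compat_gcd:
  assumes "compat a" "compat b"
  shows "compat (gcd a b)"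
  unfolding compat_def
proof (intro conjI ballI allI impI)
  show "gcd a b > 0" using compatD(1)[OF assms(1)] by simp
  show "gcd a b dvd n" using compatD(2)[OF assms(1)] by (meson dvd_trans gcd_dvd1)
  fix g x y assume g: "g \<in> G" and "gcd a b dvd x - y"
  then obtain c where c: "x - y = gcd a b * c" by (meson dvdE)
  obtain u v where "u * a + v * b = gcd a b" using bezout_int by blast
  then have "x - y = (u * a + v * b) * c" using c by simp
  then have "x - y = u * c * a + v * c * b" by (simp add: algebra_simps)
  then have "a dvd x - (y + v * c * b)" "b dvd (y + v * c * b) - y" by (auto simp: algebra_simps)
  then have "a dvd g x - g (y + v * c * b)" "b dvd g (y + v * c * b) - g y"
    using compatD(3)[OF assms(1) g] compatD(3)[OF assms(2) g] by blast+
  then have "gcd a b dvd g x - g (y + v * c * b)" "gcd a b dvd g (y + v * c * b) - g y"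
    by (meson dvd_trans gcd_dvd1 gcd_dvd2)+
  then show "gcd a b dvd g x - g y" by (metis dvd_add diff_add_cancel add_diff_eq)
qed

section \<open>Schur's theorem on prime powers of invariant sets\<close>

definition indicator_poly :: "int \<Rightarrow> int set \<Rightarrow> int poly" where
  "indicator_poly d T = (\<Sum>x\<in>{0..<d} \<inter> T. monom 1 (nat x))"

lemma residue_coeff_indicator_mult:
  assumes "compat d" "invariant d T"
  shows "residue_coeff d y (indicator_poly d T * Q) =
    (\<Sum>v\<in>{0..<d}. if y - v \<in> T then residue_coeff d v Q else 0)"
proof -
  have "residue_coeff d y (indicator_poly d T * Q) =
      (\<Sum>x\<in>{0..<d} \<inter> T. residue_coeff d (y - x) Q)"
    unfolding indicator_poly_def sum_distrib_right residue_coeff_sum residue_coeff_mult_monom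
    by (intro sum.cong) auto
  also have "\<dots> = (\<Sum>x\<in>{0..<d}. if x \<in> T then residue_coeff d (y - x) Q else 0)"
    by (simp add: sum.inter_restrict)
  also have "\<dots> = (\<Sum>x\<in>{0..<d}. (\<lambda>v. if y - v \<in> T then residue_coeff d v Q else 0) (y - x))"
    by simp
  also have "\<dots> = (\<Sum>v\<in>{0..<d}. if y - v \<in> T then residue_coeff d v Q else 0)"
  proof (rule sum_residues_bij[where h = "\<lambda>x. y - x"])
    fix u v assume "d dvd u - v"
    moreover from this have "d dvd (y - v) - (y - u)" by simp
    ultimately show "(if y - u \<in> T then residue_coeff d u Q else 0) =
        (if y - v \<in> T then residue_coeff d v Q else 0)"
      using invariantD(1)[OF assms(2)] residue_coeff_cong by metis
  qed (use compatD(1)[OF assms(1)] in \<open>auto simp: dvd_diff_commute\<close>)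
  finally show ?thesis .
qed

lemma bij_betw_residues:
  assumes "compat d" "g \<in> G"
  shows "bij_betw (\<lambda>v. g v mod d) {0..<d} {0..<d}"
  by (rule bij_betw_mod) (use compatD(1)[OF assms(1)] compat_iff[OF assms] in auto)

text \<open>Invariance passes to products in the group ring: in the convolution for the next power,
  substitute \<open>g v\<close> for \<open>v\<close>; the condition on the difference survives by
  \<open>invariant_diff\<close>, the other factor by induction.\<close>

lemma residue_coeff_power_invariant:
  assumes "compat d" "invariant d T" "g \<in> G" "d dvd g 0"
  shows "residue_coeff d (g y) (indicator_poly d T ^ k) = residue_coeff d y (indicator_poly d T ^ k)"
proof (induction k arbitrary: y)
  case 0
  have "d dvd g y \<longleftrightarrow> d dvd g y - g 0" using assms(4) by (simp add: dvd_diff_left_iff)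
  also have "\<dots> \<longleftrightarrow> d dvd y" using compat_iff[OF assms(1,3), of y 0] by simp
  finally show ?case
    using residue_coeff_monom[of d _ 0] by (simp add: monom_0 one_pCons)
next
  case (Suc k)
  let ?r = "\<lambda>v. residue_coeff d v (indicator_poly d T ^ k)"
  have "(\<Sum>v\<in>{0..<d}. if g y - v \<in> T then ?r v else 0) =
      (\<Sum>v\<in>{0..<d}. if g y - g v mod d \<in> T then ?r (g v mod d) else 0)"
    by (rule sum.reindex_bij_betw[OF bij_betw_residues[OF assms(1,3)], symmetric])
  also have "\<dots> = (\<Sum>v\<in>{0..<d}. if y - v \<in> T then ?r v else 0)"
  proof (intro sum.cong refl)
    fix v
    have "d dvd (g y - g v mod d) - (g y - g v)" "d dvd g v mod d - g v"
      by (simp_all add: mod_eq_dvd_iff[symmetric])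
    then have "g y - g v mod d \<in> T \<longleftrightarrow> g y - g v \<in> T" "?r (g v mod d) = ?r (g v)"
      using invariantD(1)[OF assms(2)] residue_coeff_cong by blast+
    then show "(if g y - g v mod d \<in> T then ?r (g v mod d) else 0) = (if y - v \<in> T then ?r v else 0)"
      using invariant_diff[OF assms(1-3)] Suc.IH by simp
  qed
  finally show ?case using residue_coeff_indicator_mult[OF assms(1,2)] by simp
qed

text \<open>By the Frobenius congruence, the \<open>p\<close>-th power of a sum of monomials is
  modulo \<open>p\<close> the sum of their \<open>p\<close>-th powers. Its coefficient at
  \<open>y\<close> thus counts the elements of \<open>T\<close> that multiplication by
  \<open>p\<close> sends to \<open>y\<close>.\<close>

lemma residue_coeff_power_prime_cong:
  assumes "prime p"
  shows "[residue_coeff d y (indicator_poly d T ^ p) =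
    int (card {x \<in> {0..<d} \<inter> T. d dvd int p * x - y})] (mod int p)"
proof -
  obtain c where "indicator_poly d T ^ p = (\<Sum>x\<in>{0..<d} \<inter> T. monom 1 (nat x) ^ p) + of_nat p * c"
    using freshmans_dream_family[OF assms] unfolding indicator_poly_def by blast
  then have "residue_coeff d y (indicator_poly d T ^ p) =
      (\<Sum>x\<in>{0..<d} \<inter> T. if d dvd int (nat x * p) - y then 1 else 0) + int p * residue_coeff d y c"
    by (simp only: residue_coeff_add residue_coeff_sum residue_coeff_of_nat_mult monom_power
        power_one residue_coeff_monom)
  also have "(\<Sum>x\<in>{0..<d} \<inter> T. if d dvd int (nat x * p) - y then 1 else 0) =
      (\<Sum>x\<in>{x \<in> {0..<d} \<inter> T. d dvd int p * x - y}. 1 :: int)"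
    by (subst sum.inter_filter[symmetric], simp) (intro sum.cong, auto simp: mult.commute)
  finally show ?thesis by (simp add: cong_def)
qed

end

text \<open>For \<open>p\<close> dividing \<open>d\<close>, the solutions of p x = y modulo
  \<open>d\<close>, once there is one, form a coset of the subgroup generated by
  \<open>q = d div p\<close>, which has order \<open>p\<close>.\<close>

lemma card_prime_fibre:
  fixes p q d x0 y :: int
  assumes p: "p > 0" and d: "d = p * q" "d > 0" and x0: "d dvd p * x0 - y"
    and T: "\<And>x y. d dvd x - y \<Longrightarrow> x \<in> T \<longleftrightarrow> y \<in> T"
  shows "card {x \<in> {0..<d} \<inter> T. d dvd p * x - y} = card {j \<in> {0..<p}. x0 + j * q \<in> T}"
proof -
  have q: "q \<noteq> 0" using d by auto
  have "bij_betw (\<lambda>j. (x0 + j * q) mod d) {j \<in> {0..<p}. x0 + j * q \<in> T}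
      {x \<in> {0..<d} \<inter> T. d dvd p * x - y}"
    unfolding bij_betw_def
  proof (intro conjI inj_onI equalityI subsetI)
    fix i j assume ij: "i \<in> {j \<in> {0..<p}. x0 + j * q \<in> T}" "j \<in> {j \<in> {0..<p}. x0 + j * q \<in> T}"
      and "(x0 + i * q) mod d = (x0 + j * q) mod d"
    then have "p * q dvd (i - j) * q" unfolding d mod_eq_dvd_iff by (simp add: algebra_simps)
    then have "i mod p = j mod p" using q by (simp add: mod_eq_dvd_iff)
    then show "i = j" using ij by simp
  next
    fix x assume "x \<in> (\<lambda>j. (x0 + j * q) mod d) ` {j \<in> {0..<p}. x0 + j * q \<in> T}"
    then obtain j where j: "x0 + j * q \<in> T" and x: "x = (x0 + j * q) mod d" by blast
    have dx: "d dvd x - (x0 + j * q)" unfolding x by (simp add: mod_eq_dvd_iff[symmetric])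
    then have "d dvd p * (x - (x0 + j * q)) + (p * x0 - y) + d * j" using x0 by simp
    moreover have "p * (x - (x0 + j * q)) + (p * x0 - y) + d * j = p * x - y"
      by (simp add: d algebra_simps)
    ultimately have "d dvd p * x - y" by metis
    then show "x \<in> {x \<in> {0..<d} \<inter> T. d dvd p * x - y}"
      using T[OF dx] j d(2) x by simp
  next
    fix x assume x: "x \<in> {x \<in> {0..<d} \<inter> T. d dvd p * x - y}"
    then have "d dvd p * x - y" by blast
    then have "d dvd (p * x - y) - (p * x0 - y)" using x0 by (rule dvd_diff)
    then have "p * q dvd p * (x - x0)" unfolding d by (simp add: algebra_simps)
    then have "q dvd x - x0" using p by simp
    then obtain k where k: "x = x0 + k * q" by (metis add.commute diff_add_cancel dvdE mult.commute)
    have "d dvd (x0 + (k mod p) * q) - x"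
    proof -
      have "(x0 + (k mod p) * q) - x = (k mod p - k) * q" by (simp add: k algebra_simps)
      moreover have "p dvd k mod p - k" by (simp add: mod_eq_dvd_iff[symmetric])
      ultimately show ?thesis unfolding d by (simp add: mult_dvd_mono)
    qed
    moreover from this have "(x0 + (k mod p) * q) mod d = x"
      using x by (metis (no_types, lifting) IntD1 atLeastLessThan_iff mem_Collect_eq mod_eq_dvd_iff mod_pos_pos_trivial)
    ultimately show "x \<in> (\<lambda>j. (x0 + j * q) mod d) ` {j \<in> {0..<p}. x0 + j * q \<in> T}"
      using x p T by (intro image_eqI[of _ _ "k mod p"]) auto
  qed
  then show ?thesis by (simp add: bij_betw_same_card)
qed

context cyclic_perms
begin

text \<open>Used with \<open>P\<close> the full \<open>p\<close>-part of \<open>d\<close> and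
  \<open>q = d div p\<close>. By \<open>split_set_iff\<close> it is then the support modulo
  \<open>p\<close> of the \<open>p\<close>-th power of \<open>T\<close>.\<close>

definition split_set :: "int \<Rightarrow> int \<Rightarrow> int set \<Rightarrow> int set" where
  "split_set P q T = {x. P dvd x \<and> (x \<in> T \<longleftrightarrow> x + q \<notin> T)}"

context
  fixes d p P' m :: int and b :: nat and T :: "int set"
  assumes d: "compat d" and T: "invariant d T" and p: "prime p"
    and d_eq: "d = p * P' * m" and P': "P' = p ^ b" and m: "coprime p m"
begin

text \<open>For \<open>y = x\<close> this says that \<open>T\<close> contains all or none of the
  nonzero translates of \<open>x\<close> by the subgroup of order \<open>p\<close>. A different
  \<open>y\<close> with the same gcd allows the fibre over \<open>y\<close> to be based at a
  preimage of \<open>y\<close> instead.\<close>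

lemma unit_coset:
  assumes x: "p * P' dvd x" and y: "p * P' dvd y" and xy: "gcd x m = gcd y m"
    and j: "\<not> p dvd j"
  shows "x + j * (P' * m) \<in> T \<longleftrightarrow> y + P' * m \<in> T"
proof -
  have "\<not> p dvd 1" using p not_prime_unit by blast
  then have "gcd (x + j * (P' * m)) d = gcd (y + P' * m) d"
    using gcd_shift_dvd[OF p P' m x y xy j, of 1] by (simp add: d_eq)
  then show ?thesis by (rule invariant_gcd[OF d T])
qed

lemma not_dvd_coset:
  assumes "\<not> P' dvd x"
  shows "x + j * (P' * m) \<in> T \<longleftrightarrow> x \<in> T"
  by (rule invariant_gcd[OF d T], unfold d_eq) (rule gcd_shift_not_dvd[OF p P' m assms])

text \<open>If the full \<open>p\<close>-part divides \<open>y\<close>, the fibre has one point that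
  behaves like \<open>y\<close> and \<open>p - 1\<close> points that behave like
  \<open>y + P' * m\<close>; modulo \<open>p\<close> the count is the difference of the two
  indicators. If \<open>p\<close> divides \<open>y\<close> but the \<open>p\<close>-part does not,
  the fibre is a coset that \<open>T\<close> does not cut, and the count is 0 or \<open>p\<close>.
  If \<open>p\<close> does not divide \<open>y\<close>, the fibre is empty.\<close>

lemma split_set_iff:
  "\<not> p dvd int (card {x \<in> {0..<d} \<inter> T. d dvd p * x - y}) \<longleftrightarrow> y \<in> split_set (p * P') (P' * m) T"
proof -
  have p0: "p > 0" using p prime_gt_0_int by blast
  have d': "d = p * (P' * m)" "d > 0" using d_eq compatD(1)[OF d] by (auto simp: ac_simps)
  note fibre = card_prime_fibre[OF p0 d' _ invariantD(1)[OF T]]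
  show ?thesis
  proof (cases "p * P' dvd y")
    case True
    then obtain y' where y': "y = p * P' * y'" by (meson dvdE)
    obtain r where "[p * r = 1] (mod m)" using m cong_solve_coprime_int by blast
    then have r: "m dvd p * r - 1" by (simp add: cong_iff_dvd_diff)
    \<comment> \<open>Among the \<open>p\<close> preimages of \<open>y\<close> this is the one
      divisible by the full \<open>p\<close>-part; \<open>r\<close> inverts \<open>p\<close> modulo
      \<open>m\<close>.\<close>
    define x0 where "x0 = p * P' * (r * y')"
    have "p * x0 - y = p * P' * y' * (p * r - 1)" by (simp add: x0_def y' algebra_simps)
    then have x0y: "d dvd p * x0 - y" unfolding d_eq using r by (simp add: mult_dvd_mono)
    then have "m dvd p * x0 - y" unfolding d_eq by (rule dvd_mult_right)
    then have "gcd (y + (p * x0 - y)) m = gcd y m" by (rule gcd_add_multiple)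
    then have "gcd y m = gcd (p * x0) m" by simp
    also have "\<dots> = gcd x0 m" using m by (simp add: gcd_mult_left_left_cancel coprime_commute)
    finally have g: "gcd x0 m = gcd y m" ..
    have x0: "p * P' dvd x0" by (simp add: x0_def)
    have "coprime (p * P') m" using m P' by simp
    then have "gcd x0 d = gcd y d"
      using gcd_mult_coprime[of "p * P'" m] g x0 True by (simp add: d_eq gcd_proj2_iff)
    then have yT: "x0 \<in> T \<longleftrightarrow> y \<in> T" by (rule invariant_gcd[OF d T])
    have "x0 + j * (P' * m) \<in> T \<longleftrightarrow> y + P' * m \<in> T" if "j \<in> {1..<p}" for j
      using unit_coset[OF x0 True g, of j] that zdvd_not_zless by auto
    moreover have "{0..<p} = insert 0 {1..<p}" using p0 by auto
    ultimately have "{j \<in> {0..<p}. x0 + j * (P' * m) \<in> T} =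
       {j. j = 0 \<and> y \<in> T} \<union> {j \<in> {1..<p}. y + P' * m \<in> T}"
      using yT by auto
    then have "card {j \<in> {0..<p}. x0 + j * (P' * m) \<in> T} =
       card ({j. j = 0 \<and> y \<in> T} \<union> {j \<in> {1..<p}. y + P' * m \<in> T})" by simp
    also have "\<dots> = card {j :: int. j = 0 \<and> y \<in> T} + card {j \<in> {1..<p}. y + P' * m \<in> T}"
      by (rule card_Un_disjoint) (auto intro: finite_subset[of _ "{1..<p}"] finite_subset[of _ "{0}"])
    also have "{j \<in> {1..<p}. y + P' * m \<in> T} = (if y + P' * m \<in> T then {1..<p} else {})"
      by auto
    also have "{j :: int. j = 0 \<and> y \<in> T} = (if y \<in> T then {0} else {})" by auto
    also have "int (card (if y \<in> T then {0 :: int} else {}) + card (if y + P' * m \<in> T then {1..<p} else {})) = (if y \<in> T then 1 else 0) + (if y + P' * m \<in> T then p - 1 else 0)"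
      using p0 by (cases "y \<in> T"; cases "y + P' * m \<in> T") simp_all
    finally have "int (card {x \<in> {0..<d} \<inter> T. d dvd p * x - y}) =
        (if y \<in> T then 1 else 0) + (if y + P' * m \<in> T then p - 1 else 0)"
      using fibre[OF x0y] by simp
    moreover have p1: "\<not> p dvd 1" using p not_prime_unit by blast
    moreover have "\<not> p dvd p - 1"
    proof
      assume "p dvd p - 1"
      from dvd_diff[OF dvd_refl this] show False using p1 by simp
    qed
    ultimately show ?thesis
      using True by (cases "y \<in> T"; cases "y + P' * m \<in> T") (simp_all add: split_set_def)
  next
    case False
    then have W: "y \<notin> split_set (p * P') (P' * m) T" by (simp add: split_set_def)
    show ?thesis
    proof (cases "p dvd y")
      case True
      then obtain x0 where x0: "y = p * x0" by (meson dvdE)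
      then have "\<not> P' dvd x0" using False by simp
      then have "{j \<in> {0..<p}. x0 + j * (P' * m) \<in> T} = {j \<in> {0..<p}. x0 \<in> T}"
        using not_dvd_coset[of x0] by simp
      also have "\<dots> = (if x0 \<in> T then {0..<p} else {})" by auto
      finally have "p dvd int (card {j \<in> {0..<p}. x0 + j * (P' * m) \<in> T})"
        using p0 by simp
      then show ?thesis using W fibre[of x0 y] x0 by simp
    next
      case False
      have "\<not> d dvd p * x - y" for x
      proof
        assume "d dvd p * x - y"
        then have "p dvd p * x - y" unfolding d'(1) by (rule dvd_mult_left)
        from dvd_diff[OF dvd_triv_left[of p x] this] show False using False by simp
      qed
      then show ?thesis using W by simp
    qed
  qed
qed

lemma invariant_split_set: "invariant d (split_set (p * P') (P' * m) T)"
  unfolding invariant_def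
proof (intro conjI allI impI ballI)
  have P_dvd: "p * P' dvd d" by (simp add: d_eq)
  fix x y assume xy: "d dvd x - y" and x: "x \<in> split_set (p * P') (P' * m) T"
  have "d dvd (x + P' * m) - (y + P' * m)" using xy by simp
  moreover have "p * P' dvd x - y" using xy P_dvd by (rule dvd_trans[rotated])
  then have "p * P' dvd x \<longleftrightarrow> p * P' dvd y" by (metis dvd_diff_left_iff dvd_diff_right_iff)
  ultimately show "y \<in> split_set (p * P') (P' * m) T"
    using x invariantD(1)[OF T xy] invariantD(1)[OF T] unfolding split_set_def by blast
next
  fix g x assume g: "g \<in> G" "d dvd g 0" and x: "x \<in> split_set (p * P') (P' * m) T"
  have pn: "prime (nat p)" "int (nat p) = p" using p prime_ge_0_int by auto
  have "p dvd int (card {x \<in> {0..<d} \<inter> T. d dvd p * x - y}) \<longleftrightarrow>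
      p dvd residue_coeff d y (indicator_poly d T ^ nat p)" for y
    using residue_coeff_power_prime_cong[OF pn(1), of d y T] cong_dvd_iff unfolding pn(2) by blast
  then show "g x \<in> split_set (p * P') (P' * m) T"
    using x residue_coeff_power_invariant[OF d T g] by (simp flip: split_set_iff)
qed

text \<open>A cut coset consists of multiples of \<open>P'\<close> and hence contains a multiple
  \<open>w\<close> of \<open>p * P'\<close>. Were \<open>w\<close> not in the split set,
  \<open>w\<close> and \<open>w + P' * m\<close> would agree about \<open>T\<close>, and by
  \<open>unit_coset\<close> so would the whole coset.\<close>

lemma split_set_nonempty:
  assumes x: "x \<in> T" "x + P' * m \<notin> T"
  shows "\<exists>w. w \<in> split_set (p * P') (P' * m) T"
proof -
  have "P' dvd x" using not_dvd_coset[of x 1] x by auto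
  then obtain x' where x': "x = P' * x'" by (meson dvdE)
  obtain r where "[m * r = 1] (mod p)" using m cong_solve_coprime_int by (metis coprime_commute)
  then have "p dvd 1 - m * r" by (simp add: cong_iff_dvd_diff dvd_diff_commute)
  \<comment> \<open>Chosen so that \<open>x' + j * m\<close> is divisible by \<open>p\<close>, where
    \<open>r\<close> inverts \<open>m\<close> modulo \<open>p\<close>.\<close>
  define j where "j = - x' * r"
  have "x + j * (P' * m) = P' * (x' * (1 - m * r))" by (simp add: x' j_def algebra_simps)
  then have w: "p * P' dvd x + j * (P' * m)" using \<open>p dvd 1 - m * r\<close> by (simp add: mult.commute)
  define w where "w = x + j * (P' * m)"
  have "w \<in> split_set (p * P') (P' * m) T"
  proof (rule ccontr)
    assume "w \<notin> split_set (p * P') (P' * m) T"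
    then have eq: "w \<in> T \<longleftrightarrow> w + P' * m \<in> T" using w by (auto simp: split_set_def w_def)
    have all: "w + i * (P' * m) \<in> T \<longleftrightarrow> w \<in> T" for i
    proof (cases "p dvd i")
      case True
      then have "d dvd (w + i * (P' * m)) - w" by (auto simp: d_eq)
      then show ?thesis by (rule invariantD(1)[OF T])
    next
      case False
      then show ?thesis using unit_coset[of w w i] w eq by (simp add: w_def)
    qed
    have "x = w + (- j) * (P' * m)" "x + P' * m = w + (1 - j) * (P' * m)"
      by (simp_all add: w_def algebra_simps)
    then show False using x all by metis
  qed
  then show ?thesis by blast
qed

end

end

section \<open>Separating orbits by invariant divisors\<close>

context cyclic_perms
begin

text \<open>The periods of an invariant set form a block. If \<open>x - y\<close> is a period, then
  so is \<open>g x - g y\<close>: write an arbitrary \<open>z\<close> as \<open>g w - g x\<close>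
  modulo \<open>d\<close>, pull it back to \<open>w - x\<close>, add the period to get
  \<open>w - y\<close>, and push forward again.\<close>

lemma stabilizer_compat:
  assumes "compat d" "invariant d T"
  obtains k where "compat k" "k dvd d" "\<And>u. k dvd u \<longleftrightarrow> (\<forall>x. x \<in> T \<longleftrightarrow> x + u \<in> T)"
proof -
  define H where "H = {u. \<forall>x. x \<in> T \<longleftrightarrow> x + u \<in> T}"
  have "x - y \<in> H" if "x \<in> H" "y \<in> H" for x y
  proof -
    have "z \<in> T \<longleftrightarrow> z + (x - y) \<in> T" for z
    proof -
      have "z - y \<in> T \<longleftrightarrow> (z - y) + y \<in> T" "z - y \<in> T \<longleftrightarrow> (z - y) + x \<in> T"
        using that unfolding H_def by blast+
      then show ?thesis by (simp add: algebra_simps)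
    qed
    then show ?thesis by (simp add: H_def)
  qed
  moreover have dH: "d \<in> H" unfolding H_def using invariantD(1)[OF assms(2)] by simp
  ultimately obtain k where k: "k > 0" "\<And>u. u \<in> H \<longleftrightarrow> k dvd u"
    using int_subgroup_principal[of H d] compatD(1)[OF assms(1)] by blast
  have kd: "k dvd d" using k(2) dH by simp
  have "compat k"
    unfolding compat_def
  proof (intro conjI ballI allI impI)
    show "k dvd n" using kd compatD(2)[OF assms(1)] by (rule dvd_trans)
    fix g x y assume g: "g \<in> G" and xy: "k dvd x - y"
    have "z \<in> T \<longleftrightarrow> z + (g x - g y) \<in> T" for z
    proof -
      obtain w where "n dvd g w - (z + g x)" using surjective[OF g] by blast
      then have "d dvd g w - (z + g x)" using compatD(2)[OF assms(1)] dvd_trans by blast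
      then have w1: "d dvd (g w - g x) - z" and w2: "d dvd (g w - g y) - (z + (g x - g y))"
        by (simp_all add: algebra_simps)
      have "z \<in> T \<longleftrightarrow> g w - g x \<in> T" using invariantD(1)[OF assms(2) w1] by simp
      also have "\<dots> \<longleftrightarrow> w - x \<in> T" by (rule invariant_diff[OF assms g])
      also have "\<dots> \<longleftrightarrow> (w - x) + (x - y) \<in> T" using k(2)[of "x - y"] xy unfolding H_def by blast
      also have "(w - x) + (x - y) = w - y" by simp
      also have "w - y \<in> T \<longleftrightarrow> g w - g y \<in> T" by (rule invariant_diff[OF assms g, symmetric])
      also have "\<dots> \<longleftrightarrow> z + (g x - g y) \<in> T" by (rule invariantD(1)[OF assms(2) w2])
      finally show ?thesis .
    qed
    then show "k dvd g x - g y" using k(2) unfolding H_def by blast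
  qed (rule k(1))
  then show ?thesis using that kd k(2) unfolding H_def by blast
qed

lemma orbD:
  assumes "x \<in> orb d t"
  obtains g where "g \<in> G" "g 0 = 0" "d dvd g t - x"
proof -
  obtain g where g: "g \<in> G" "d dvd g 0" "d dvd g t - x" using assms by (auto simp: orb_def)
  have "d dvd (g t - g 0) - x" using dvd_diff[OF g(3,2)] by (simp add: algebra_simps)
  then show ?thesis using that[OF G_shift[OF g(1), of 0 "- g 0"]] by simp
qed

text \<open>Induction on \<open>d\<close>. Suppose that the orbits \<open>T\<close>, \<open>T1\<close> of \<open>t\<close>, \<open>t1\<close> are distinct. By the
  induction hypothesis neither is a union of cosets of a nonzero subgroup. For a prime \<open>p\<close>, let \<open>W\<close> be
  the set of those \<open>x\<close> divisible by the \<open>p\<close>-part of \<open>d\<close> for which exactly one of \<open>x\<close> and \<open>x + d div p\<close>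
  is in \<open>T\<close>; it is nonempty, and invariant by Schur's theorem on prime powers of invariant sets. Let
  \<open>M\<close> be a maximal proper invariant divisor of \<open>d\<close> above all those that divide \<open>t\<close>, and let \<open>p\<close> divide
  \<open>d div M\<close>. Then \<open>W\<close> avoids \<open>T\<close>, and the invariant subgroup generated by the sets \<open>W\<close> of \<open>T\<close> and \<open>T1\<close>
  meets that of \<open>M\<close> trivially. As \<open>T\<close> and \<open>T1\<close> agree modulo \<open>M\<close> by induction, so do their sets
  \<open>W\<close>, which therefore coincide; hence \<open>T\<close> and \<open>T1\<close> meet.\<close>
lemma same_orbit:
  assumes "compat d" "\<And>e. compat e \<Longrightarrow> e dvd d \<Longrightarrow> e dvd t \<longleftrightarrow> e dvd t1"
  shows "t1 \<in> orb d t"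
  using assms
proof (induction "nat d" arbitrary: d t t1 rule: less_induct)
  case less
  note d = less.prems(1) and div = less.prems(2)
  have d0: "d > 0" using compatD(1)[OF d] .
  have IH: "s1 \<in> orb k s"
    if "compat k" "k dvd d" "k < d" "\<And>e. compat e \<Longrightarrow> e dvd d \<Longrightarrow> e dvd s \<longleftrightarrow> e dvd s1" for k s s1
  proof (rule less.hyps)
    show "nat k < nat d" using that(3) d0 by simp
    show "compat k" by fact
    show "e dvd s \<longleftrightarrow> e dvd s1" if "compat e" "e dvd k" for e
      using \<open>\<And>e. compat e \<Longrightarrow> e dvd d \<Longrightarrow> e dvd s \<longleftrightarrow> e dvd s1\<close> that \<open>k dvd d\<close> dvd_trans by blast
  qed
  show ?case
  proof (rule ccontr)
    assume t1: "t1 \<notin> orb d t"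
    have t: "t \<notin> orb d t1"
      using orb_in_invariant[OF d invariant_orb[OF d], of t t1 t] orb_self t1 by blast
    have disjoint: "x \<notin> orb d t1" if "x \<in> orb d t" for x
      using that orb_in_invariant[OF d invariant_orb[OF d]] orb_self t by blast
    define E where "E = {f. compat f \<and> f dvd d \<and> f dvd t}"
    have fin: "finite {f. f dvd d}" using d0 by (intro finite_divisors_int) simp
    have "finite E" by (rule finite_subset[OF _ fin]) (auto simp: E_def)
    have "1 \<in> E" using compat_1 by (simp add: E_def)
    define e where "e = Max E"
    have eE: "e \<in> E" unfolding e_def using \<open>finite E\<close> \<open>1 \<in> E\<close> by (intro Max_in) auto
    have e_max: "f dvd e" if "f \<in> E" for f
    proof -
      have "lcm f e \<in> E" using that eE compat_lcm by (simp add: E_def)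
      then have "lcm f e \<le> e" unfolding e_def using \<open>finite E\<close> by simp
      moreover have "e > 0" using eE compatD(1) by (simp add: E_def)
      ultimately have "lcm f e = e" using zdvd_imp_le[of e "lcm f e"] compatD(1) \<open>lcm f e \<in> E\<close>
        by (simp add: E_def)
      then show ?thesis by (metis dvd_lcm1)
    qed
    have "e \<noteq> d"
    proof
      assume "e = d"
      then have "d dvd t" "d dvd t1" using eE div[OF d] by (auto simp: E_def)
      then have "d dvd t - t1" by simp
      then show False using t1 shift[of 0] by (auto simp: orb_def)
    qed
    define C where "C = {f. compat f \<and> f dvd d \<and> e dvd f \<and> f \<noteq> d}"
    have "finite C" by (rule finite_subset[OF _ fin]) (auto simp: C_def)
    have "e \<in> C" using eE \<open>e \<noteq> d\<close> by (simp add: C_def E_def)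
    define M where "M = Max C"
    have MC: "M \<in> C" unfolding M_def using \<open>finite C\<close> \<open>e \<in> C\<close> by (intro Max_in) auto
    then have M: "compat M" "M dvd d" "e dvd M" "M \<noteq> d" by (auto simp: C_def)
    have M0: "M > 0" using compatD(1)[OF M(1)] .
    have M_less: "M < d" using zdvd_imp_le[OF M(2) d0] M(4) by simp
    have M_max: "lcm f M = d" if "compat f" "f dvd d" "\<not> f dvd M" for f
    proof (rule ccontr)
      assume "lcm f M \<noteq> d"
      then have "lcm f M \<in> C" using that M compat_lcm by (auto simp: C_def intro: dvd_trans)
      then have "lcm f M \<le> M" unfolding M_def using \<open>finite C\<close> by simp
      moreover have "M \<le> lcm f M"
        using compatD(1)[OF compat_lcm[OF that(1) M(1)]] by (intro zdvd_imp_le) auto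
      ultimately show False using that(3) by (metis dvd_lcm1 order_antisym)
    qed
    obtain r where r: "d = M * r" using M(2) by (meson dvdE)
    have "r > 0" using r d0 M0 by (simp add: zero_less_mult_iff)
    moreover have "r \<noteq> 1" using r M(4) by simp
    ultimately have "\<not> is_unit r" by simp
    then obtain p where p: "prime p" "p dvd r" using \<open>r > 0\<close> prime_divisor_exists[of r] by auto
    obtain r' where r': "r = p * r'" using p(2) by (meson dvdE)
    have "p dvd d" using p(2) r by simp
    have "\<not> is_unit p" using p(1) not_prime_unit by blast
    then obtain m where m': "d = p ^ multiplicity p d * m" "\<not> p dvd m"
      using multiplicity_decompose'[of d p] d0 by (metis less_irrefl)
    have "multiplicity p d \<noteq> 0"
    proof
      assume "multiplicity p d = 0"
      then have "d = m" using m'(1) by simp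
      then show False using m'(2) \<open>p dvd d\<close> by simp
    qed
    then obtain b where "multiplicity p d = Suc b" by (meson not0_implies_Suc)
    then have m: "d = p ^ Suc b * m" "\<not> p dvd m" using m' by simp_all
    define P' where "P' = p ^ b"
    have d_eq: "d = p * P' * m" using m(1) by (simp add: P'_def)
    have cop: "coprime p m" using p(1) m(2) prime_imp_coprime by blast
    have P_M: "\<not> p * P' dvd M"
    proof
      assume "p * P' dvd M"
      then obtain c where "M = p * P' * c" by (meson dvdE)
      then have "p * P' * m = p * P' * (c * p * r')" using r r' d_eq by (simp add: ac_simps)
      moreover have "p * P' \<noteq> 0" using d_eq d0 by auto
      ultimately have "m = c * p * r'" by simp
      then show False using m(2) by simp
    qed
    let ?q = "P' * m"
    have p0: "p > 0" using p(1) prime_gt_0_int by blast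
    have q: "d = p * ?q" by (simp add: d_eq)
    have "p * ?q = p * (M * r')"
      unfolding q[symmetric] r r' by (simp only: mult.left_commute)
    then have "?q = M * r'" using p0 by simp
    then have M_q: "M dvd ?q" by simp
    let ?W = "\<lambda>s. split_set (p * P') ?q (orb d s)"
    have inv: "invariant d (?W s)" for s
      by (rule invariant_split_set[OF d invariant_orb[OF d] p(1) d_eq P'_def cop])
    \<comment> \<open>Needed for \<open>t\<close> and for \<open>t1\<close>; the last premise says
      that \<open>s\<close> has the same invariant divisors as \<open>t\<close>, so that the
      \<open>E\<close> and \<open>M\<close> built from \<open>t\<close> serve both.\<close>
    have props: "(\<exists>w. w \<in> ?W s) \<and> ?W s \<inter> orb d s = {}"
      if s: "s1 \<notin> orb d s" "\<And>e. compat e \<Longrightarrow> e dvd d \<Longrightarrow> e dvd s \<longleftrightarrow> e dvd s1"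
        "\<And>e. compat e \<Longrightarrow> e dvd d \<Longrightarrow> e dvd s \<longleftrightarrow> e dvd t" for s s1
    proof
      have "\<exists>x. x \<in> orb d s \<and> x + ?q \<notin> orb d s"
      proof (rule ccontr)
        assume "\<not> ?thesis"
        then have step: "x + ?q \<in> orb d s" if "x \<in> orb d s" for x using that by blast
        have steps: "x + int j * ?q \<in> orb d s" if "x \<in> orb d s" for x j
        proof (induction j)
          case (Suc j)
          then show ?case using step[OF Suc] by (simp add: algebra_simps)
        qed (use that in simp)
        \<comment> \<open>The generator \<open>k\<close> of the period group is a proper divisor of
          \<open>d\<close>. The induction hypothesis joins \<open>s\<close> and \<open>s1\<close>
          modulo \<open>k\<close>, and periodicity lifts this to \<open>d\<close>.\<close>
        obtain k where k: "compat k" "k dvd d" "\<And>u. k dvd u \<longleftrightarrow> (\<forall>x. x \<in> orb d s \<longleftrightarrow> x + u \<in> orb d s)"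
          using stabilizer_compat[OF d invariant_orb[OF d]] by blast
        have "x \<in> orb d s" if "x + ?q \<in> orb d s" for x
        proof -
          have "(x + ?q) + int (nat (p - 1)) * ?q \<in> orb d s" using steps[OF that] .
          moreover have "(x + ?q) + int (nat (p - 1)) * ?q = x + d"
            using p0 q by (simp add: algebra_simps)
          ultimately have "x + d \<in> orb d s" by (simp only:)
          then show ?thesis using invariantD(1)[OF invariant_orb[OF d], of "x + d" x] by simp
        qed
        then have "k dvd ?q" using k(3) step by blast
        moreover have q0: "?q > 0" using q d0 p0 by (simp add: zero_less_mult_iff)
        ultimately have "k \<le> ?q" by (rule zdvd_imp_le)
        also have "?q < d"
          unfolding q using mult_strict_right_mono[OF prime_gt_1_int[OF p(1)] q0] by simp
        finally have "s1 \<in> orb k s" using IH[OF k(1,2)] s(2) by blast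
        then obtain g where g: "g \<in> G" "g 0 = 0" "k dvd g s - s1" using orbD by blast
        have "g s \<in> orb d s"
          using invariantD(2)[OF invariant_orb[OF d] g(1) _ orb_self] g(2) by simp
        moreover have "k dvd s1 - g s" using g(3) by (simp add: dvd_diff_commute)
        ultimately have "g s + (s1 - g s) \<in> orb d s" using k(3) by blast
        then show False using s(1) by simp
      qed
      then show "\<exists>w. w \<in> ?W s"
        using split_set_nonempty[OF d invariant_orb[OF d] p(1) d_eq P'_def cop] by blast
      show "?W s \<inter> orb d s = {}"
      proof (rule ccontr)
        assume "?W s \<inter> orb d s \<noteq> {}"
        then obtain w where w: "w \<in> ?W s" "w \<in> orb d s" by blast
        have "s \<in> ?W s" using orb_in_invariant[OF d inv w(2)] w(1) by blast
        then have "x \<in> ?W s" if "x \<in> orb d s" for x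
          using orb_in_invariant[OF d inv that] by blast
        then have dvdP: "p * P' dvd x" if "x \<in> orb d s" for x
          using that unfolding split_set_def by blast
        \<comment> \<open>The whole orbit now lies in \<open>?W s\<close>, so its generator
          \<open>k\<close> is a multiple of the \<open>p\<close>-part of \<open>d\<close>. But
          \<open>k\<close> divides \<open>s\<close>, hence belongs to \<open>E\<close> and divides
          \<open>M\<close>, which lacks a factor \<open>p\<close> of that part.\<close>
        obtain k where k: "compat k" "k dvd d" "\<And>a. a \<in> orb d s \<Longrightarrow> k dvd a"
          "\<And>c. c dvd d \<Longrightarrow> (\<And>a. a \<in> orb d s \<Longrightarrow> c dvd a) \<Longrightarrow> c dvd k"
          using compat_generated[OF d invariant_orb[OF d]] by blast
        have "p * P' dvd k" by (rule k(4)) (use dvdP d_eq in auto)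
        moreover have "k \<in> E" using k(1,2) k(3)[OF orb_self] s(3) by (simp add: E_def)
        then have "k dvd M" using e_max M(3) dvd_trans by blast
        ultimately show False using P_M dvd_trans by blast
      qed
    qed
    have "(\<exists>w. w \<in> ?W t) \<and> ?W t \<inter> orb d t = {}" using props[OF t1] div by blast
    then obtain w where w: "w \<in> ?W t" "?W t \<inter> orb d t = {}" by blast
    have "(\<exists>w. w \<in> ?W t1) \<and> ?W t1 \<inter> orb d t1 = {}" using props[OF t] div by blast
    then obtain w1 where w1: "w1 \<in> ?W t1" "?W t1 \<inter> orb d t1 = {}" by blast
    have wq: "w + ?q \<in> orb d t" "w1 + ?q \<in> orb d t1"
      using w w1 by (auto simp: split_set_def)
    have coarse: "x \<in> orb M s" if xq: "x + ?q \<in> orb d s" for x s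
    proof -
      obtain g where g: "g \<in> G" "g 0 = 0" "d dvd g s - (x + ?q)" using orbD[OF xq] .
      have "M dvd g s - (x + ?q)" using M(2) g(3) by (rule dvd_trans)
      then have "M dvd (g s - (x + ?q)) + ?q" using M_q by (rule dvd_add)
      then have "M dvd g 0 \<and> M dvd g s - x" using g(2) by simp
      then show ?thesis using g(1) unfolding orb_def by blast
    qed
    have "t1 \<in> orb M t" using IH[OF M(1,2) M_less] div by blast
    moreover have "t \<in> orb M w"
      using orb_in_invariant[OF M(1) invariant_orb[OF M(1)] coarse[OF wq(1)]] orb_self by blast
    ultimately have "w1 \<in> orb M w" using orb_trans[OF M(1)] coarse[OF wq(2)] by blast
    then obtain g where g: "g \<in> G" "g 0 = 0" "M dvd g w - w1" using orbD by blast
    have gw: "g w \<in> ?W t" using invariantD(2)[OF inv g(1) _ w(1)] g(2) by simp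
    obtain k where k: "compat k" "k dvd d" "\<And>a. a \<in> ?W t \<union> ?W t1 \<Longrightarrow> k dvd a"
      "\<And>c. c dvd d \<Longrightarrow> (\<And>a. a \<in> ?W t \<union> ?W t1 \<Longrightarrow> c dvd a) \<Longrightarrow> c dvd k"
      using compat_generated[OF d invariant_Un[OF inv inv]] by blast
    have "p * P' dvd k" by (rule k(4)) (auto simp: d_eq split_set_def)
    then have "\<not> k dvd M" using P_M dvd_trans by blast
    then have "lcm k M = d" by (rule M_max[OF k(1,2)])
    moreover have "k dvd g w - w1" using k(3) gw w1(1) by (meson UnI1 UnI2 dvd_diff)
    ultimately have "d dvd g w - w1" using g(3) lcm_least by metis
    then have "w1 \<in> ?W t" using invariantD(1)[OF inv] gw by blast
    then have "w1 + ?q \<in> orb d t" using w(2) by (auto simp: split_set_def)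
    then show False using disjoint wq(2) by blast
  qed
qed

end

section \<open>Spectra of circulant graphs\<close>

definition root_char :: "nat \<Rightarrow> int \<Rightarrow> complex" where
  "root_char n a = cis (2 * pi * (of_int a / of_nat n))"

lemma root_char_0 [simp]: "root_char n 0 = 1"
  by (simp add: root_char_def)

lemma root_char_add: "root_char n (a + b) = root_char n a * root_char n b"
  by (simp add: root_char_def cis_mult add_divide_distrib distrib_left)

lemma root_char_power: "root_char n a ^ k = root_char n (a * int k)"
  by (induction k) (simp_all add: root_char_add distrib_left)

lemma norm_root_char [simp]: "norm (root_char n a) = 1"
  by (simp add: root_char_def)

lemma root_char_nonzero [simp]: "root_char n a \<noteq> 0"
  by (simp add: root_char_def)

lemma root_char_eq_1_iff:
  assumes "n > 0"
  shows "root_char n a = 1 \<longleftrightarrow> int n dvd a"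
proof
  assume "int n dvd a"
  then obtain k where "a = int n * k" by (meson dvdE)
  then show "root_char n a = 1" using assms by (simp add: root_char_def)
next
  assume "root_char n a = 1"
  then have "cos (2 * pi * (of_int a / of_nat n)) = 1"
    unfolding root_char_def by (metis Re_complex_of_real cis.sel(1) of_real_1)
  moreover define t :: real where "t = of_int a / of_nat n"
  ultimately obtain k :: int where "2 * pi * t = of_int k * 2 * pi"
    using cos_one_2pi_int by blast
  then have "t = of_int k" by simp
  then have "of_int a / of_nat n = (of_int k :: real)" by (simp only: t_def)
  then have "(of_int a :: real) = of_int (k * int n)" using assms by (simp add: field_simps)
  then have "a = k * int n" by (simp only: of_int_eq_iff)
  then show "int n dvd a" by simp
qed

lemma root_char_cong:
  assumes "n > 0" "int n dvd a - b"
  shows "root_char n a = root_char n b"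
  using root_char_add[of n "a - b" b] root_char_eq_1_iff[OF assms(1), of "a - b"] assms(2) by simp

lemma sum_root_char:
  assumes "n > 0"
  shows "(\<Sum>x\<in>{0..<int n}. root_char n (a * x)) = (if int n dvd a then of_nat n else 0)"
proof (cases "int n dvd a")
  case True
  then have "root_char n (a * x) = 1" for x using root_char_eq_1_iff[OF assms] by simp
  then show ?thesis using True by simp
next
  case False
  let ?s = "\<Sum>x\<in>{0..<int n}. root_char n (a * x)"
  have "root_char n a * ?s = (\<Sum>x\<in>{0..<int n}. root_char n (a * (1 + x)))"
    by (simp add: sum_distrib_left distrib_left root_char_add)
  also have "\<dots> = ?s"
    by (rule sum_residues_bij[where f = "\<lambda>x. root_char n (a * x)" and h = "\<lambda>x. 1 + x"])
      (use assms in \<open>auto intro: root_char_cong simp flip: right_diff_distrib\<close>)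
  finally have "(root_char n a - 1) * ?s = 0" by (simp add: algebra_simps)
  then show ?thesis using False root_char_eq_1_iff[OF assms] by simp
qed

lemma fourier_inversion:
  fixes f :: "int \<Rightarrow> complex"
  assumes "n > 0" "y \<in> {0..<int n}"
  shows "(\<Sum>j\<in>{0..<int n}. (\<Sum>x\<in>{0..<int n}. f x * root_char n (j * x)) * root_char n (- (j * y))) =
    of_nat n * f y"
proof -
  have "(\<Sum>j\<in>{0..<int n}. (\<Sum>x\<in>{0..<int n}. f x * root_char n (j * x)) * root_char n (- (j * y))) =
      (\<Sum>j\<in>{0..<int n}. \<Sum>x\<in>{0..<int n}. f x * root_char n ((x - y) * j))"
    unfolding sum_distrib_right
    by (intro sum.cong refl) (simp add: algebra_simps flip: root_char_add)
  also have "\<dots> = (\<Sum>x\<in>{0..<int n}. \<Sum>j\<in>{0..<int n}. f x * root_char n ((x - y) * j))"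
    by (rule sum.swap)
  also have "\<dots> = (\<Sum>x\<in>{0..<int n}. f x * (if int n dvd x - y then of_nat n else 0))"
    by (simp only: sum_root_char[OF assms(1)] flip: sum_distrib_left)
  also have "\<dots> = (\<Sum>x\<in>{0..<int n}. if x = y then of_nat n * f x else 0)"
  proof (intro sum.cong refl)
    fix x assume "x \<in> {0..<int n}"
    then have "int n dvd x - y \<longleftrightarrow> x = y"
      using assms(2) by (metis atLeastLessThan_iff diff_self dvd_0_right mod_eq_dvd_iff mod_pos_pos_trivial)
    then show "f x * (if int n dvd x - y then of_nat n else 0) = (if x = y then of_nat n * f x else 0)"
      by simp
  qed
  also have "\<dots> = of_nat n * f y" using assms(2) by simp
  finally show ?thesis .
qed

lemma sum_int_residues: "(\<Sum>y\<in>{0..<int n}. f y) = (\<Sum>i\<in>{0..<n}. f (int i))"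
  by (rule sum.reindex_bij_witness[of _ int nat]) auto

text \<open>Trades vectors indexed by naturals for functions on residues, where sums can be
  reindexed by translations of Z_n.\<close>

lemma eigenvalue_int_indexed:
  fixes a :: "int \<Rightarrow> int \<Rightarrow> complex"
  shows "eigenvalue (mat n n (\<lambda>(i, j). a (int i) (int j))) c \<longleftrightarrow>
    (\<exists>v. (\<exists>x\<in>{0..<int n}. v x \<noteq> 0) \<and>
       (\<forall>x\<in>{0..<int n}. (\<Sum>y\<in>{0..<int n}. a x y * v y) = c * v x))"
proof
  let ?A = "mat n n (\<lambda>(i, j). a (int i) (int j))"
  assume "eigenvalue ?A c"
  then obtain w where w: "w \<in> carrier_vec n" "w \<noteq> 0\<^sub>v n" "?A *\<^sub>v w = c \<cdot>\<^sub>v w"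
    by (auto simp: eigenvalue_def eigenvector_def)
  define v where "v x = w $ nat x" for x
  obtain i where "i < n" "w $ i \<noteq> 0" using w(1,2) by (metis carrier_vecD eq_vecI index_zero_vec)
  then have "\<exists>x\<in>{0..<int n}. v x \<noteq> 0" by (intro bexI[of _ "int i"]) (auto simp: v_def)
  moreover have "(\<Sum>y\<in>{0..<int n}. a x y * v y) = c * v x" if "x \<in> {0..<int n}" for x
  proof -
    have "(?A *\<^sub>v w) $ nat x = (c \<cdot>\<^sub>v w) $ nat x" using w(3) by simp
    then show ?thesis
      using that w(1) by (simp add: scalar_prod_def sum_int_residues v_def nat_less_iff)
  qed
  ultimately show "\<exists>v. (\<exists>x\<in>{0..<int n}. v x \<noteq> 0) \<and>
       (\<forall>x\<in>{0..<int n}. (\<Sum>y\<in>{0..<int n}. a x y * v y) = c * v x)" by blast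
next
  let ?A = "mat n n (\<lambda>(i, j). a (int i) (int j))"
  assume "\<exists>v. (\<exists>x\<in>{0..<int n}. v x \<noteq> 0) \<and>
       (\<forall>x\<in>{0..<int n}. (\<Sum>y\<in>{0..<int n}. a x y * v y) = c * v x)"
  then obtain v x0 where x0: "x0 \<in> {0..<int n}" "v x0 \<noteq> 0" and
    v: "\<And>x. x \<in> {0..<int n} \<Longrightarrow> (\<Sum>y\<in>{0..<int n}. a x y * v y) = c * v x" by blast
  define w where "w = vec n (\<lambda>i. v (int i))"
  have "w $ nat x0 \<noteq> 0\<^sub>v n $ nat x0" using x0 by (simp add: w_def nat_less_iff)
  then have "w \<noteq> 0\<^sub>v n" by auto
  moreover have "?A *\<^sub>v w = c \<cdot>\<^sub>v w"
  proof (rule eq_vecI)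
    fix i assume "i < dim_vec (c \<cdot>\<^sub>v w)"
    then have i: "i < n" by (simp add: w_def)
    then show "(?A *\<^sub>v w) $ i = (c \<cdot>\<^sub>v w) $ i"
      using v[of "int i"] by (simp add: scalar_prod_def w_def sum_int_residues)
  qed (simp add: w_def)
  ultimately show "eigenvalue ?A c"
    unfolding eigenvalue_def eigenvector_def by (intro exI[of _ w]) (simp add: w_def)
qed

text \<open>The sum is an eigenvalue of the integer circulant matrix with entries
  \<open>a ((k - i) mod n)\<close>, with the \<open>j\<close>-th character as eigenvector. It is
  thus a root of a monic integer polynomial, the characteristic polynomial.\<close>

lemma algebraic_int_root_char_sum:
  fixes a :: "int \<Rightarrow> int"
  assumes "n > 0"
  shows "algebraic_int (\<Sum>s\<in>{0..<int n}. of_int (a s) * root_char n (j * s))" (is "algebraic_int ?l")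
proof -
  let ?M = "mat n n (\<lambda>(i, k). a ((int k - int i) mod int n))"
  have "eigenvalue (mat n n (\<lambda>(i, k). (\<lambda>x y. of_int (a ((y - x) mod int n))) (int i) (int k))) ?l"
  proof (rule eigenvalue_int_indexed[of n "\<lambda>x y. of_int (a ((y - x) mod int n))" ?l, THEN iffD2], intro exI[of _ "\<lambda>x. root_char n (j * x)"] conjI ballI)
    show "\<exists>x\<in>{0..<int n}. root_char n (j * x) \<noteq> 0" using assms by (intro bexI[of _ 0]) auto
    fix x
    have "(\<Sum>y\<in>{0..<int n}. of_int (a ((y - x) mod int n)) * root_char n (j * y)) =
        (\<Sum>y\<in>{0..<int n}. of_int (a ((y - x) mod int n)) * root_char n (j * ((y - x) + x)))"
      by simp
    also have "\<dots> = (\<Sum>s\<in>{0..<int n}. of_int (a (s mod int n)) * root_char n (j * (s + x)))"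
    proof (rule sum_residues_bij[where h = "\<lambda>y. y - x" and f = "\<lambda>s. of_int (a (s mod int n)) * root_char n (j * (s + x))"])
      fix s t assume st: "int n dvd s - t"
      then have "s mod int n = t mod int n" by (simp add: mod_eq_dvd_iff)
      moreover have "int n dvd j * (s + x) - j * (t + x)" using st by (simp flip: right_diff_distrib)
      ultimately show "of_int (a (s mod int n)) * root_char n (j * (s + x)) =
          of_int (a (t mod int n)) * root_char n (j * (t + x))"
        using root_char_cong[OF assms] by metis
    qed (use assms in auto)
    also have "\<dots> = ?l * root_char n (j * x)"
      unfolding sum_distrib_right
      by (intro sum.cong refl) (simp add: distrib_left root_char_add)
    finally show "(\<Sum>y\<in>{0..<int n}. of_int (a ((y - x) mod int n)) * root_char n (j * y)) =
        ?l * root_char n (j * x)" .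
  qed
  moreover have "mat n n (\<lambda>(i, k). (\<lambda>x y. of_int (a ((y - x) mod int n)) :: complex) (int i) (int k)) =
      map_mat of_int ?M" by (rule eq_matI) auto
  ultimately have "eigenvalue (map_mat of_int ?M :: complex mat) ?l" by simp
  then have "poly (char_poly (map_mat of_int ?M)) ?l = 0"
    by (subst (asm) eigenvalue_root_char_poly[of _ n]) auto
  then have "poly (map_poly of_int (char_poly ?M)) ?l = 0"
    by (simp add: of_int_hom.char_poly_hom[of _ n])
  moreover have "lead_coeff (char_poly ?M) = 1" using degree_monic_char_poly[of ?M n] by simp
  ultimately show ?thesis unfolding algebraic_int_altdef_ipoly by blast
qed

text \<open>Reducing exponents modulo \<open>n\<close> does not change the value at an
  \<open>n\<close>-th root of unity and yields a character sum as in
  \<open>algebraic_int_root_char_sum\<close>.\<close>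

lemma algebraic_int_poly_root_char:
  assumes "n > 0"
  shows "algebraic_int (poly (of_int_poly P) (root_char n j))"
proof -
  have "poly (of_int_poly P) (root_char n j) =
      (\<Sum>i\<le>Polynomial.degree P. of_int (poly.coeff P i) * root_char n (j * int i))"
    by (simp add: poly_altdef root_char_power)
  also have "\<dots> = (\<Sum>i\<le>Polynomial.degree P. \<Sum>s\<in>{0..<int n}.
      if int i mod int n = s then of_int (poly.coeff P i) * root_char n (j * int i) else 0)"
    using assms by (intro sum.cong refl) simp
  also have "\<dots> = (\<Sum>s\<in>{0..<int n}. \<Sum>i\<le>Polynomial.degree P.
      if int i mod int n = s then of_int (poly.coeff P i) * root_char n (j * int i) else 0)"
    by (rule sum.swap)
  also have "\<dots> = (\<Sum>s\<in>{0..<int n}. of_int (residue_coeff (int n) s P) * root_char n (j * s))"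
    unfolding residue_coeff_def of_int_sum sum_distrib_right
  proof (intro sum.cong refl)
    fix s i assume s: "s \<in> {0..<int n}"
    have "int i mod int n = s \<longleftrightarrow> int n dvd int i - s"
      using s by (metis atLeastLessThan_iff mod_eq_dvd_iff mod_pos_pos_trivial)
    moreover have "root_char n (j * int i) = root_char n (j * s)" if "int n dvd int i - s"
      using that by (intro root_char_cong[OF assms]) (simp flip: right_diff_distrib)
    ultimately show "(if int i mod int n = s then of_int (poly.coeff P i) * root_char n (j * int i) else 0) =
        of_int (if int n dvd int i - s then poly.coeff P i else 0) * root_char n (j * s)" by simp
  qed
  finally show ?thesis using algebraic_int_root_char_sum[OF assms] by simp
qed

definition circulant_eigenvalue :: "nat \<Rightarrow> int set \<Rightarrow> int \<Rightarrow> complex" where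
  "circulant_eigenvalue n S j = (\<Sum>s\<in>S. root_char n (j * s))"

lemma circulant_eigenvalue_cong:
  assumes "n > 0" "int n dvd i - j"
  shows "circulant_eigenvalue n S i = circulant_eigenvalue n S j"
  unfolding circulant_eigenvalue_def
  by (intro sum.cong refl root_char_cong[OF assms(1)]) (use assms(2) in \<open>simp flip: left_diff_distrib\<close>)

lemma circulant_arc_iff:
  assumes "n > 0" "S \<subseteq> {0..<int n}" "x \<in> {0..<int n}" "y \<in> {0..<int n}"
  shows "(x, y) \<in> parcs (circulant n S) \<longleftrightarrow> (y - x) mod int n \<in> S"
proof
  assume "(x, y) \<in> parcs (circulant n S)"
  then obtain s where s: "s \<in> S" "y = (s + x) mod int n"
    by (auto simp: cayley_digraph_def)
  then have "(y - x) mod int n = s mod int n" by (simp add: mod_diff_left_eq)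
  then show "(y - x) mod int n \<in> S" using s(1) assms(2) by (auto simp: subset_iff)
next
  assume *: "(y - x) mod int n \<in> S"
  have "y = ((y - x) mod int n + x) mod int n" using assms(4) by (simp add: mod_add_left_eq)
  then show "(x, y) \<in> parcs (circulant n S)"
    using * assms(1,3) unfolding cayley_digraph_def
    by (auto simp: carrier_integer_mod_group intro!: exI[of _ "(y - x) mod int n"])
qed

lemma circulant_row_sum:
  assumes "n > 0" "S \<subseteq> {0..<int n}"
  shows "(\<Sum>y\<in>{0..<int n}. (if (y - x) mod int n \<in> S then 1 else 0) * v y) =
    (\<Sum>s\<in>S. v ((x + s) mod int n) :: complex)"
proof -
  have "(\<Sum>y\<in>{0..<int n}. (if (y - x) mod int n \<in> S then 1 else 0) * v y) =
      (\<Sum>y\<in>{0..<int n}. (if (y - x) mod int n \<in> S then 1 else 0) * v (((y - x) + x) mod int n))"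
    by (intro sum.cong) auto
  also have "\<dots> = (\<Sum>s\<in>{0..<int n}. (if s mod int n \<in> S then 1 else 0) * v ((s + x) mod int n))"
  proof (rule sum_residues_bij[where h = "\<lambda>y. y - x" and
        f = "\<lambda>s. (if s mod int n \<in> S then 1 else 0) * v ((s + x) mod int n)"])
    fix s t assume "int n dvd s - t"
    then have "s mod int n = t mod int n" "(s + x) mod int n = (t + x) mod int n"
      by (simp_all add: mod_eq_dvd_iff)
    then show "(if s mod int n \<in> S then 1 else 0) * v ((s + x) mod int n) =
        (if t mod int n \<in> S then 1 else 0) * v ((t + x) mod int n)" by simp
  qed (use assms(1) in auto)
  also have "\<dots> = (\<Sum>s\<in>{0..<int n}. if s \<in> S then v ((x + s) mod int n) else 0)"
    by (intro sum.cong) (auto simp: add.commute)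
  also have "\<dots> = (\<Sum>s\<in>{0..<int n} \<inter> S. v ((x + s) mod int n))"
    by (rule sum.inter_restrict[symmetric]) simp
  also have "{0..<int n} \<inter> S = S" using assms(2) by blast
  finally show ?thesis .
qed

text \<open>A nonzero eigenvector has a nonzero Fourier coefficient at some \<open>j\<close>, and
  the transform turns the adjacency operator into multiplication by the character sum at
  \<open>- j\<close>. Conversely, characters are eigenvectors.\<close>

lemma eigenvalue_circulant_iff:
  assumes n: "n > 0" and S: "S \<subseteq> {0..<int n}"
  shows "eigenvalue (adjacency_mat n (circulant n S)) c \<longleftrightarrow> (\<exists>j. c = circulant_eigenvalue n S j)"
proof -
  have "adjacency_mat n (circulant n S) =
      mat n n (\<lambda>(i, j). (\<lambda>x y. if (y - x) mod int n \<in> S then 1 else 0) (int i) (int j))"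
    unfolding adjacency_mat_def by (rule eq_matI) (auto simp: circulant_arc_iff[OF n S])
  then have *: "eigenvalue (adjacency_mat n (circulant n S)) c \<longleftrightarrow>
      (\<exists>v. (\<exists>x\<in>{0..<int n}. v x \<noteq> 0) \<and>
       (\<forall>x\<in>{0..<int n}. (\<Sum>s\<in>S. v ((x + s) mod int n)) = c * v x))"
    using eigenvalue_int_indexed[of n "\<lambda>x y. if (y - x) mod int n \<in> S then 1 else 0" c]
    by (simp only: circulant_row_sum[OF n S])
  show ?thesis
  proof
    assume "eigenvalue (adjacency_mat n (circulant n S)) c"
    then obtain v where v: "\<exists>x\<in>{0..<int n}. v x \<noteq> 0"
      "\<And>x. x \<in> {0..<int n} \<Longrightarrow> (\<Sum>s\<in>S. v ((x + s) mod int n)) = c * v x" using * by blast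
    let ?F = "\<lambda>j. \<Sum>x\<in>{0..<int n}. v x * root_char n (j * x)"
    obtain j where j: "?F j \<noteq> 0"
    proof -
      obtain y where "y \<in> {0..<int n}" "v y \<noteq> 0" using v(1) by blast
      then have "(\<Sum>j\<in>{0..<int n}. ?F j * root_char n (- (j * y))) \<noteq> 0"
        using fourier_inversion[OF n, of y v] n by simp
      then obtain j where "?F j * root_char n (- (j * y)) \<noteq> 0"
        by (rule sum.not_neutral_contains_not_neutral)
      then show ?thesis using that by simp
    qed
    have "c * ?F j = (\<Sum>x\<in>{0..<int n}. \<Sum>s\<in>S. v ((x + s) mod int n) * root_char n (j * x))"
      unfolding sum_distrib_left
      by (intro sum.cong refl) (simp only: v(2) flip: sum_distrib_right mult.assoc)
    also have "\<dots> = (\<Sum>s\<in>S. \<Sum>x\<in>{0..<int n}. v ((x + s) mod int n) * root_char n (j * x))"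
      by (rule sum.swap)
    also have "\<dots> = (\<Sum>s\<in>S. root_char n (- j * s) * ?F j)"
    proof (intro sum.cong refl)
      fix s
      have "(\<Sum>x\<in>{0..<int n}. v ((x + s) mod int n) * root_char n (j * x)) =
          (\<Sum>x\<in>{0..<int n}. v ((x + s) mod int n) * root_char n (j * ((x + s) - s)))" by simp
      also have "\<dots> = (\<Sum>x\<in>{0..<int n}. v (x mod int n) * root_char n (j * (x - s)))"
      proof (rule sum_residues_bij[where h = "\<lambda>x. x + s" and
            f = "\<lambda>x. v (x mod int n) * root_char n (j * (x - s))"])
        fix x y assume xy: "int n dvd x - y"
        then have "x mod int n = y mod int n" by (simp add: mod_eq_dvd_iff)
        moreover have "int n dvd j * (x - s) - j * (y - s)" using xy by (simp flip: right_diff_distrib)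
        ultimately show "v (x mod int n) * root_char n (j * (x - s)) =
            v (y mod int n) * root_char n (j * (y - s))" using root_char_cong[OF n] by metis
      qed (use n in auto)
      also have "\<dots> = root_char n (- j * s) * ?F j"
        unfolding sum_distrib_left
      proof (intro sum.cong refl)
        fix x assume "x \<in> {0..<int n}"
        moreover have "root_char n (j * (x - s)) = root_char n (- j * s) * root_char n (j * x)"
          by (simp add: algebra_simps flip: root_char_add)
        ultimately show "v (x mod int n) * root_char n (j * (x - s)) =
            root_char n (- j * s) * (v x * root_char n (j * x))" by simp
      qed
      finally show "(\<Sum>x\<in>{0..<int n}. v ((x + s) mod int n) * root_char n (j * x)) =
          root_char n (- j * s) * ?F j" .
    qed
    also have "\<dots> = circulant_eigenvalue n S (- j) * ?F j"
      by (simp add: circulant_eigenvalue_def sum_distrib_right)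
    finally show "\<exists>j. c = circulant_eigenvalue n S j" using j by auto
  next
    assume "\<exists>j. c = circulant_eigenvalue n S j"
    then obtain j where c: "c = circulant_eigenvalue n S j" by blast
    have "(\<Sum>s\<in>S. root_char n (j * ((x + s) mod int n))) = c * root_char n (j * x)" for x
    proof -
      have "root_char n (j * ((x + s) mod int n)) = root_char n (j * s) * root_char n (j * x)" for s
      proof -
        have "int n dvd j * ((x + s) mod int n) - (j * s + j * x)"
          by (simp add: mod_eq_dvd_iff[symmetric] mod_mult_right_eq algebra_simps)
        then show ?thesis using root_char_cong[OF n] by (metis root_char_add)
      qed
      then show ?thesis by (simp add: c circulant_eigenvalue_def sum_distrib_right)
    qed
    moreover have "\<exists>x\<in>{0..<int n}. root_char n (j * x) \<noteq> 0" using n by (intro bexI[of _ 0]) auto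
    ultimately show "eigenvalue (adjacency_mat n (circulant n S)) c"
      unfolding * by (intro exI[of _ "\<lambda>x. root_char n (j * x)"]) blast
  qed
qed

lemma rational_circulant_iff:
  assumes "n > 0" "S \<subseteq> {0..<int n}"
  shows "rational_circulant n S \<longleftrightarrow> (\<forall>j. circulant_eigenvalue n S j \<in> \<rat>)"
  unfolding rational_circulant_def using eigenvalue_circulant_iff[OF assms] by auto

section \<open>Rational eigenvalues and units\<close>

lemma fermat_int:
  assumes "prime p"
  shows "[(a :: int) ^ p = a] (mod int p)"
proof -
  have p: "p > 0" using assms prime_gt_0_nat by blast
  define k where "k = nat (a mod int p)"
  have ak: "[a = int k] (mod int p)" using p by (simp add: k_def cong_def)
  obtain c where c: "(\<Sum>s<k. (1 :: int)) ^ p = (\<Sum>s<k. 1 ^ p) + of_nat p * c"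
    using freshmans_dream_family[OF assms] by blast
  have "[a ^ p = int k ^ p] (mod int p)" using ak by (rule cong_pow)
  also have "int k ^ p = int k + int p * c" using c by simp
  also have "[int k + int p * c = int k] (mod int p)" by (simp add: cong_def)
  also have "[int k = a] (mod int p)" using ak by (rule cong_sym)
  finally show ?thesis .
qed

lemma norm_circulant_eigenvalue_le:
  assumes "S \<subseteq> {0..<int n}"
  shows "norm (circulant_eigenvalue n S j) \<le> n"
proof -
  have "norm (circulant_eigenvalue n S j) \<le> (\<Sum>s\<in>S. norm (root_char n (j * s)))"
    unfolding circulant_eigenvalue_def by (rule norm_sum)
  also have "\<dots> = real (card S)" by simp
  also have "card S \<le> card {0..<int n}" using assms by (intro card_mono) auto
  finally show ?thesis by simp
qed

lemma algebraic_int_circulant_eigenvalue: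
  assumes "n > 0" "S \<subseteq> {0..<int n}"
  shows "algebraic_int (circulant_eigenvalue n S j)"
proof -
  have "(\<Sum>s\<in>{0..<int n}. of_int (if s \<in> S then 1 else 0) * root_char n (j * s)) =
      (\<Sum>s\<in>{0..<int n}. if s \<in> S then root_char n (j * s) else 0)"
    by (intro sum.cong) auto
  also have "\<dots> = (\<Sum>s\<in>{0..<int n} \<inter> S. root_char n (j * s))"
    by (rule sum.inter_restrict[symmetric]) simp
  also have "{0..<int n} \<inter> S = S" using assms(2) by blast
  finally show ?thesis
    using algebraic_int_root_char_sum[OF assms(1), of "\<lambda>s. if s \<in> S then 1 else 0" j]
    by (simp add: circulant_eigenvalue_def)
qed

text \<open>The two sides are integers that are both congruent to the \<open>p\<close>-th power of the right-hand side
  modulo \<open>p\<close>, and they differ by less than \<open>p\<close>.\<close>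
lemma circulant_eigenvalue_large_prime:
  assumes n: "n > 0" and S: "S \<subseteq> {0..<int n}" and rat: "\<And>j. circulant_eigenvalue n S j \<in> \<rat>"
    and p: "prime p" "p > 2 * n"
  shows "circulant_eigenvalue n S (int p * j) = circulant_eigenvalue n S j"
proof -
  let ?l = "circulant_eigenvalue n S"
  have "?l i \<in> \<int>" for i
    using rational_algebraic_int_is_int algebraic_int_circulant_eigenvalue[OF n S] rat by blast
  then obtain a b where a: "?l j = of_int a" and b: "?l (int p * j) = of_int b"
    by (meson Ints_cases)
  obtain Q where "(\<Sum>s\<in>S. monom (1 :: int) (nat s)) ^ p =
      (\<Sum>s\<in>S. monom 1 (nat s) ^ p) + of_nat p * Q"
    using freshmans_dream_family[OF p(1)] by blast
  then have "poly (of_int_poly ((\<Sum>s\<in>S. monom (1 :: int) (nat s)) ^ p)) (root_char n j) =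
      poly (of_int_poly ((\<Sum>s\<in>S. monom 1 (nat s) ^ p) + of_nat p * Q)) (root_char n j)" by simp
  then have "(\<Sum>s\<in>S. root_char n j ^ nat s) ^ p =
      (\<Sum>s\<in>S. (root_char n j ^ nat s) ^ p) + of_nat p * poly (of_int_poly Q) (root_char n j)"
    by (simp add: hom_distribs poly_sum poly_monom)
  moreover have "root_char n j ^ nat s = root_char n (j * s)" if "s \<in> S" for s
    using that S by (auto simp: root_char_power)
  moreover have "(root_char n j ^ nat s) ^ p = root_char n (int p * j * s)" if "s \<in> S" for s
    using that S by (auto simp: root_char_power algebra_simps)
  ultimately have *: "?l j ^ p = ?l (int p * j) + of_nat p * poly (of_int_poly Q) (root_char n j)"
    by (simp add: circulant_eigenvalue_def)
  have p0: "(of_nat p :: complex) \<noteq> 0" using p(1) by auto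
  \<comment> \<open>The cofactor is an algebraic integer as a value of an integer polynomial, and
    rational by this formula. It is therefore an integer, and the congruence modulo \<open>p\<close>
    holds in the integers.\<close>
  have "poly (of_int_poly Q) (root_char n j) = of_int (a ^ p - b) / of_nat p"
    using *[unfolded a b] p0 by (simp add: field_simps)
  then have "poly (of_int_poly Q) (root_char n j) \<in> \<rat>" by simp
  then have "poly (of_int_poly Q) (root_char n j) \<in> \<int>"
    using rational_algebraic_int_is_int algebraic_int_poly_root_char[OF n] by blast
  then obtain q where "poly (of_int_poly Q) (root_char n j) = of_int q" by (meson Ints_cases)
  then have "(of_int (a ^ p) :: complex) = of_int (b + int p * q)" using * a b by simp
  then have "a ^ p = b + int p * q" by (simp only: of_int_eq_iff)
  then have "[a ^ p = b] (mod int p)" by (simp add: cong_def)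
  then have "[b = a] (mod int p)" using fermat_int[OF p(1)] cong_sym cong_trans by metis
  then have dvd: "int p dvd b - a" by (simp add: cong_iff_dvd_diff)
  have "\<bar>real_of_int a\<bar> \<le> n" "\<bar>real_of_int b\<bar> \<le> n"
    using norm_circulant_eigenvalue_le[OF S, of j] norm_circulant_eigenvalue_le[OF S, of "int p * j"]
    unfolding a b by simp_all
  then have "\<bar>b - a\<bar> < int p" using p(2) by linarith
  then have "b - a = 0" using dvd_imp_le_int[OF _ dvd] by linarith
  then show ?thesis by (simp add: a b)
qed

lemma circulant_eigenvalue_large_factors:
  assumes n: "n > 0" and S: "S \<subseteq> {0..<int n}" and rat: "\<And>j. circulant_eigenvalue n S j \<in> \<rat>"
    and "u > 0" "\<And>p. prime p \<Longrightarrow> p dvd u \<Longrightarrow> p > 2 * n"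
  shows "circulant_eigenvalue n S (int u * j) = circulant_eigenvalue n S j"
  using assms(4,5)
proof (induction u arbitrary: j rule: less_induct)
  case (less u)
  show ?case
  proof (cases "u = 1")
    case False
    then obtain p where p: "prime p" "p dvd u" using prime_factor_nat by blast
    then obtain v where v: "u = p * v" by (meson dvdE)
    have "v > 0" using v less.prems(1) by simp
    moreover have "v < u" using v \<open>v > 0\<close> prime_gt_1_nat[OF p(1)] by simp
    ultimately have "circulant_eigenvalue n S (int v * j) = circulant_eigenvalue n S j"
      using less v by simp
    moreover have "circulant_eigenvalue n S (int p * (int v * j)) = circulant_eigenvalue n S (int v * j)"
      using circulant_eigenvalue_large_prime[OF n S rat p(1)] less.prems(2)[OF p] by blast
    ultimately show ?thesis by (simp add: v mult.assoc)
  qed simp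
qed

text \<open>The unit \<open>u\<close> is lifted to a number all of whose prime factors exceed \<open>2 * n\<close>, so that neither
  Dirichlet's theorem nor Galois theory is needed.\<close>
lemma circulant_eigenvalue_unit:
  assumes n: "n > 0" and S: "S \<subseteq> {0..<int n}" and rat: "\<And>j. circulant_eigenvalue n S j \<in> \<rat>"
    and u: "coprime u (int n)"
  shows "circulant_eigenvalue n S (u * j) = circulant_eigenvalue n S j"
proof -
  \<comment> \<open>Being coprime to \<open>(2 * n)!\<close> rules out all prime factors up to
    \<open>2 * n\<close>, the bound that \<open>circulant_eigenvalue_large_prime\<close> asks
    for.\<close>
  define N :: int where "N = int n * fact (2 * n)"
  have N0: "N > 0" using n by (simp add: N_def)
  have nN: "int n dvd N" by (simp add: N_def)
  obtain v where v: "[v = u] (mod int n)" "coprime v N"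
    using unit_lift[OF u nN] N0 by (metis less_irrefl)
  \<comment> \<open>Adding \<open>N\<close> makes the representative positive, so that it can be
    factored as a natural number.\<close>
  define w where "w = v mod N + N"
  have w0: "w > 0" using N0 pos_mod_sign[OF N0, of v] unfolding w_def by linarith
  have Nwv: "N dvd w - v" unfolding w_def
    by (simp add: mod_eq_dvd_iff[symmetric])
  then have "[v = w] (mod N)" by (simp add: cong_iff_dvd_diff dvd_diff_commute)
  then have cop: "coprime w N" using v(2) by (rule cong_imp_coprime)
  have "int n dvd w - v" using nN Nwv by (rule dvd_trans)
  moreover have "int n dvd v - u" using v(1) by (simp add: cong_iff_dvd_diff)
  ultimately have "int n dvd w - u" by (metis diff_add_cancel add_diff_eq dvd_add)
  then have "int n dvd u * j - w * j" by (simp add: dvd_diff_commute flip: left_diff_distrib)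
  then have "circulant_eigenvalue n S (u * j) = circulant_eigenvalue n S (w * j)"
    by (rule circulant_eigenvalue_cong[OF n])
  also have "w * j = int (nat w) * j" using w0 by simp
  also have "circulant_eigenvalue n S (int (nat w) * j) = circulant_eigenvalue n S j"
  proof (rule circulant_eigenvalue_large_factors[OF n S rat])
    fix p assume p: "prime p" "p dvd nat w"
    show "p > 2 * n"
    proof (rule ccontr)
      assume "\<not> ?thesis"
      then have "p dvd fact (2 * n)" using prime_gt_0_nat[OF p(1)] by (intro dvd_fact) auto
      then have "int p dvd int (fact (2 * n))" by (simp only: int_dvd_int_iff)
      then have "int p dvd N" by (simp add: N_def)
      moreover have "int p dvd w" using p(2) w0 int_dvd_int_iff[of p "nat w"] by simp
      ultimately have "is_unit (int p)" using cop coprime_common_divisor by blast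
      then show False using p(1) by simp
    qed
  qed (use w0 in auto)
  finally show ?thesis .
qed

text \<open>Fourier inversion recovers the indicator of \<open>S\<close> from the eigenvalues. As
  these do not change under \<open>j\<close> to \<open>u * j\<close>, the indicator does not change
  under multiplication by the unit \<open>u\<close>, and numbers with equal gcd differ by such a
  unit.\<close>

lemma rational_circulant_imp_gcd_closed:
  assumes n: "n > 0" and S: "S \<subseteq> {0..<int n}" and rat: "rational_circulant n S"
    and xy: "gcd x (int n) = gcd y (int n)"
  shows "x mod int n \<in> S \<longleftrightarrow> y mod int n \<in> S"
proof -
  let ?l = "circulant_eigenvalue n S"
  have rat': "?l j \<in> \<rat>" for j using rat rational_circulant_iff[OF n S] by blast
  have l: "?l j = (\<Sum>x\<in>{0..<int n}. (if x \<in> S then 1 else 0) * root_char n (j * x))" for j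
  proof -
    have "(\<Sum>x\<in>{0..<int n}. (if x \<in> S then 1 else 0) * root_char n (j * x)) =
        (\<Sum>x\<in>{0..<int n}. if x \<in> S then root_char n (j * x) else 0)"
      by (intro sum.cong) auto
    also have "\<dots> = (\<Sum>x\<in>{0..<int n} \<inter> S. root_char n (j * x))"
      by (rule sum.inter_restrict[symmetric]) simp
    also have "{0..<int n} \<inter> S = S" using S by blast
    finally show ?thesis by (simp add: circulant_eigenvalue_def)
  qed
  have inv: "(\<Sum>j\<in>{0..<int n}. ?l j * root_char n (- (j * z))) =
      of_nat n * (if z mod int n \<in> S then 1 else 0)" for z
  proof -
    have "root_char n (- (j * z)) = root_char n (- (j * (z mod int n)))" for j
      by (rule root_char_cong[OF n]) (simp add: mod_eq_dvd_iff[symmetric] mod_minus_cong mod_mult_right_eq)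
    then show ?thesis
      using fourier_inversion[OF n, of "z mod int n" "\<lambda>x. if x \<in> S then 1 else 0"] n
      by (simp add: l)
  qed
  obtain u where u: "coprime u (int n)" "int n dvd u * x - y"
    using gcd_eq_imp_unit_multiple[OF xy dvd_refl] n by auto
  have "(\<Sum>j\<in>{0..<int n}. ?l j * root_char n (- (j * y))) =
      (\<Sum>j\<in>{0..<int n}. ?l (u * j) * root_char n (- ((u * j) * x)))"
  proof (intro sum.cong refl)
    fix j
    have "- (j * y) - - (u * j * x) = j * (u * x - y)" by (simp add: algebra_simps)
    then have "int n dvd - (j * y) - - (u * j * x)" using u(2) by simp
    then have "root_char n (- (j * y)) = root_char n (- (u * j * x))" by (rule root_char_cong[OF n])
    then show "?l j * root_char n (- (j * y)) = ?l (u * j) * root_char n (- ((u * j) * x))"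
      using circulant_eigenvalue_unit[OF n S rat' u(1)] by simp
  qed
  also have "\<dots> = (\<Sum>j\<in>{0..<int n}. ?l j * root_char n (- (j * x)))"
  proof (rule sum_residues_bij[where h = "\<lambda>j. u * j" and f = "\<lambda>j. ?l j * root_char n (- (j * x))"])
    fix i j assume ij: "int n dvd i - j"
    have "- (i * x) - - (j * x) = - ((i - j) * x)" by (simp add: algebra_simps)
    then have "int n dvd - (i * x) - - (j * x)" using ij by simp
    then show "?l i * root_char n (- (i * x)) = ?l j * root_char n (- (j * x))"
      using circulant_eigenvalue_cong[OF n ij] root_char_cong[OF n] by metis
  next
    fix i j assume "int n dvd u * i - u * j"
    then have "int n dvd u * (i - j)" by (simp add: right_diff_distrib)
    then show "int n dvd i - j" using u(1) by (simp add: coprime_dvd_mult_right_iff coprime_commute)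
  qed (use n in simp)
  finally show ?thesis using inv n by (simp split: if_splits)
qed

section \<open>Ramanujan sums and the converse for spectra\<close>

lemma sum_multiples_rational:
  assumes n: "n > 0" and d: "d dvd int n"
  shows "(\<Sum>z\<in>{z \<in> {0..<int n}. d dvd z}. root_char n (j * z)) \<in> \<rat>" (is "?s \<in> _")
proof (cases "root_char n (j * d) = 1")
  case True
  have "root_char n (j * z) = 1" if "d dvd z" for z
  proof -
    have "j * d dvd j * z" using that by simp
    then show ?thesis
      using True unfolding root_char_eq_1_iff[OF n] by (rule dvd_trans[rotated])
  qed
  then have "?s = (\<Sum>z\<in>{z \<in> {0..<int n}. d dvd z}. 1)" by (intro sum.cong) auto
  then show ?thesis by simp
next
  case False
  have s: "?s = (\<Sum>z\<in>{0..<int n}. if d dvd z then root_char n (j * z) else 0)"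
    by (rule sum.inter_filter) simp
  have "root_char n (j * d) * ?s =
      (\<Sum>z\<in>{0..<int n}. if d dvd z + d then root_char n (j * (z + d)) else 0)"
    unfolding s sum_distrib_left
    by (intro sum.cong refl) (simp add: distrib_left root_char_add)
  also have "\<dots> = ?s"
    unfolding s
  proof (rule sum_residues_bij[where h = "\<lambda>z. z + d" and f = "\<lambda>z. if d dvd z then root_char n (j * z) else 0"])
    fix x y assume xy: "int n dvd x - y"
    then have "d dvd x - y" using d dvd_trans by blast
    then have "d dvd x \<longleftrightarrow> d dvd y" by (metis dvd_diff_left_iff dvd_diff_right_iff)
    moreover have "root_char n (j * x) = root_char n (j * y)"
      by (rule root_char_cong[OF n]) (use xy in \<open>simp flip: right_diff_distrib\<close>)
    ultimately show "(if d dvd x then root_char n (j * x) else 0) =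
        (if d dvd y then root_char n (j * y) else 0)" by simp
  qed (use n in auto)
  finally have "(root_char n (j * d) - 1) * ?s = 0" by (simp add: algebra_simps)
  then show ?thesis using False by simp
qed

lemma finite_gcd_class: "finite {z \<in> {0..<int n}. gcd z (int n) = d}"
  by (rule finite_subset[of _ "{0..<int n}"]) auto

text \<open>The sum of a character over the multiples of \<open>d\<close> is 0 or a count, and it
  splits into the sums over the gcd classes of all multiples \<open>e\<close> of \<open>d\<close>
  dividing \<open>n\<close>. Solving for the class of \<open>d\<close> gives an induction downwards
  from \<open>n\<close>, in place of Moebius inversion.\<close>

lemma ramanujan_sum_rational:
  assumes n: "n > 0" and "d dvd int n" "d > 0"
  shows "(\<Sum>z\<in>{z \<in> {0..<int n}. gcd z (int n) = d}. root_char n (j * z)) \<in> \<rat>"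
  using assms(2,3)
proof (induction "nat (int n - d)" arbitrary: d rule: less_induct)
  case less
  let ?R = "\<lambda>d. \<Sum>z\<in>{z \<in> {0..<int n}. gcd z (int n) = d}. root_char n (j * z)"
  let ?D = "{e. e dvd int n \<and> d dvd e \<and> e > 0}"
  have fin: "finite ?D" by (rule finite_subset[OF _ finite_divisors_int[of "int n"]]) (use n in auto)
  have "{z \<in> {0..<int n}. d dvd z} = (\<Union>e\<in>?D. {z \<in> {0..<int n}. gcd z (int n) = e})"
    using less.prems n by auto
  then have "(\<Sum>z\<in>{z \<in> {0..<int n}. d dvd z}. root_char n (j * z)) = (\<Sum>e\<in>?D. ?R e)"
    using fin finite_gcd_class by (simp only:, intro sum.UNION_disjoint) blast+
  also have "\<dots> = ?R d + (\<Sum>e\<in>?D - {d}. ?R e)"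
    by (rule sum.remove[OF fin]) (use less.prems in auto)
  finally have "?R d = (\<Sum>z\<in>{z \<in> {0..<int n}. d dvd z}. root_char n (j * z)) - (\<Sum>e\<in>?D - {d}. ?R e)"
    by simp
  moreover have "(\<Sum>e\<in>?D - {d}. ?R e) \<in> \<rat>"
  proof (rule Rats_sum)
    fix e assume e: "e \<in> ?D - {d}"
    then have "d \<le> e" "e \<le> int n" using n by (auto intro: zdvd_imp_le)
    then show "?R e \<in> \<rat>" using e by (intro less.hyps) auto
  qed
  ultimately show ?case using sum_multiples_rational[OF n less.prems(1)] by simp
qed

lemma gcd_closed_imp_rational_circulant:
  assumes n: "n > 0" and S: "S \<subseteq> {0..<int n}"
    and closed: "\<And>x y. gcd x (int n) = gcd y (int n) \<Longrightarrow> x mod int n \<in> S \<longleftrightarrow> y mod int n \<in> S"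
  shows "rational_circulant n S"
  unfolding rational_circulant_iff[OF n S]
proof
  fix j
  let ?D = "(\<lambda>z. gcd z (int n)) ` S"
  have fin: "finite S" using S finite_subset by blast
  have "S = (\<Union>d\<in>?D. {z \<in> {0..<int n}. gcd z (int n) = d})"
  proof (intro equalityI subsetI)
    fix z assume "z \<in> (\<Union>d\<in>?D. {z \<in> {0..<int n}. gcd z (int n) = d})"
    then obtain s where s: "s \<in> S" "z \<in> {0..<int n}" "gcd z (int n) = gcd s (int n)" by blast
    then have "z mod int n = z" "s mod int n = s" using S by (auto simp: subset_iff)
    then show "z \<in> S" using closed[OF s(3)] s(1) by simp
  qed (use S in auto)
  then have "circulant_eigenvalue n S j =
      (\<Sum>z\<in>(\<Union>d\<in>?D. {z \<in> {0..<int n}. gcd z (int n) = d}). root_char n (j * z))"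
    unfolding circulant_eigenvalue_def by simp
  also have "\<dots> = (\<Sum>d\<in>?D. \<Sum>z\<in>{z \<in> {0..<int n}. gcd z (int n) = d}. root_char n (j * z))"
    using fin finite_gcd_class by (intro sum.UNION_disjoint) blast+
  also have "\<dots> \<in> \<rat>"
  proof (rule Rats_sum)
    fix d assume "d \<in> ?D"
    then have "d dvd int n" "d > 0" using n by auto
    then show "(\<Sum>z\<in>{z \<in> {0..<int n}. gcd z (int n) = d}. root_char n (j * z)) \<in> \<rat>"
      by (rule ramanujan_sum_rational[OF n])
  qed
  finally show "circulant_eigenvalue n S j \<in> \<rat>" .
qed

section \<open>Mixed radix digits and generalized wreath products\<close>

text \<open>A common form for the automorphisms of a digraph (a single relation, indexed by
  \<open>()\<close>), of a family of congruences, and of agreement on sets of coordinates, so that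
  one lemma moves all of them along a bijection.\<close>

definition rel_auts :: "'a set \<Rightarrow> 'i set \<Rightarrow> ('i \<Rightarrow> 'a \<Rightarrow> 'a \<Rightarrow> bool) \<Rightarrow> ('a \<Rightarrow> 'a) set" where
  "rel_auts Y I \<rho> = {g \<in> Bij Y. \<forall>i\<in>I. \<forall>x\<in>Y. \<forall>y\<in>Y. \<rho> i (g x) (g y) \<longleftrightarrow> \<rho> i x y}"

definition conj_perm :: "'a set \<Rightarrow> 'b set \<Rightarrow> ('a \<Rightarrow> 'b) \<Rightarrow> ('a \<Rightarrow> 'a) \<Rightarrow> 'b \<Rightarrow> 'b" where
  "conj_perm Y Y' \<phi> g = (\<lambda>y\<in>Y'. \<phi> (g (inv_into Y \<phi> y)))"

lemma perm_isomorphic_iff: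
  "perm_isomorphic Y K Y' K' \<longleftrightarrow> (\<exists>\<phi>. bij_betw \<phi> Y Y' \<and> K' = conj_perm Y Y' \<phi> ` K)"
  by (simp add: perm_isomorphic_def conj_perm_def[abs_def])

lemma Bij_mem: "g \<in> Bij Y \<Longrightarrow> x \<in> Y \<Longrightarrow> g x \<in> Y"
  by (auto simp: Bij_def bij_betw_def)

lemma rel_auts_cong:
  assumes "\<And>i x y. i \<in> I \<Longrightarrow> x \<in> Y \<Longrightarrow> y \<in> Y \<Longrightarrow> \<rho> i x y \<longleftrightarrow> \<rho>' i x y"
  shows "rel_auts Y I \<rho> = rel_auts Y I \<rho>'"
proof -
  have "g \<in> rel_auts Y I \<rho> \<longleftrightarrow> g \<in> rel_auts Y I \<rho>'" for g
  proof (cases "g \<in> Bij Y")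
    case True
    then show ?thesis using assms Bij_mem[OF True] by (simp add: rel_auts_def)
  qed (simp add: rel_auts_def)
  then show ?thesis by blast
qed

lemma rel_auts_image: "rel_auts Y (f ` I) \<rho> = rel_auts Y I (\<lambda>i. \<rho> (f i))"
  by (simp add: rel_auts_def)

lemma conj_perm_apply:
  assumes "bij_betw \<phi> Y Y'" "x \<in> Y"
  shows "conj_perm Y Y' \<phi> g (\<phi> x) = \<phi> (g x)"
  using assms by (auto simp: conj_perm_def bij_betw_def)

lemma conj_perm_Bij:
  assumes "bij_betw \<phi> Y Y'" "g \<in> Bij Y"
  shows "conj_perm Y Y' \<phi> g \<in> Bij Y'"
proof -
  have "bij_betw (\<phi> \<circ> (g \<circ> inv_into Y \<phi>)) Y' Y'"
    using bij_betw_inv_into[OF assms(1)] assms by (intro bij_betw_trans) (auto simp: Bij_def)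
  then have "bij_betw (conj_perm Y Y' \<phi> g) Y' Y'"
    by (rule bij_betw_cong[THEN iffD1, rotated]) (simp add: conj_perm_def)
  then show ?thesis by (simp add: Bij_def conj_perm_def)
qed

lemma conj_perm_compose:
  assumes "bij_betw \<phi> Y Y'" "bij_betw \<psi> Y' Y''" "g \<in> Bij Y"
  shows "conj_perm Y' Y'' \<psi> (conj_perm Y Y' \<phi> g) = conj_perm Y Y'' (\<psi> \<circ> \<phi>) g"
proof
  fix z
  show "conj_perm Y' Y'' \<psi> (conj_perm Y Y' \<phi> g) z = conj_perm Y Y'' (\<psi> \<circ> \<phi>) g z"
  proof (cases "z \<in> Y''")
    case True
    then obtain x where x: "x \<in> Y" "z = \<psi> (\<phi> x)"
      using assms(1,2) unfolding bij_betw_def by blast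
    have "\<phi> x \<in> Y'" using x(1) assms(1) by (auto simp: bij_betw_def)
    then show ?thesis
      using conj_perm_apply[OF assms(2), of "\<phi> x"] conj_perm_apply[OF assms(1) x(1)]
        conj_perm_apply[OF bij_betw_trans[OF assms(1,2)] x(1)] by (simp add: x(2))
  qed (simp add: conj_perm_def)
qed

lemma conj_perm_inverse:
  assumes "bij_betw \<phi> Y Y'" "h \<in> Bij Y'"
  shows "conj_perm Y Y' \<phi> (conj_perm Y' Y (inv_into Y \<phi>) h) = h"
proof -
  have "conj_perm Y' Y' (\<phi> \<circ> inv_into Y \<phi>) h y = h y" for y
  proof (cases "y \<in> Y'")
    case True
    have b: "bij_betw (\<phi> \<circ> inv_into Y \<phi>) Y' Y'"
      using bij_betw_inv_into[OF assms(1)] assms(1) by (rule bij_betw_trans)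
    have "conj_perm Y' Y' (\<phi> \<circ> inv_into Y \<phi>) h ((\<phi> \<circ> inv_into Y \<phi>) y) = (\<phi> \<circ> inv_into Y \<phi>) (h y)"
      by (rule conj_perm_apply[OF b True])
    then show ?thesis
      using True Bij_mem[OF assms(2) True] assms(1) by (simp add: bij_betw_inv_into_right)
  next
    case False
    then show ?thesis using assms(2) by (simp add: conj_perm_def Bij_def extensional_def)
  qed
  then show ?thesis
    using conj_perm_compose[OF bij_betw_inv_into[OF assms(1)] assms] by (simp add: fun_eq_iff)
qed

lemma conj_perm_rel_auts:
  assumes \<phi>: "bij_betw \<phi> Y Y'"
    and \<rho>: "\<And>i x y. i \<in> I \<Longrightarrow> x \<in> Y \<Longrightarrow> y \<in> Y \<Longrightarrow> \<rho>' i (\<phi> x) (\<phi> y) \<longleftrightarrow> \<rho> i x y"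
  shows "conj_perm Y Y' \<phi> ` rel_auts Y I \<rho> = rel_auts Y' I \<rho>'"
proof (intro equalityI subsetI)
  fix h assume "h \<in> conj_perm Y Y' \<phi> ` rel_auts Y I \<rho>"
  then obtain g where g: "g \<in> rel_auts Y I \<rho>" and h: "h = conj_perm Y Y' \<phi> g" by blast
  have gB: "g \<in> Bij Y" using g by (simp add: rel_auts_def)
  have "\<rho>' i (h x) (h y) \<longleftrightarrow> \<rho>' i x y" if "i \<in> I" "x \<in> Y'" "y \<in> Y'" for i x y
  proof -
    have "x \<in> \<phi> ` Y" "y \<in> \<phi> ` Y" using that \<phi> by (simp_all add: bij_betw_def)
    then obtain u v where uv: "u \<in> Y" "v \<in> Y" "x = \<phi> u" "y = \<phi> v" by blast
    have "h x = \<phi> (g u)" "h y = \<phi> (g v)" using conj_perm_apply[OF \<phi>] uv by (simp_all add: h)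
    then show ?thesis
      using g uv \<rho>[OF that(1)] Bij_mem[OF gB] that(1) by (simp add: rel_auts_def)
  qed
  then show "h \<in> rel_auts Y' I \<rho>'" using conj_perm_Bij[OF \<phi> gB] by (simp add: rel_auts_def h)
next
  fix h assume h: "h \<in> rel_auts Y' I \<rho>'"
  then have hB: "h \<in> Bij Y'" by (simp add: rel_auts_def)
  let ?g = "conj_perm Y' Y (inv_into Y \<phi>) h"
  have gB: "?g \<in> Bij Y" by (rule conj_perm_Bij[OF bij_betw_inv_into[OF \<phi>] hB])
  have hg: "conj_perm Y Y' \<phi> ?g = h" by (rule conj_perm_inverse[OF \<phi> hB])
  have "\<rho> i (?g x) (?g y) \<longleftrightarrow> \<rho> i x y" if "i \<in> I" "x \<in> Y" "y \<in> Y" for i x y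
  proof -
    have "\<phi> x \<in> Y'" "\<phi> y \<in> Y'" using that \<phi> by (auto simp: bij_betw_def)
    then have "\<rho>' i (h (\<phi> x)) (h (\<phi> y)) \<longleftrightarrow> \<rho>' i (\<phi> x) (\<phi> y)"
      using h that(1) by (simp add: rel_auts_def)
    moreover have "h (\<phi> z) = \<phi> (?g z)" if "z \<in> Y" for z
      using conj_perm_apply[OF \<phi> that, of ?g] by (simp add: hg)
    ultimately show ?thesis using \<rho> that Bij_mem[OF gB] by simp
  qed
  then have "?g \<in> rel_auts Y I \<rho>" using gB by (simp add: rel_auts_def)
  then show "h \<in> conj_perm Y Y' \<phi> ` rel_auts Y I \<rho>" using hg by (metis image_eqI)
qed

section \<open>Mixed radix digits over a weighted poset\<close>

locale weighted_poset =
  fixes r :: nat and R :: "nat rel" and m :: "nat \<Rightarrow> nat"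
  assumes poset: "increasing_poset r R"
    and m_ge_2: "\<And>i. i \<in> {1..r} \<Longrightarrow> m i \<ge> 2"
    and coprime_incomparable: "\<And>i j. i \<in> {1..r} \<Longrightarrow> j \<in> {1..r} \<Longrightarrow> (i, j) \<notin> R \<Longrightarrow> (j, i) \<notin> R \<Longrightarrow>
      coprime (m i) (m j)"
begin

abbreviation over where "over \<equiv> strictly_above R"

definition up_set :: "nat set \<Rightarrow> bool" where
  "up_set J \<longleftrightarrow> J \<subseteq> {1..r} \<and> (\<forall>i\<in>J. over i \<subseteq> J)"

definition weight :: "nat set \<Rightarrow> int" where
  "weight J = (\<Prod>j\<in>J. int (m j))"

abbreviation total where "total \<equiv> weight {1..r}"

text \<open>For a chain these are the usual mixed radix digits. In general the place value of
  \<open>j\<close> is the product of the radices strictly above \<open>j\<close> only, so that this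
  digit depends only on \<open>z\<close> modulo \<open>weight (insert j (over j))\<close>.\<close>

definition digit :: "nat \<Rightarrow> int \<Rightarrow> int" where
  "digit j z = (z div weight (over j)) mod int (m j)"

text \<open>Digits start at 0 but the coordinate sets are \<open>{1..m i}\<close>, hence the added
  1.\<close>

definition digits :: "int \<Rightarrow> nat \<Rightarrow> nat" where
  "digits z = (\<lambda>i\<in>{1..r}. nat (digit i z) + 1)"

abbreviation digit_space where "digit_space \<equiv> gwp_domain r (\<lambda>i. {1..m i})"

lemma R_range: "(i, j) \<in> R \<Longrightarrow> i \<in> {1..r} \<and> j \<in> {1..r}"
  using poset unfolding increasing_poset_def partial_order_on_def preorder_on_def refl_on_def by blast

lemma R_trans: "(i, j) \<in> R \<Longrightarrow> (j, k) \<in> R \<Longrightarrow> (i, k) \<in> R"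
  using poset unfolding increasing_poset_def partial_order_on_def preorder_on_def
  by (meson transD)

lemma R_antisym: "(i, j) \<in> R \<Longrightarrow> (j, i) \<in> R \<Longrightarrow> i = j"
  using poset unfolding increasing_poset_def partial_order_on_def by (meson antisymD)

lemma aboveD: "j \<in> over i \<Longrightarrow> i < j \<and> i \<in> {1..r} \<and> j \<in> {1..r}"
  using poset R_range unfolding strictly_above_def increasing_poset_def by fastforce

lemma above_trans: "k \<in> over j \<Longrightarrow> j \<in> over i \<Longrightarrow> k \<in> over i"
  using R_trans R_antisym unfolding strictly_above_def by blast

lemma up_set_above: "up_set (over i)"
  using aboveD above_trans unfolding up_set_def by blast

lemma up_set_insert_above: "i \<in> {1..r} \<Longrightarrow> up_set (insert i (over i))"
  using aboveD above_trans unfolding up_set_def by blast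

lemma up_set_full: "up_set {1..r}"
  using aboveD unfolding up_set_def by blast

lemma finite_up_set: "up_set J \<Longrightarrow> finite J"
  unfolding up_set_def using finite_subset by blast

lemma finite_above: "finite (over i)"
  using finite_up_set up_set_above by blast

lemma not_above_self: "i \<notin> over i"
  by (simp add: strictly_above_def)

lemma weight_pos: "J \<subseteq> {1..r} \<Longrightarrow> weight J > 0"
  unfolding weight_def using m_ge_2 by (intro prod_pos) fastforce

lemma weight_insert: "finite J \<Longrightarrow> j \<notin> J \<Longrightarrow> weight (insert j J) = int (m j) * weight J"
  by (simp add: weight_def)

lemma weight_Un: "finite J \<Longrightarrow> finite K \<Longrightarrow> J \<inter> K = {} \<Longrightarrow> weight (J \<union> K) = weight J * weight K"
  unfolding weight_def by (rule prod.union_disjoint)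

lemma weight_dvd: "up_set K \<Longrightarrow> J \<subseteq> K \<Longrightarrow> weight J dvd weight K"
  unfolding weight_def using finite_up_set by (intro prod_dvd_prod_subset)

lemma dvd_mult_digit_iff:
  fixes a k x y :: int
  assumes "a > 0"
  shows "a * k dvd x - y \<longleftrightarrow> a dvd x - y \<and> (x div a) mod k = (y div a) mod k"
proof (cases "a dvd x - y")
  case True
  then have "x mod a = y mod a" by (simp add: mod_eq_dvd_iff)
  then have "x - y = a * (x div a - y div a)"
    by (metis add_diff_cancel_right' diff_diff_eq2 mult_div_mod_eq right_diff_distrib add.commute diff_add_eq)
  then show ?thesis using True assms by (simp add: mod_eq_dvd_iff)
qed (auto dest: dvd_mult_left)

lemma weight_insert_above_dvd_iff:
  assumes "j \<in> {1..r}"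
  shows "weight (insert j (over j)) dvd x - y \<longleftrightarrow> weight (over j) dvd x - y \<and> digit j x = digit j y"
  using dvd_mult_digit_iff[OF weight_pos, of "over j" "int (m j)" x y] up_set_above[of j]
  unfolding weight_insert[OF finite_above not_above_self] digit_def up_set_def
  by (simp add: mult.commute)

text \<open>Since the poset is increasing, the numerically least \<open>j\<close> in
  \<open>J\<close> is minimal, and removing it leaves an up-set. The elements of \<open>J\<close>
  other than \<open>j\<close> and those above it are incomparable to \<open>j\<close>, so their
  weight is coprime to \<open>m j\<close>. Hence \<open>weight J\<close> is the lcm of the weights
  of \<open>J - {j}\<close> and \<open>insert j (over j)\<close>, and the latter adds precisely the
  condition on digit \<open>j\<close>.\<close>

lemma weight_dvd_iff:
  assumes "up_set J"
  shows "weight J dvd x - y \<longleftrightarrow> (\<forall>j\<in>J. digit j x = digit j y)"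
  using assms
proof (induction "card J" arbitrary: J)
  case 0
  then show ?case using finite_up_set by (simp add: weight_def)
next
  case (Suc k)
  have fin: "finite J" using Suc.prems by (rule finite_up_set)
  have "J \<noteq> {}" using Suc.hyps(2) by auto
  define j where "j = Min J"
  have j: "j \<in> J" "\<And>i. i \<in> J \<Longrightarrow> j \<le> i" using fin \<open>J \<noteq> {}\<close> by (auto simp: j_def)
  have jr: "j \<in> {1..r}" and sub: "over j \<subseteq> J" using j(1) Suc.prems by (auto simp: up_set_def)
  let ?K = "J - {j}" and ?B = "J - insert j (over j)"
  have "j \<notin> over i" if "i \<in> J" for i using j(2)[OF that] aboveD by fastforce
  then have upK: "up_set ?K" using Suc.prems unfolding up_set_def by blast
  have K_eq: "?K = over j \<union> ?B" using sub not_above_self by blast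
  have J_eq: "J = insert j ?K" using j(1) by blast
  have "coprime (int (m j)) (weight ?B)"
    unfolding weight_def
  proof (rule prod_coprime_right)
    fix i assume i: "i \<in> ?B"
    then have ir: "i \<in> {1..r}" using Suc.prems by (auto simp: up_set_def)
    have "(j, i) \<notin> R" using i by (auto simp: strictly_above_def)
    moreover have "(i, j) \<notin> R"
      using i \<open>\<And>i. i \<in> J \<Longrightarrow> j \<notin> over i\<close> by (auto simp: strictly_above_def)
    ultimately show "coprime (int (m j)) (int (m i))"
      using coprime_incomparable[OF jr ir] by simp
  qed
  then have "lcm (weight (over j) * weight ?B) (weight (over j) * int (m j)) =
      normalize (weight (over j) * (weight ?B * int (m j)))"
    by (simp add: lcm_mult_left lcm_coprime coprime_commute normalize_mult abs_mult)
  moreover have "weight ?K = weight (over j) * weight ?B"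
    by (subst K_eq, rule weight_Un) (use fin finite_above in auto)
  moreover have "weight (insert j (over j)) = weight (over j) * int (m j)"
    using weight_insert[OF finite_above not_above_self] by simp
  moreover have "weight J = int (m j) * weight ?K"
    by (subst J_eq, rule weight_insert) (use fin in auto)
  moreover have "weight J > 0" using Suc.prems weight_pos by (simp add: up_set_def)
  ultimately have "weight J = lcm (weight ?K) (weight (insert j (over j)))"
    by (simp add: ac_simps)
  then have "weight J dvd x - y \<longleftrightarrow> weight ?K dvd x - y \<and> weight (insert j (over j)) dvd x - y"
    by simp
  also have "weight ?K dvd x - y \<longleftrightarrow> (\<forall>i\<in>?K. digit i x = digit i y)"
    by (rule Suc.hyps(1)) (use Suc.hyps(2) upK j(1) fin in auto)
  also have "weight (insert j (over j)) dvd x - y \<longleftrightarrow> weight (over j) dvd x - y \<and> digit j x = digit j y"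
    by (rule weight_insert_above_dvd_iff[OF jr])
  finally have *: "weight J dvd x - y \<longleftrightarrow> (\<forall>i\<in>?K. digit i x = digit i y) \<and>
      weight (over j) dvd x - y \<and> digit j x = digit j y" .
  have "weight (over j) dvd x - y" if "\<forall>i\<in>?K. digit i x = digit i y"
  proof -
    have "weight ?K dvd x - y"
      using that \<open>weight ?K dvd x - y \<longleftrightarrow> (\<forall>i\<in>?K. digit i x = digit i y)\<close> by blast
    then show ?thesis unfolding \<open>weight ?K = weight (over j) * weight ?B\<close> by (rule dvd_mult_left)
  qed
  then show ?case unfolding * using j(1) by blast
qed

lemma digits_eq_iff:
  assumes "j \<in> {1..r}"
  shows "digits x j = digits y j \<longleftrightarrow> digit j x = digit j y"
proof -
  have "m j > 0" using m_ge_2[OF assms] by simp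
  then have "digit j x \<ge> 0" "digit j y \<ge> 0" by (simp_all add: digit_def)
  then show ?thesis using assms by (simp add: digits_def eq_nat_nat_iff)
qed

lemma weight_dvd_iff_digits:
  assumes "up_set J"
  shows "weight J dvd x - y \<longleftrightarrow> (\<forall>j\<in>J. digits x j = digits y j)"
  using weight_dvd_iff[OF assms] digits_eq_iff assms unfolding up_set_def by (meson subset_iff)

lemma digits_mem: "digits z \<in> digit_space"
  unfolding gwp_domain_def
proof (rule PiE_I)
  fix j assume j: "j \<in> {1..r}"
  then have "m j > 0" using m_ge_2[OF j] by simp
  then have "digit j z \<ge> 0" "digit j z < int (m j)" by (simp_all add: digit_def)
  then show "digits z j \<in> {1..m j}" using j by (simp add: digits_def nat_less_iff)
qed (auto simp: digits_def)

lemma finite_dom: "finite digit_space"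
  unfolding gwp_domain_def by (intro finite_PiE) auto

lemma card_dom: "int (card digit_space) = total"
  unfolding gwp_domain_def weight_def by (simp add: card_PiE)

lemma domD: "x \<in> digit_space \<Longrightarrow> j \<in> {1..r} \<Longrightarrow> x j \<in> {1..m j}"
  unfolding gwp_domain_def by (rule PiE_mem)

lemma dom_eqI:
  assumes "x \<in> digit_space" "y \<in> digit_space" "\<And>j. j \<in> {1..r} \<Longrightarrow> x j = y j"
  shows "x = y"
  using assms unfolding gwp_domain_def by (intro PiE_ext[of x "{1..r}" _ y]) auto

lemma bij_betw_digits: "bij_betw digits {0..<total} digit_space"
proof -
  have "inj_on digits {0..<total}"
  proof (rule inj_onI)
    fix x y assume "x \<in> {0..<total}" "y \<in> {0..<total}" "digits x = digits y"
    then have "total dvd x - y" using weight_dvd_iff_digits[OF up_set_full] by simp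
    then have "x mod total = y mod total" by (simp add: mod_eq_dvd_iff)
    then show "x = y" using \<open>x \<in> _\<close> \<open>y \<in> _\<close> by simp
  qed
  moreover have "digits ` {0..<total} = digit_space"
  proof (rule card_subset_eq[OF finite_dom])
    show "digits ` {0..<total} \<subseteq> digit_space" using digits_mem by blast
    show "card (digits ` {0..<total}) = card digit_space"
      using card_image[OF calculation] card_dom by simp
  qed
  ultimately show ?thesis by (simp add: bij_betw_def)
qed

abbreviation agree_on :: "nat set \<Rightarrow> (nat \<Rightarrow> nat) \<Rightarrow> (nat \<Rightarrow> nat) \<Rightarrow> bool" where
  "agree_on J x y \<equiv> \<forall>j\<in>J. x j = y j"

abbreviation congruence_auts :: "(int \<Rightarrow> int) set" where
  "congruence_auts \<equiv> rel_auts {0..<total} (Collect up_set) (\<lambda>J x y. weight J dvd x - y)"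

lemma conj_perm_congruence_auts:
  "conj_perm {0..<total} digit_space digits ` congruence_auts =
   rel_auts digit_space (Collect up_set) agree_on"
  by (rule conj_perm_rel_auts[OF bij_betw_digits]) (simp add: weight_dvd_iff_digits)

section \<open>The generalized wreath product as the group preserving agreement on up-sets\<close>

definition wreath_perm :: "(nat \<Rightarrow> (nat \<Rightarrow> nat) \<Rightarrow> nat \<Rightarrow> nat) \<Rightarrow> (nat \<Rightarrow> nat) \<Rightarrow> nat \<Rightarrow> nat" where
  "wreath_perm f = (\<lambda>x\<in>digit_space. \<lambda>i\<in>{1..r}. f i (restrict x (over i)) (x i))"

definition wreath_maps :: "(nat \<Rightarrow> (nat \<Rightarrow> nat) \<Rightarrow> nat \<Rightarrow> nat) set" where
  "wreath_maps = {f. \<forall>i\<in>{1..r}. f i \<in> (\<Pi>\<^sub>E j\<in>over i. {1..m j}) \<rightarrow> Bij {1..m i}}"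

lemma restrict_over_mem: "x \<in> digit_space \<Longrightarrow> restrict x (over i) \<in> (\<Pi>\<^sub>E j\<in>over i. {1..m j})"
  using domD aboveD by fastforce

lemma wreath_maps_Bij:
  "f \<in> wreath_maps \<Longrightarrow> i \<in> {1..r} \<Longrightarrow> x \<in> digit_space \<Longrightarrow> f i (restrict x (over i)) \<in> Bij {1..m i}"
  using restrict_over_mem unfolding wreath_maps_def by blast

lemma upd_mem: "x \<in> digit_space \<Longrightarrow> i \<in> {1..r} \<Longrightarrow> a \<in> {1..m i} \<Longrightarrow> x(i := a) \<in> digit_space"
  unfolding gwp_domain_def by (auto simp: PiE_iff extensional_def)

text \<open>The first \<open>k\<close> factors change only coordinates up to \<open>k\<close>,
  whereas factor \<open>k + 1\<close> reads its own coordinate and those above it, which have larger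
  indices. Every factor therefore still sees the original \<open>x\<close>, and the product has a
  closed form.\<close>

lemma fold_factors:
  assumes f: "f \<in> wreath_maps" and x: "x \<in> digit_space" and "k \<le> r"
  shows "fold (\<lambda>i h. compose digit_space
      (\<lambda>x\<in>digit_space. x(i := f i (restrict x (over i)) (x i))) h) [1..<Suc k] (\<lambda>x\<in>digit_space. x) x =
    (\<lambda>i. if i \<in> {1..k} then f i (restrict x (over i)) (x i) else x i) \<and>
    (\<lambda>i. if i \<in> {1..k} then f i (restrict x (over i)) (x i) else x i) \<in> digit_space"
  using assms(3)
proof (induction k)
  case 0
  then show ?case using x by simp
next
  case (Suc k)
  let ?y = "\<lambda>k i. if i \<in> {1..k} then f i (restrict x (over i)) (x i) else x i"
  have y: "?y k \<in> digit_space" using Suc by simp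
  have k: "Suc k \<in> {1..r}" using Suc.prems by simp
  have re: "restrict (?y k) (over (Suc k)) = restrict x (over (Suc k))"
    by (rule restrict_ext) (use aboveD in fastforce)
  have upd0: "(?y k)(Suc k := f (Suc k) (restrict x (over (Suc k))) (x (Suc k))) = ?y (Suc k)"
    by (auto simp: fun_eq_iff)
  have "?y k (Suc k) = x (Suc k)" by simp
  then have upd: "(?y k)(Suc k := f (Suc k) (restrict (?y k) (over (Suc k))) (?y k (Suc k))) = ?y (Suc k)"
    unfolding re using upd0 by (simp only:)
  have "f (Suc k) (restrict x (over (Suc k))) (x (Suc k)) \<in> {1..m (Suc k)}"
    by (rule Bij_mem[OF wreath_maps_Bij[OF f k x] domD[OF x k]])
  then have "(?y k)(Suc k := f (Suc k) (restrict x (over (Suc k))) (x (Suc k))) \<in> digit_space"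
    by (rule upd_mem[OF y k])
  then have y': "?y (Suc k) \<in> digit_space" unfolding upd0 .
  let ?F = "\<lambda>k. fold (\<lambda>i h. compose digit_space
      (\<lambda>x\<in>digit_space. x(i := f i (restrict x (over i)) (x i))) h) [1..<Suc k] (\<lambda>x\<in>digit_space. x)"
  have Fk: "?F k x = ?y k" using Suc.IH Suc_leD[OF Suc.prems] by blast
  have upt: "[1..<Suc (Suc k)] = [1..<Suc k] @ [Suc k]" by simp
  have "?F (Suc k) = compose digit_space
      (\<lambda>x\<in>digit_space. x(Suc k := f (Suc k) (restrict x (over (Suc k))) (x (Suc k)))) (?F k)"
    by (simp only: upt fold_append fold.simps comp_apply id_apply)
  then have "?F (Suc k) x = (\<lambda>x\<in>digit_space. x(Suc k := f (Suc k) (restrict x (over (Suc k))) (x (Suc k)))) (?F k x)"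
    using x by (simp only: compose_eq)
  also have "\<dots> = ?y (Suc k)" unfolding Fk restrict_apply'[OF y] by (rule upd)
  finally show ?case using y' by blast
qed

lemma gen_wreath_product_eq:
  "gen_wreath_product r R (\<lambda>i. {1..m i}) (\<lambda>i. carrier (BijGroup {1..m i})) = wreath_perm ` wreath_maps"
proof -
  let ?F = "\<lambda>f. fold (\<lambda>i h. compose digit_space
      (\<lambda>x\<in>digit_space. x(i := f i (restrict x (over i)) (x i))) h) [1..<Suc r] (\<lambda>x\<in>digit_space. x)"
  have F: "?F f = wreath_perm f" if f: "f \<in> wreath_maps" for f
  proof
    fix x
    show "?F f x = wreath_perm f x"
    proof (cases "x \<in> digit_space")
      case True
      have "x i = undefined" if "i \<notin> {1..r}" for i
        using True that unfolding gwp_domain_def by (rule PiE_arb)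
      then show ?thesis
        using fold_factors[OF f True order_refl] True by (auto simp: wreath_perm_def fun_eq_iff)
    next
      case False
      have "fold (\<lambda>i h. compose digit_space (g i) h) is (\<lambda>x\<in>digit_space. x) x = undefined"
        for g :: "nat \<Rightarrow> (nat \<Rightarrow> nat) \<Rightarrow> nat \<Rightarrow> nat" and "is"
        by (induction "is" rule: rev_induct) (use False in \<open>auto simp: compose_def\<close>)
      then show ?thesis using False by (simp add: wreath_perm_def del: upt_Suc)
    qed
  qed
  have cong: "fold (\<lambda>i h. compose digit_space (g i) h) [1..<Suc r] id0 =
      fold (\<lambda>i h. compose digit_space (g' i) h) [1..<Suc r] id0"
    if "\<forall>i\<in>{1..r}. g i = g' i" for g g' :: "nat \<Rightarrow> (nat \<Rightarrow> nat) \<Rightarrow> nat \<Rightarrow> nat" and id0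
    by (rule fold_cong) (use that in auto)
  show ?thesis
  proof (intro equalityI subsetI)
    fix h assume "h \<in> gen_wreath_product r R (\<lambda>i. {1..m i}) (\<lambda>i. carrier (BijGroup {1..m i}))"
    then obtain g where g: "\<forall>i\<in>{1..r}. g i \<in> gwp_factor r R (\<lambda>i. {1..m i}) (\<lambda>i. carrier (BijGroup {1..m i})) i"
      and h: "h = fold (\<lambda>i h. compose digit_space (g i) h) [1..<Suc r] (\<lambda>x\<in>digit_space. x)"
      unfolding gen_wreath_product_def by blast
    have "\<forall>i\<in>{1..r}. \<exists>f. f \<in> (\<Pi>\<^sub>E j\<in>over i. {1..m j}) \<rightarrow> Bij {1..m i} \<and>
        g i = (\<lambda>x\<in>digit_space. x(i := f (restrict x (over i)) (x i)))"
      using g unfolding gwp_factor_def BijGroup_def by fastforce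
    from bchoice[OF this] obtain f where f: "\<forall>i\<in>{1..r}. f i \<in> (\<Pi>\<^sub>E j\<in>over i. {1..m j}) \<rightarrow> Bij {1..m i} \<and>
        g i = (\<lambda>x\<in>digit_space. x(i := f i (restrict x (over i)) (x i)))"
      by blast
    then have "f \<in> wreath_maps" by (simp add: wreath_maps_def)
    moreover have "h = ?F f" unfolding h by (rule cong) (use f in blast)
    ultimately show "h \<in> wreath_perm ` wreath_maps" using F by blast
  next
    fix h assume "h \<in> wreath_perm ` wreath_maps"
    then obtain f where f: "f \<in> wreath_maps" "h = wreath_perm f" by blast
    show "h \<in> gen_wreath_product r R (\<lambda>i. {1..m i}) (\<lambda>i. carrier (BijGroup {1..m i}))"
      unfolding gen_wreath_product_def mem_Collect_eq
    proof (intro exI conjI ballI)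
      show "h = fold (\<lambda>i h. compose digit_space
          ((\<lambda>i. \<lambda>x\<in>digit_space. x(i := f i (restrict x (over i)) (x i))) i) h) [1..<Suc r] (\<lambda>x\<in>digit_space. x)"
        using F[OF f(1)] f(2) by simp
      fix i assume "i \<in> {1..r}"
      then have "f i \<in> (\<Pi>\<^sub>E j\<in>over i. {1..m j}) \<rightarrow> Bij {1..m i}" using f(1) by (simp add: wreath_maps_def)
      then show "(\<lambda>x\<in>digit_space. x(i := f i (restrict x (over i)) (x i)))
          \<in> gwp_factor r R (\<lambda>i. {1..m i}) (\<lambda>i. carrier (BijGroup {1..m i})) i"
        unfolding gwp_factor_def BijGroup_def by auto
    qed
  qed
qed

text \<open>From the images the coordinates are recovered from the top of the poset downwards: once
  those above \<open>i\<close> agree, both \<open>i\<close>-th coordinates have passed through the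
  same permutation. Elements above \<open>i\<close> have larger indices, so \<open>r - i\<close>
  decreases.\<close>

lemma wreath_perm_agree_on:
  assumes f: "f \<in> wreath_maps" and J: "up_set J" and xy: "x \<in> digit_space" "y \<in> digit_space"
  shows "agree_on J (wreath_perm f x) (wreath_perm f y) \<longleftrightarrow> agree_on J x y"
proof
  have Jr: "i \<in> {1..r}" if "i \<in> J" for i using J that by (auto simp: up_set_def)
  have over: "j \<in> J" if "i \<in> J" "j \<in> over i" for i j using J that by (auto simp: up_set_def)
  {
    assume eq: "agree_on J x y"
    have "restrict x (over i) = restrict y (over i)" if "i \<in> J" for i
      by (rule restrict_ext) (use eq over that in blast)
    then show "agree_on J (wreath_perm f x) (wreath_perm f y)"
      using xy eq Jr by (simp add: wreath_perm_def)
  next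
    assume eq: "agree_on J (wreath_perm f x) (wreath_perm f y)"
    have "x i = y i" if "i \<in> J" for i
      using that
    proof (induction "r - i" arbitrary: i rule: less_induct)
      case less
      note i = Jr[OF less.prems]
      have "restrict x (over i) = restrict y (over i)"
      proof (rule restrict_ext)
        fix j assume j: "j \<in> over i"
        show "x j = y j"
          by (rule less.hyps) (use aboveD[OF j] over[OF less.prems j] in auto)
      qed
      moreover have "wreath_perm f x i = wreath_perm f y i" using eq less.prems by blast
      ultimately have "f i (restrict x (over i)) (x i) = f i (restrict x (over i)) (y i)"
        using xy i by (simp add: wreath_perm_def)
      moreover have "inj_on (f i (restrict x (over i))) {1..m i}"
        using wreath_maps_Bij[OF f i xy(1)] by (simp add: Bij_def bij_betw_def)
      ultimately show "x i = y i" using domD xy i by (metis inj_onD)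
    qed
    then show "agree_on J x y" by blast
  }
qed

lemma wreath_perm_mem:
  assumes "f \<in> wreath_maps" "x \<in> digit_space"
  shows "wreath_perm f x \<in> digit_space"
  unfolding gwp_domain_def
proof (rule PiE_I)
  fix i assume i: "i \<in> {1..r}"
  show "wreath_perm f x i \<in> {1..m i}"
    using Bij_mem[OF wreath_maps_Bij[OF assms(1) i assms(2)] domD[OF assms(2) i]] i assms(2)
    by (simp add: wreath_perm_def)
qed (use assms(2) in \<open>auto simp: wreath_perm_def\<close>)

text \<open>If \<open>h\<close> preserves agreement on \<open>insert i (over i)\<close>, then
  \<open>h x i\<close> depends only on \<open>x i\<close> and the coordinates above
  \<open>i\<close>; this defines the component at \<open>i\<close>. It is injective because
  \<open>h\<close> preserves agreement on \<open>over i\<close> and also reflects agreement on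
  \<open>insert i (over i)\<close>.\<close>

lemma wreath_perm_image: "wreath_perm ` wreath_maps = rel_auts digit_space (Collect up_set) agree_on"
proof (intro equalityI subsetI)
  fix h assume "h \<in> wreath_perm ` wreath_maps"
  then obtain f where f: "f \<in> wreath_maps" "h = wreath_perm f" by blast
  have "inj_on h digit_space"
  proof (rule inj_onI)
    fix x y assume xy: "x \<in> digit_space" "y \<in> digit_space" "h x = h y"
    then have "agree_on {1..r} x y"
      using wreath_perm_agree_on[OF f(1) up_set_full xy(1,2)] by (simp add: f(2))
    then show "x = y" using xy by (intro dom_eqI) auto
  qed
  moreover have "h ` digit_space \<subseteq> digit_space" using wreath_perm_mem f by blast
  ultimately have "bij_betw h digit_space digit_space"
    using finite_dom by (simp add: bij_betw_def endo_inj_surj)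
  moreover have "h \<in> extensional digit_space" by (simp add: f(2) wreath_perm_def)
  ultimately show "h \<in> rel_auts digit_space (Collect up_set) agree_on"
    using wreath_perm_agree_on[OF f(1)] unfolding rel_auts_def Bij_def f(2) by blast
next
  fix h assume h: "h \<in> rel_auts digit_space (Collect up_set) agree_on"
  then have hB: "h \<in> Bij digit_space" by (simp add: rel_auts_def)
  have pres: "agree_on J (h x) (h y) \<longleftrightarrow> agree_on J x y"
    if "up_set J" "x \<in> digit_space" "y \<in> digit_space" for J x y
    using h that by (simp add: rel_auts_def)
  \<comment> \<open>Any point with the prescribed coordinates at \<open>i\<close> and above serves;
    by preservation of agreement the choice does not affect \<open>h\<close> at
    \<open>i\<close>.\<close>
  define ext where "ext i \<xi> a = (SOME x. x \<in> digit_space \<and> restrict x (over i) = \<xi> \<and> x i = a)"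
    for i and \<xi> :: "nat \<Rightarrow> nat" and a :: nat
  have ext: "ext i \<xi> a \<in> digit_space \<and> restrict (ext i \<xi> a) (over i) = \<xi> \<and> ext i \<xi> a i = a"
    if i: "i \<in> {1..r}" and \<xi>: "\<xi> \<in> (\<Pi>\<^sub>E j\<in>over i. {1..m j})" and a: "a \<in> {1..m i}" for i \<xi> a
  proof -
    \<comment> \<open>The filler 1 belongs to every coordinate set \<open>{1..m j}\<close>.\<close>
    define x where "x = (\<lambda>j\<in>{1..r}. if j = i then a else if j \<in> over i then \<xi> j else 1)"
    have "x \<in> digit_space"
      unfolding gwp_domain_def x_def
    proof (rule restrict_PiE_iff[THEN iffD2], intro ballI)
      fix j assume "j \<in> {1..r}"
      then show "(if j = i then a else if j \<in> over i then \<xi> j else 1) \<in> {1..m j}"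
        using a PiE_mem[OF \<xi>, of j] m_ge_2[of j] by auto
    qed
    moreover have "restrict x (over i) = \<xi>"
    proof
      fix j
      show "restrict x (over i) j = \<xi> j"
      proof (cases "j \<in> over i")
        case True
        then show ?thesis using aboveD[OF True] by (auto simp: x_def)
      next
        case False
        then show ?thesis using PiE_arb[OF \<xi> False] by simp
      qed
    qed
    moreover have "x i = a" using i by (simp add: x_def)
    ultimately show ?thesis unfolding ext_def by (metis (mono_tags, lifting) someI)
  qed
  define f where "f i \<xi> = (\<lambda>a\<in>{1..m i}. h (ext i \<xi> a) i)" for i \<xi>
  have h_eq: "h x i = f i (restrict x (over i)) (x i)" if x: "x \<in> digit_space" and i: "i \<in> {1..r}" for x i
  proof -
    let ?z = "ext i (restrict x (over i)) (x i)"
    have z: "?z \<in> digit_space" "restrict ?z (over i) = restrict x (over i)" "?z i = x i"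
      using ext[OF i restrict_over_mem[OF x] domD[OF x i]] by auto
    have "agree_on (insert i (over i)) ?z x"
      using z(2,3) by (metis insert_iff restrict_apply')
    then have "agree_on (insert i (over i)) (h ?z) (h x)"
      using pres[OF up_set_insert_above[OF i] z(1) x] by blast
    then show ?thesis using domD[OF x i] by (simp add: f_def)
  qed
  have "f \<in> wreath_maps"
    unfolding wreath_maps_def
  proof (intro CollectI ballI funcsetI)
    fix i \<xi> assume i: "i \<in> {1..r}" and \<xi>: "\<xi> \<in> (\<Pi>\<^sub>E j\<in>over i. {1..m j})"
    note e = ext[OF i \<xi>]
    have "inj_on (f i \<xi>) {1..m i}"
    proof (rule inj_onI)
      fix a b assume ab: "a \<in> {1..m i}" "b \<in> {1..m i}" "f i \<xi> a = f i \<xi> b"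
      have "agree_on (over i) (ext i \<xi> a) (ext i \<xi> b)"
        using e[OF ab(1)] e[OF ab(2)] by (metis restrict_apply')
      then have "agree_on (over i) (h (ext i \<xi> a)) (h (ext i \<xi> b))"
        using pres[OF up_set_above] e[OF ab(1)] e[OF ab(2)] by blast
      moreover have "h (ext i \<xi> a) i = h (ext i \<xi> b) i" using ab by (simp add: f_def)
      ultimately have "agree_on (insert i (over i)) (h (ext i \<xi> a)) (h (ext i \<xi> b))" by blast
      then have "agree_on (insert i (over i)) (ext i \<xi> a) (ext i \<xi> b)"
        using pres[OF up_set_insert_above[OF i]] e[OF ab(1)] e[OF ab(2)] by blast
      then show "a = b" using e[OF ab(1)] e[OF ab(2)] by simp
    qed
    moreover have "f i \<xi> ` {1..m i} \<subseteq> {1..m i}"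
    proof (intro subsetI, elim imageE)
      fix b a assume a: "a \<in> {1..m i}" and b: "b = f i \<xi> a"
      have "h (ext i \<xi> a) \<in> digit_space" using Bij_mem[OF hB] e[OF a] by blast
      then have "h (ext i \<xi> a) i \<in> {1..m i}" using i by (rule domD)
      then show "b \<in> {1..m i}" using a b by (simp add: f_def)
    qed
    ultimately have "bij_betw (f i \<xi>) {1..m i} {1..m i}" by (simp add: bij_betw_def endo_inj_surj)
    then show "f i \<xi> \<in> Bij {1..m i}" by (simp add: Bij_def f_def)
  qed
  moreover have "h = wreath_perm f"
  proof
    fix x
    show "h x = wreath_perm f x"
    proof (cases "x \<in> digit_space")
      case True
      show ?thesis
      proof (rule dom_eqI)
        show "h x \<in> digit_space" using Bij_mem[OF hB True] .
        show "wreath_perm f x \<in> digit_space" using wreath_perm_mem[OF \<open>f \<in> wreath_maps\<close> True] .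
        show "h x j = wreath_perm f x j" if "j \<in> {1..r}" for j
          using h_eq[OF True that] True that by (simp add: wreath_perm_def)
      qed
    next
      case False
      then show ?thesis using hB by (auto simp: wreath_perm_def Bij_def extensional_def)
    qed
  qed
  ultimately show "h \<in> wreath_perm ` wreath_maps" by blast
qed

lemma perm_isomorphic_congruence_auts:
  "perm_isomorphic {0..<total} congruence_auts digit_space
     (gen_wreath_product r R (\<lambda>i. {1..m i}) (\<lambda>i. carrier (BijGroup {1..m i})))"
  unfolding perm_isomorphic_iff gen_wreath_product_eq wreath_perm_image
  by (intro exI[of _ digits] conjI bij_betw_digits conj_perm_congruence_auts[symmetric])

end

section \<open>Lattices of invariant congruences\<close>

locale divisor_lattice =
  fixes L :: "int set" and N :: int
  assumes N_pos: "N > 0"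
    and L_pos: "d \<in> L \<Longrightarrow> d > 0"
    and L_dvd: "d \<in> L \<Longrightarrow> d dvd N"
    and one_L: "1 \<in> L"
    and N_L: "N \<in> L"
    and lcm_L: "a \<in> L \<Longrightarrow> b \<in> L \<Longrightarrow> lcm a b \<in> L"
    and gcd_L: "a \<in> L \<Longrightarrow> b \<in> L \<Longrightarrow> gcd a b \<in> L"
begin

lemma finite_L: "finite L"
  by (rule finite_subset[OF _ finite_divisors_int[of N]]) (use L_dvd N_pos in auto)

lemma Lcm_L: "A \<subseteq> L \<Longrightarrow> Lcm A \<in> L"
proof -
  assume A: "A \<subseteq> L"
  then have "finite A" using finite_L finite_subset by blast
  then show ?thesis using A by (induction A) (auto simp: one_L lcm_L)
qed

text \<open>For a join-irreducible \<open>j\<close> this is its unique lower cover; otherwise it is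
  \<open>j\<close> itself. In particular \<open>lower 1\<close> is the empty lcm 1, so 1 does not
  count as irreducible.\<close>

definition lower :: "int \<Rightarrow> int" where
  "lower j = Lcm {d \<in> L. d dvd j \<and> d \<noteq> j}"

definition irr :: "int set" where
  "irr = {j \<in> L. lower j \<noteq> j}"

lemma finite_irr: "finite irr"
  using finite_L by (simp add: irr_def)

lemma irr_L: "j \<in> irr \<Longrightarrow> j \<in> L"
  by (simp add: irr_def)

lemma lower_L: "lower j \<in> L"
  unfolding lower_def by (rule Lcm_L) auto

lemma lower_dvd: "lower j dvd j"
  unfolding lower_def by (rule Lcm_least) auto

lemma dvd_lower: "d \<in> L \<Longrightarrow> d dvd j \<Longrightarrow> d \<noteq> j \<Longrightarrow> d dvd lower j"
  unfolding lower_def by (rule dvd_Lcm) auto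

lemma Lcm_irr: "d \<in> L \<Longrightarrow> Lcm {k \<in> irr. k dvd d} = d"
proof (induction "nat d" arbitrary: d rule: less_induct)
  case less
  have d0: "d > 0" using L_pos less.prems by blast
  have "d dvd Lcm {k \<in> irr. k dvd d}"
  proof (cases "d \<in> irr")
    case True
    then show ?thesis by (intro dvd_Lcm) auto
  next
    case False
    then have "d = lower d" using less.prems by (simp add: irr_def)
    also have "lower d dvd Lcm {k \<in> irr. k dvd d}"
      unfolding lower_def
    proof (rule Lcm_least)
      fix e assume e: "e \<in> {e \<in> L. e dvd d \<and> e \<noteq> d}"
      then have "e < d" using zdvd_imp_le[of e d] d0 by auto
      then have "Lcm {k \<in> irr. k dvd e} = e" using less.hyps[of e] e d0 by simp
      moreover have "Lcm {k \<in> irr. k dvd e} dvd Lcm {k \<in> irr. k dvd d}"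
        using e by (intro Lcm_least dvd_Lcm) (auto intro: dvd_trans)
      ultimately show "e dvd Lcm {k \<in> irr. k dvd d}" by simp
    qed
    finally show ?thesis .
  qed
  moreover have "Lcm {k \<in> irr. k dvd d} dvd d" by (rule Lcm_least) auto
  ultimately show ?case using d0 by (intro zdvd_antisym_nonneg) auto
qed

text \<open>Remove the largest \<open>j\<close> from \<open>J\<close>. By distributivity the gcd of
  \<open>j\<close> with the lcm of the rest is the lcm of the gcds with its members, all of them
  proper divisors of \<open>j\<close> in \<open>L\<close>; so it divides \<open>lower j\<close>.
  Conversely the irreducibles below \<open>lower j\<close> remain in the rest. Thus the gcd is
  \<open>lower j\<close>, and adding \<open>j\<close> multiplies the lcm by
  \<open>j div lower j\<close>.\<close>

lemma prod_irr_quotients: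
  assumes "J \<subseteq> irr" "\<And>i k. i \<in> J \<Longrightarrow> k \<in> irr \<Longrightarrow> k dvd i \<Longrightarrow> k \<in> J"
  shows "(\<Prod>j\<in>J. j div lower j) = Lcm J"
  using assms
proof (induction "card J" arbitrary: J)
  case 0
  then have "J = {}" using finite_subset[OF 0(2) finite_irr] by simp
  then show ?case by simp
next
  case (Suc k)
  have fin: "finite J" using Suc.prems(1) finite_irr by (rule finite_subset)
  have "J \<noteq> {}" using Suc.hyps(2) by auto
  define j where "j = Max J"
  have j: "j \<in> J" "\<And>i. i \<in> J \<Longrightarrow> i \<le> j" using fin \<open>J \<noteq> {}\<close> by (auto simp: j_def)
  let ?K = "J - {j}"
  have JL: "J \<subseteq> L" using Suc.prems(1) irr_L by blast
  have j0: "j > 0" using j(1) JL L_pos by blast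
  have IH: "(\<Prod>j\<in>?K. j div lower j) = Lcm ?K"
  proof (rule Suc.hyps(1))
    fix i l assume il: "i \<in> ?K" "l \<in> irr" "l dvd i"
    have "i > 0" using il(1) JL L_pos by blast
    then have "l \<le> i" using il(3) by (intro zdvd_imp_le)
    moreover have "i < j" using j(2)[of i] il(1) by auto
    ultimately show "l \<in> ?K" using Suc.prems(2)[of i l] il by auto
  qed (use Suc.hyps(2) Suc.prems(1) fin j(1) in auto)
  have not_dvd: "\<not> j dvd i" if "i \<in> ?K" for i
  proof
    assume "j dvd i"
    have "i > 0" using that JL L_pos by blast
    then have "j \<le> i" using \<open>j dvd i\<close> by (intro zdvd_imp_le)
    then show False using j(2)[of i] that by auto
  qed
  have "gcd j (Lcm A) dvd lower j" if "A \<subseteq> ?K" for A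
    using finite_subset[OF that] fin that
  proof (induction A rule: infinite_finite_induct)
    case (insert a A)
    have "gcd j a \<noteq> j" using not_dvd[of a] insert.prems by (metis gcd_dvd2 insert_subset)
    then have "gcd j a dvd lower j" using gcd_L j(1) insert.prems JL by (intro dvd_lower) auto
    moreover have "gcd j (Lcm A) dvd lower j" using insert by simp
    ultimately have "lcm (gcd j a) (gcd j (Lcm A)) dvd lower j" by (rule lcm_least)
    then show ?case by (simp add: gcd_lcm_distrib)
  next
    case empty
    then show ?case by simp
  next
    case (infinite A)
    then show ?case by simp
  qed
  then have "gcd j (Lcm ?K) dvd lower j" by blast
  moreover have "lower j dvd Lcm ?K"
    unfolding lower_def
  proof (rule Lcm_least)
    fix d assume d: "d \<in> {d \<in> L. d dvd j \<and> d \<noteq> j}"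
    then have "d < j" using zdvd_imp_le[of d j] j0 by auto
    have "{k \<in> irr. k dvd d} \<subseteq> ?K"
    proof
      fix l assume l: "l \<in> {k \<in> irr. k dvd d}"
      have "d > 0" using d L_pos by blast
      then have "l \<le> d" using l by (auto intro: zdvd_imp_le)
      moreover have "l dvd j" using l d dvd_trans by blast
      ultimately show "l \<in> ?K" using Suc.prems(2)[OF j(1), of l] l \<open>d < j\<close> by auto
    qed
    then have "Lcm {k \<in> irr. k dvd d} dvd Lcm ?K"
      by (intro Lcm_least dvd_Lcm) blast
    then show "d dvd Lcm ?K" using Lcm_irr[of d] d by simp
  qed
  then have "lower j dvd gcd j (Lcm ?K)" using lower_dvd by simp
  ultimately have gcd: "gcd j (Lcm ?K) = lower j"
    using L_pos[OF lower_L, of j] by (intro zdvd_antisym_nonneg) simp_all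
  have "Lcm ?K > 0" by (rule L_pos[OF Lcm_L]) (use JL in auto)
  have "Lcm J = lcm j (Lcm ?K)" using j(1) by (metis Lcm_insert insert_Diff)
  also have "\<dots> = j * Lcm ?K div lower j"
    using j0 \<open>Lcm ?K > 0\<close> L_pos[OF lower_L, of j]
    by (simp add: lcm_gcd gcd pos_imp_zdiv_nonneg_iff)
  also have "\<dots> = (j div lower j) * Lcm ?K" using lower_dvd by (simp add: dvd_div_mult)
  also have "\<dots> = (\<Prod>j\<in>J. j div lower j)"
    using prod.remove[OF fin j(1), of "\<lambda>j. j div lower j"] IH by simp
  finally show ?case by simp
qed

lemma quotient_ge_2:
  assumes "j \<in> irr"
  shows "j div lower j \<ge> 2"
proof -
  have j0: "j > 0" and l0: "lower j > 0" using L_pos irr_L[OF assms] lower_L by blast+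
  obtain q where q: "j = lower j * q" using lower_dvd by (meson dvdE)
  have "q > 0" using q j0 l0 by (metis zero_less_mult_pos)
  moreover have "q \<noteq> 1" using q assms by (auto simp: irr_def)
  moreover have "j div lower j = q" using l0 by (subst q) simp
  ultimately show ?thesis by simp
qed

text \<open>Let a prime \<open>p\<close> divide both quotients, and let \<open>k\<close> be the
  smaller of its multiplicities in \<open>lower i\<close> and \<open>lower j\<close>. Then
  \<open>p ^ Suc k\<close> divides \<open>i\<close> and \<open>j\<close>, hence their gcd. For
  incomparable \<open>i\<close> and \<open>j\<close> this gcd is an element of \<open>L\<close>
  properly dividing both, so it divides both lower covers, against the choice of
  \<open>k\<close>.\<close>

lemma coprime_quotients:
  assumes i: "i \<in> irr" and j: "j \<in> irr" and ij: "\<not> i dvd j" "\<not> j dvd i"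
  shows "coprime (i div lower i) (j div lower j)"
proof (rule ccontr)
  assume nc: "\<not> ?thesis"
  let ?a = "lower i" and ?b = "lower j"
  have pos: "i > 0" "j > 0" "?a > 0" "?b > 0" using L_pos irr_L i j lower_L by blast+
  have "gcd (i div ?a) (j div ?b) \<noteq> 0" using quotient_ge_2[OF i] by auto
  moreover have "\<not> is_unit (gcd (i div ?a) (j div ?b))" using nc is_unit_gcd by blast
  ultimately obtain p where p: "prime p" "p dvd gcd (i div ?a) (j div ?b)"
    using prime_divisor_exists by blast
  have "?a * p dvd ?a * (i div ?a)" "?b * p dvd ?b * (j div ?b)" using p(2) by simp_all
  then have pi: "?a * p dvd i" and pj: "?b * p dvd j" using lower_dvd by simp_all
  define k where "k = min (multiplicity p ?a) (multiplicity p ?b)"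
  have pe: "prime_elem p" "\<not> is_unit p" using p(1) not_prime_unit by auto
  have "p ^ k dvd ?a" "p ^ k dvd ?b"
    unfolding k_def using multiplicity_dvd' by (metis min.cobounded1, metis min.cobounded2)
  then have "p ^ Suc k dvd i" "p ^ Suc k dvd j"
    using pi pj by (metis dvd_trans dvd_refl mult_dvd_mono power_Suc2)+
  then have pg: "p ^ Suc k dvd gcd i j" by simp
  have "gcd i j \<in> L" using gcd_L irr_L i j by blast
  moreover have "gcd i j \<noteq> i" "gcd i j \<noteq> j" using ij by (metis gcd_dvd2, metis gcd_dvd1)
  ultimately have "gcd i j dvd ?a" "gcd i j dvd ?b" by (auto intro: dvd_lower)
  then have "p ^ Suc k dvd ?a" "p ^ Suc k dvd ?b" using pg dvd_trans by blast+
  then have "Suc k \<le> multiplicity p ?a" "Suc k \<le> multiplicity p ?b"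
    using power_dvd_iff_le_multiplicity pos pe by (metis less_irrefl)+
  then show False by (simp add: k_def)
qed

text \<open>Birkhoff representation: the poset is that of the join-irreducible divisors with the
  order reversed, listed in decreasing order so that it becomes increasing.\<close>
lemma weighted_poset_exists:
  obtains r R m where "weighted_poset r R m"
    "weighted_poset.weight m ` Collect (weighted_poset.up_set r R) = L"
proof -
  define r where "r = card irr"
  define xs where "xs = sorted_list_of_set irr"
  have xs: "length xs = r" "set xs = irr" "sorted_wrt (<) xs" "distinct xs"
    using finite_irr by (simp_all add: xs_def r_def)
  \<comment> \<open>For \<open>i\<close> from 1 to \<open>r\<close> the index \<open>r - i\<close>
    descends from \<open>r - 1\<close> to 0, so that a proper divisor receives the larger
    index.\<close>
  define c where "c i = xs ! (r - i)" for i
  have c_irr: "c i \<in> irr" if "i \<in> {1..r}" for i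
  proof -
    have "r - i < length xs" using that xs(1) by auto
    then show ?thesis unfolding c_def using xs(2) nth_mem by blast
  qed
  have c_less: "c j < c i" if "i \<in> {1..r}" "j \<in> {1..r}" "i < j" for i j
    unfolding c_def using that xs(1) by (intro sorted_wrt_nth_less[OF xs(3)]) auto
  have c_inj: "i = j" if "i \<in> {1..r}" "j \<in> {1..r}" "c i = c j" for i j
    using c_less that by (metis less_irrefl nat_neq_iff)
  have c_surj: "\<exists>i\<in>{1..r}. c i = k" if k: "k \<in> irr" for k
  proof -
    obtain l where "l < r" "xs ! l = k" using k xs(1,2) by (metis in_set_conv_nth)
    then show ?thesis by (intro bexI[of _ "r - l"]) (auto simp: c_def)
  qed
  \<comment> \<open>With this direction up-sets of indices are the sets of irreducibles closed under
    irreducible divisors, as \<open>prod_irr_quotients\<close> requires.\<close>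
  define R where "R = {(i, j). i \<in> {1..r} \<and> j \<in> {1..r} \<and> c j dvd c i}"
  define m where "m i = nat (c i div lower (c i))" for i
  have m: "int (m i) = c i div lower (c i)" if "i \<in> {1..r}" for i
    using quotient_ge_2[OF c_irr[OF that]] by (simp add: m_def)
  have c_le: "c j \<le> c i" if "(i, j) \<in> R" for i j
    using that c_irr irr_L L_pos zdvd_imp_le unfolding R_def by blast
  have wp: "weighted_poset r R m"
  proof
    show "increasing_poset r R"
      unfolding increasing_poset_def partial_order_on_def preorder_on_def
    proof (intro conjI)
      show "refl_on {1..r} R" "R \<subseteq> {1..r} \<times> {1..r}" by (auto simp: refl_on_def R_def)
      show "trans R" by (auto simp: trans_def R_def intro: dvd_trans)
      show "antisym R"
      proof (rule antisymI)
        fix i j assume "(i, j) \<in> R" "(j, i) \<in> R"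
        then show "i = j" using c_le c_inj unfolding R_def by (metis (lifting) case_prodD mem_Collect_eq order_antisym)
      qed
      show "\<forall>(i, j)\<in>R. i \<le> j"
      proof (intro ballI, clarify)
        fix i j assume ij: "(i, j) \<in> R"
        show "i \<le> j"
        proof (rule ccontr)
          assume "\<not> i \<le> j"
          then have "c i < c j" using ij by (intro c_less) (auto simp: R_def)
          then show False using c_le[OF ij] by simp
        qed
      qed
    qed
    fix i assume i: "i \<in> {1..r}"
    have "int (m i) \<ge> 2" unfolding m[OF i] by (rule quotient_ge_2[OF c_irr[OF i]])
    then show "m i \<ge> 2" by simp
    fix j assume j: "j \<in> {1..r}" and ij: "(i, j) \<notin> R" "(j, i) \<notin> R"
    have "coprime (int (m i)) (int (m j))"
      unfolding m[OF i] m[OF j]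
      by (rule coprime_quotients[OF c_irr[OF i] c_irr[OF j]]) (use i j ij in \<open>auto simp: R_def\<close>)
    then show "coprime (m i) (m j)" by simp
  qed
  interpret weighted_poset r R m by (rule wp)
  have weight: "weight J = Lcm (c ` J)" if J: "up_set J" for J
  proof -
    have Jr: "J \<subseteq> {1..r}" using J by (simp add: up_set_def)
    have "weight J = (\<Prod>j\<in>J. c j div lower (c j))"
      unfolding weight_def by (intro prod.cong refl m) (use Jr in auto)
    also have "\<dots> = (\<Prod>k\<in>c ` J. k div lower k)"
      by (rule prod.reindex_cong[symmetric, of c J]) (use c_inj Jr in \<open>auto simp: inj_on_def subset_iff\<close>)
    also have "\<dots> = Lcm (c ` J)"
    proof (rule prod_irr_quotients)
      show "c ` J \<subseteq> irr" using Jr c_irr by blast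
      fix l k assume l: "l \<in> c ` J" and k: "k \<in> irr" "k dvd l"
      obtain i where i: "i \<in> J" "l = c i" using l by blast
      obtain j where j: "j \<in> {1..r}" "c j = k" using c_surj k(1) by blast
      have "(i, j) \<in> R" using i j k Jr by (auto simp: R_def)
      then have "j \<in> J" using J i(1) by (cases "i = j") (auto simp: up_set_def strictly_above_def)
      then show "k \<in> c ` J" using j by blast
    qed
    finally show ?thesis .
  qed
  have "weight ` Collect up_set = L"
  proof (intro equalityI subsetI)
    fix d assume "d \<in> weight ` Collect up_set"
    then obtain J where J: "up_set J" "d = weight J" by blast
    have "c ` J \<subseteq> L" using J(1) c_irr irr_L unfolding up_set_def by blast
    then show "d \<in> L" using Lcm_L weight[OF J(1)] J(2) by simp
  next
    fix d assume d: "d \<in> L"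
    define J where "J = {i \<in> {1..r}. c i dvd d}"
    have "up_set J" unfolding up_set_def J_def
      by (auto simp: strictly_above_def R_def intro: dvd_trans)
    moreover have "c ` J = {k \<in> irr. k dvd d}" unfolding J_def using c_irr c_surj by fastforce
    ultimately have "weight J = d" using weight Lcm_irr[OF d] by simp
    then show "d \<in> weight ` Collect up_set" using \<open>up_set J\<close> by blast
  qed
  then show ?thesis using that wp by blast
qed

end

section \<open>Automorphism groups of rational circulants\<close>

definition residue_lifts :: "nat \<Rightarrow> int set \<Rightarrow> (int \<Rightarrow> int) set" where
  "residue_lifts n S = {g. \<forall>x y. (int n dvd g x - g y \<longleftrightarrow> int n dvd x - y) \<and>
     ((g y - g x) mod int n \<in> S \<longleftrightarrow> (y - x) mod int n \<in> S)}"

lemma residue_liftsD: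
  assumes "g \<in> residue_lifts n S"
  shows "int n dvd g x - g y \<longleftrightarrow> int n dvd x - y"
    "(g y - g x) mod int n \<in> S \<longleftrightarrow> (y - x) mod int n \<in> S"
  using assms by (auto simp: residue_lifts_def)

lemma cyclic_perms_residue_lifts:
  assumes n: "n > 0"
    and closed: "\<And>x y. gcd x (int n) = gcd y (int n) \<Longrightarrow> x mod int n \<in> S \<longleftrightarrow> y mod int n \<in> S"
  shows "cyclic_perms (int n) (residue_lifts n S)"
proof
  fix g assume g: "g \<in> residue_lifts n S"
  have bij: "bij_betw (\<lambda>x. g x mod int n) {0..<int n} {0..<int n}"
    by (rule bij_betw_mod) (use n residue_liftsD(1)[OF g] in auto)
  have "\<exists>x. int n dvd g x - y" for y
  proof -
    have "y mod int n \<in> (\<lambda>x. g x mod int n) ` {0..<int n}"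
      using bij n by (simp add: bij_betw_def)
    then obtain x where "g x mod int n = y mod int n" by force
    then show ?thesis by (auto simp: mod_eq_dvd_iff)
  qed
  then obtain h where h: "\<And>y. int n dvd g (h y) - y" by metis
  have "h \<in> residue_lifts n S"
    unfolding residue_lifts_def
  proof (intro CollectI allI conjI)
    fix x y
    have eq: "(g (h x) - g (h y)) - (x - y) = (g (h x) - x) - (g (h y) - y)" for x y by simp
    have *: "int n dvd (g (h x) - g (h y)) - (x - y)" for x y unfolding eq by (rule dvd_diff[OF h h])
    have "int n dvd h x - h y \<longleftrightarrow> int n dvd g (h x) - g (h y)" using residue_liftsD(1)[OF g] by simp
    also have "\<dots> \<longleftrightarrow> int n dvd x - y"
      using *[of x y] by (metis diff_add_cancel dvd_add_right_iff dvd_add_left_iff)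
    finally show "int n dvd h x - h y \<longleftrightarrow> int n dvd x - y" .
    have "(h y - h x) mod int n \<in> S \<longleftrightarrow> (g (h y) - g (h x)) mod int n \<in> S"
      using residue_liftsD(2)[OF g] by simp
    also have "(g (h y) - g (h x)) mod int n = (y - x) mod int n" using *[of y x] by (simp add: mod_eq_dvd_iff)
    finally show "(h y - h x) mod int n \<in> S \<longleftrightarrow> (y - x) mod int n \<in> S" .
  qed
  moreover have "int n dvd h (g x) - x" for x using h[of "g x"] residue_liftsD(1)[OF g] by simp
  ultimately show "\<exists>h\<in>residue_lifts n S. \<forall>x. int n dvd h (g x) - x" by blast
next
  fix u assume u: "coprime u (int n)"
  show "(\<lambda>x. u * x) \<in> residue_lifts n S"
    unfolding residue_lifts_def
  proof (intro CollectI allI conjI)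
    fix x y
    show "int n dvd u * x - u * y \<longleftrightarrow> int n dvd x - y"
      using u by (simp add: coprime_dvd_mult_right_iff coprime_commute flip: right_diff_distrib)
    have "gcd (u * (y - x)) (int n) = gcd (y - x) (int n)"
      using u by (simp add: gcd_mult_left_left_cancel coprime_commute)
    from closed[OF this] show "(u * y - u * x) mod int n \<in> S \<longleftrightarrow> (y - x) mod int n \<in> S"
      by (simp add: right_diff_distrib)
  qed
qed (use n in \<open>auto simp: residue_lifts_def\<close>)

lemma digraph_auts_circulant:
  assumes "n > 0" "S \<subseteq> {0..<int n}"
  shows "digraph_auts (circulant n S) =
    rel_auts {0..<int n} {()} (\<lambda>_ x y. (y - x) mod int n \<in> S)"
proof -
  have "pverts (circulant n S) = {0..<int n}"
    using assms(1) by (simp add: cayley_digraph_def carrier_integer_mod_group)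
  moreover have "(g x, g y) \<in> parcs (circulant n S) \<longleftrightarrow> (g y - g x) mod int n \<in> S"
    if "g \<in> Bij {0..<int n}" "x \<in> {0..<int n}" "y \<in> {0..<int n}" for g x y
    using circulant_arc_iff[OF assms] Bij_mem[OF that(1)] that(2,3) by blast
  ultimately show ?thesis
    using circulant_arc_iff[OF assms]
    unfolding digraph_auts_def rel_auts_def BijGroup_def by fastforce
qed

text \<open>\<open>S\<close> is an invariant set, so by \<open>same_orbit\<close> membership depends
  only on which elements of \<open>L\<close> divide a residue; permutations preserving the
  congruences of \<open>L\<close> therefore preserve arcs. The last conclusion is exported because
  it later detects divisors missing from \<open>L\<close>.\<close>

lemma rational_circulant_auts:
  assumes n: "n > 0" and S: "S \<subseteq> {0..<int n}" and rat: "rational_circulant n S"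
  obtains L where "divisor_lattice L (int n)"
    "digraph_auts (circulant n S) = rel_auts {0..<int n} L (\<lambda>d x y. d dvd x - y)"
    "\<And>x y. (\<And>d. d \<in> L \<Longrightarrow> d dvd x \<longleftrightarrow> d dvd y) \<Longrightarrow> x mod int n \<in> S \<longleftrightarrow> y mod int n \<in> S"
proof -
  note closed = rational_circulant_imp_gcd_closed[OF n S rat]
  interpret cyclic_perms "int n" "residue_lifts n S"
    by (rule cyclic_perms_residue_lifts[OF n closed])
  let ?L = "Collect compat"
  have lattice: "divisor_lattice ?L (int n)"
    by unfold_locales (use n compatD compat_1 compat_n compat_lcm compat_gcd in auto)
  have "invariant (int n) {z. z mod int n \<in> S}"
    unfolding invariant_def
  proof (intro conjI allI impI ballI)
    fix x y assume "int n dvd x - y" "x \<in> {z. z mod int n \<in> S}"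
    then show "y \<in> {z. z mod int n \<in> S}" by (simp add: mod_eq_dvd_iff[symmetric])
  next
    fix g x assume g: "g \<in> residue_lifts n S" "int n dvd g 0" and x: "x \<in> {z. z mod int n \<in> S}"
    have "g x mod int n = (g x - g 0) mod int n" using g(2) by (simp add: mod_eq_dvd_iff)
    then show "g x \<in> {z. z mod int n \<in> S}" using residue_liftsD(2)[OF g(1), of x 0] x by simp
  qed
  then have mem: "x mod int n \<in> S \<longleftrightarrow> y mod int n \<in> S"
    if "\<And>d. d \<in> ?L \<Longrightarrow> d dvd x \<longleftrightarrow> d dvd y" for x y
    using orb_in_invariant[OF compat_n _ same_orbit[OF compat_n, of x y]] that by auto
  have "digraph_auts (circulant n S) = rel_auts {0..<int n} ?L (\<lambda>d x y. d dvd x - y)"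
    unfolding digraph_auts_circulant[OF n S]
  proof (intro equalityI subsetI)
    fix g assume g: "g \<in> rel_auts {0..<int n} {()} (\<lambda>_ x y. (y - x) mod int n \<in> S)"
    then have gB: "g \<in> Bij {0..<int n}" by (simp add: rel_auts_def)
    have res: "x mod int n \<in> {0..<int n}" for x using n by simp
    have gZ: "g (x mod int n) \<in> {0..<int n}" for x by (rule Bij_mem[OF gB res])
    have inj: "inj_on g {0..<int n}" using gB by (simp add: Bij_def bij_betw_def)
    have "(\<lambda>x. g (x mod int n)) \<in> residue_lifts n S"
      unfolding residue_lifts_def
    proof (intro CollectI allI conjI)
      fix x y
      have "int n dvd g (x mod int n) - g (y mod int n) \<longleftrightarrow>
          g (x mod int n) mod int n = g (y mod int n) mod int n" by (simp add: mod_eq_dvd_iff)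
      also have "\<dots> \<longleftrightarrow> g (x mod int n) = g (y mod int n)" using gZ[of x] gZ[of y] by simp
      also have "\<dots> \<longleftrightarrow> x mod int n = y mod int n" by (rule inj_on_eq_iff[OF inj res res])
      finally show "int n dvd g (x mod int n) - g (y mod int n) \<longleftrightarrow> int n dvd x - y"
        by (simp add: mod_eq_dvd_iff)
      have "(g (y mod int n) - g (x mod int n)) mod int n \<in> S \<longleftrightarrow>
          (y mod int n - x mod int n) mod int n \<in> S"
        using g res unfolding rel_auts_def by blast
      then show "(g (y mod int n) - g (x mod int n)) mod int n \<in> S \<longleftrightarrow> (y - x) mod int n \<in> S"
        by (simp add: mod_diff_eq)
    qed
    then have "d dvd g x - g y \<longleftrightarrow> d dvd x - y"
      if "compat d" "x \<in> {0..<int n}" "y \<in> {0..<int n}" for d x y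
      using compat_iff[OF that(1), of "\<lambda>x. g (x mod int n)" x y] that(2,3) by simp
    then show "g \<in> rel_auts {0..<int n} ?L (\<lambda>d x y. d dvd x - y)"
      using gB by (simp add: rel_auts_def)
  next
    fix g assume g: "g \<in> rel_auts {0..<int n} ?L (\<lambda>d x y. d dvd x - y)"
    have "(g y - g x) mod int n \<in> S \<longleftrightarrow> (y - x) mod int n \<in> S"
      if "x \<in> {0..<int n}" "y \<in> {0..<int n}" for x y
      by (rule mem) (use g that in \<open>simp add: rel_auts_def\<close>)
    then show "g \<in> rel_auts {0..<int n} {()} (\<lambda>_ x y. (y - x) mod int n \<in> S)"
      using g by (simp add: rel_auts_def)
  qed
  then show ?thesis using that lattice mem by blast
qed

lemma rational_circulant_auts_wreath:
  assumes n: "n > 0" and S: "S \<subseteq> {0..<int n}" and rat: "rational_circulant n S"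
  obtains r R m where "weighted_poset r R m" "n = (\<Prod>i=1..r. m i)"
    "perm_isomorphic {0..<int n} (digraph_auts (circulant n S)) (gwp_domain r (\<lambda>i. {1..m i}))
       (gen_wreath_product r R (\<lambda>i. {1..m i}) (\<lambda>i. carrier (BijGroup {1..m i})))"
proof -
  obtain L where L: "divisor_lattice L (int n)"
    "digraph_auts (circulant n S) = rel_auts {0..<int n} L (\<lambda>d x y. d dvd x - y)"
    using rational_circulant_auts[OF assms] by metis
  interpret divisor_lattice L "int n" by (rule L(1))
  obtain r R m where wp: "weighted_poset r R m"
    and image: "weighted_poset.weight m ` Collect (weighted_poset.up_set r R) = L"
    using weighted_poset_exists by blast
  interpret weighted_poset r R m by (rule wp)
  \<comment> \<open>\<open>n\<close> is in \<open>L\<close>, hence a weight, and every weight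
    divides \<open>total\<close>; \<open>total\<close> is itself a weight, hence in
    \<open>L\<close>, and divides \<open>n\<close>.\<close>
  obtain J where J: "up_set J" "int n = weight J" using N_L image by blast
  have "weight J dvd total" using J(1) by (intro weight_dvd[OF up_set_full]) (simp add: up_set_def)
  moreover have "total \<in> L" unfolding image[symmetric] using up_set_full by (intro imageI) simp
  then have "total dvd weight J" unfolding J(2)[symmetric] by (rule L_dvd)
  moreover have "total > 0" by (rule weight_pos) simp
  ultimately have total: "int n = total" unfolding J(2) using n J(2) by (intro zdvd_antisym_nonneg) simp_all
  then have "int n = int (\<Prod>i=1..r. m i)" by (simp add: weight_def)
  then have "n = (\<Prod>i=1..r. m i)" by (simp only: of_nat_eq_iff)
  moreover have "digraph_auts (circulant n S) = congruence_auts"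
    unfolding L(2) image[symmetric] rel_auts_image total ..
  ultimately show ?thesis
    using that[OF wp] perm_isomorphic_congruence_auts total by simp
qed

section \<open>A connection set for a given lattice\<close>

context weighted_poset
begin

text \<open>The largest up-set whose weight divides \<open>z\<close>, assembled from principal
  up-sets; see \<open>weight_dvd_iff_closure_at\<close>. Its weight is the largest lattice element
  dividing \<open>z\<close>.\<close>

definition closure_at :: "int \<Rightarrow> nat set" where
  "closure_at z = {j \<in> {1..r}. weight (insert j (over j)) dvd z}"

lemma closure_at_iff:
  "j \<in> closure_at z \<longleftrightarrow> j \<in> {1..r} \<and> agree_on (insert j (over j)) (digits z) (digits 0)"
  using weight_dvd_iff_digits[OF up_set_insert_above, of j z 0] by (auto simp: closure_at_def)

lemma weight_dvd_iff_closure_at: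
  assumes J: "up_set J"
  shows "weight J dvd z \<longleftrightarrow> J \<subseteq> closure_at z"
proof -
  have "weight J dvd z \<longleftrightarrow> agree_on J (digits z) (digits 0)"
    using weight_dvd_iff_digits[OF J, of z 0] by simp
  also have "\<dots> \<longleftrightarrow> (\<forall>j\<in>J. agree_on (insert j (over j)) (digits z) (digits 0))"
    using J unfolding up_set_def by blast
  also have "\<dots> \<longleftrightarrow> J \<subseteq> closure_at z"
    using J by (simp add: subset_eq closure_at_iff up_set_def)
  finally show ?thesis .
qed

lemma up_set_closure_at: "up_set (closure_at z)"
  unfolding up_set_def
proof (intro conjI ballI subsetI)
  fix j i assume j: "j \<in> closure_at z" and i: "i \<in> over j"
  have "insert i (over i) \<subseteq> insert j (over j)" using above_trans i by blast
  then show "i \<in> closure_at z" using j aboveD[OF i] unfolding closure_at_iff by blast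
qed (simp add: closure_at_def)

text \<open>A further element \<open>j\<close> of the closure would force
  \<open>m j * weight J\<close> to divide \<open>weight J\<close>, although \<open>m j\<close> is at
  least 2.\<close>

lemma closure_at_weight:
  assumes J: "up_set J"
  shows "closure_at (weight J) = J"
proof
  show "J \<subseteq> closure_at (weight J)" using weight_dvd_iff_closure_at[OF J, of "weight J"] by simp
  let ?K = "closure_at (weight J)"
  have fin: "finite ?K" by (rule finite_up_set[OF up_set_closure_at])
  have Kr: "?K \<subseteq> {1..r}" by (auto simp: closure_at_def)
  show "?K \<subseteq> J"
  proof (rule ccontr)
    assume "\<not> ?K \<subseteq> J"
    then obtain j where j: "j \<in> ?K" "j \<notin> J" by blast
    have jr: "j \<in> {1..r}" using j(1) Kr by blast
    have "insert j J \<subseteq> ?K" using j(1) \<open>J \<subseteq> ?K\<close> by blast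
    then have "weight (insert j J) dvd weight ?K" by (rule weight_dvd[OF up_set_closure_at])
    also have "weight ?K dvd weight J" using weight_dvd_iff_closure_at[OF up_set_closure_at, of "weight J" "weight J"] by simp
    finally have "int (m j) * weight J dvd weight J"
      using weight_insert[OF finite_up_set[OF J] j(2)] by simp
    moreover have "weight J > 0" using J by (intro weight_pos) (simp add: up_set_def)
    ultimately have "int (m j) * weight J \<le> 1 * weight J" using zdvd_imp_le by fastforce
    then have "int (m j) \<le> 1" using \<open>weight J > 0\<close> by (simp only: mult_le_cancel_right)
    then show False using m_ge_2[OF jr] by simp
  qed
qed

lemma total_pos: "total > 0"
  by (rule weight_pos) simp

lemma closure_at_cong:
  assumes "gcd x total = gcd y total"
  shows "closure_at x = closure_at y"
proof -
  have "weight (insert j (over j)) dvd z \<longleftrightarrow> weight (insert j (over j)) dvd gcd z total"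
    if "j \<in> {1..r}" for j z
    using weight_dvd[OF up_set_full, of "insert j (over j)"] up_set_insert_above[OF that]
    by (simp add: up_set_def)
  then have "closure_at z = closure_at (gcd z total)" for z unfolding closure_at_def by blast
  then show ?thesis using assms by metis
qed

lemma closure_at_mod: "closure_at (x mod total) = closure_at x"
  by (rule closure_at_cong) (metis gcd_red_int gcd.commute)

text \<open>At each \<open>i\<close>, a point that agrees with \<open>x\<close> above
  \<open>i\<close> gets \<open>x i\<close> and \<open>y i\<close> exchanged; any other point keeps
  its coordinate. This sends \<open>x\<close> to \<open>y\<close>. It fixes the digits
  \<open>x0\<close> of 0: where \<open>x0\<close> agrees with \<open>x\<close> above
  \<open>i\<close>, equality of closures gives that \<open>x i = x0 i\<close> iff
  \<open>y i = x0 i\<close>, so the exchange does not move \<open>x0 i\<close>.\<close>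

lemma congruence_auts_transitive:
  assumes "u \<in> {0..<total}" "v \<in> {0..<total}" "closure_at u = closure_at v"
  obtains g where "g \<in> congruence_auts" "g 0 = 0" "g u = v"
proof -
  define x0 x y where "x0 = digits 0" and "x = digits u" and "y = digits v"
  have D: "x0 \<in> digit_space" "x \<in> digit_space" "y \<in> digit_space"
    unfolding x0_def x_def y_def by (rule digits_mem)+
  have cl: "agree_on (insert i (over i)) x x0 \<longleftrightarrow> agree_on (insert i (over i)) y x0"
    if "i \<in> {1..r}" for i
    using assms(3) closure_at_iff that unfolding x0_def x_def y_def by blast
  have cl_over: "agree_on (over i) x x0 \<longleftrightarrow> agree_on (over i) y x0" for i
  proof -
    have "over i \<subseteq> {1..r}" using up_set_above by (simp add: up_set_def)
    then have eq: "(\<forall>j\<in>over i. agree_on (insert j (over j)) x x0) \<longleftrightarrow>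
        (\<forall>j\<in>over i. agree_on (insert j (over j)) y x0)"
      by (intro ball_cong refl cl) auto
    have *: "agree_on (over i) z x0 \<longleftrightarrow> (\<forall>j\<in>over i. agree_on (insert j (over j)) z x0)" for z
      using above_trans by blast
    show ?thesis unfolding *[of x] *[of y] by (rule eq)
  qed
  define swap where "swap i a = (if a = x i then y i else if a = y i then x i else a)" for i a
  define f where "f i \<xi> = (\<lambda>a\<in>{1..m i}. if \<xi> = restrict x (over i) then swap i a else a)" for i \<xi>
  have "f \<in> wreath_maps"
    unfolding wreath_maps_def
  proof (intro CollectI ballI funcsetI)
    fix i and \<xi> :: "nat \<Rightarrow> nat" assume i: "i \<in> {1..r}"
    have xy: "x i \<in> {1..m i}" "y i \<in> {1..m i}" using domD D i by blast+
    have "bij_betw (f i \<xi>) {1..m i} {1..m i}"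
      by (rule bij_betw_byWitness[where f' = "f i \<xi>"])
        (use xy in \<open>auto simp: f_def swap_def split: if_splits\<close>)
    then show "f i \<xi> \<in> Bij {1..m i}" by (simp add: Bij_def f_def)
  qed
  then have "wreath_perm f \<in> rel_auts digit_space (Collect up_set) agree_on"
    using wreath_perm_image by blast
  then obtain g where g: "g \<in> congruence_auts" and gf: "wreath_perm f = conj_perm {0..<total} digit_space digits g"
    unfolding conj_perm_congruence_auts[symmetric] by blast
  have gZ: "g z \<in> {0..<total}" if "z \<in> {0..<total}" for z
  proof -
    have "g \<in> Bij {0..<total}" using g by (simp add: rel_auts_def)
    then show ?thesis using that by (rule Bij_mem)
  qed
  have g_digits: "digits (g z) = wreath_perm f (digits z)" if "z \<in> {0..<total}" for z
    unfolding gf by (rule conj_perm_apply[OF bij_betw_digits that, symmetric])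
  have inj: "inj_on digits {0..<total}" using bij_betw_digits by (simp add: bij_betw_def)
  have "wreath_perm f x = y"
  proof (rule dom_eqI[OF wreath_perm_mem[OF \<open>f \<in> wreath_maps\<close> D(2)] D(3)])
    fix i assume i: "i \<in> {1..r}"
    then show "wreath_perm f x i = y i"
      using domD[OF D(2) i] D(2) by (simp add: wreath_perm_def f_def swap_def)
  qed
  then have "g u = v"
    using g_digits[OF assms(1)] gZ[OF assms(1)] assms(2) inj unfolding x_def y_def by (metis inj_onD)
  moreover have "wreath_perm f x0 = x0"
  proof (rule dom_eqI[OF wreath_perm_mem[OF \<open>f \<in> wreath_maps\<close> D(1)] D(1)])
    fix i assume i: "i \<in> {1..r}"
    have "swap i (x0 i) = x0 i" if eq: "restrict x0 (over i) = restrict x (over i)"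
    proof -
      have "agree_on (over i) x x0" using eq by (metis restrict_apply')
      then have "x i = x0 i \<longleftrightarrow> y i = x0 i" using cl[OF i] cl_over by blast
      then show ?thesis unfolding swap_def by metis
    qed
    then show "wreath_perm f x0 i = x0 i"
      using domD[OF D(1) i] D(1) i by (auto simp: wreath_perm_def f_def)
  qed
  then have "g 0 = 0"
    using g_digits[of 0] gZ[of 0] total_pos inj unfolding x0_def
    by (metis atLeastLessThan_iff inj_onD order_refl)
  ultimately show ?thesis using that g by blast
qed

text \<open>Passing to a cover in the lattice of up-sets changes the parity, so this connection set
  distinguishes any two comparable up-sets that are neighbours.\<close>
definition parity_set :: "int set" where
  "parity_set = {z \<in> {0..<total}. even (card (closure_at z))}"

lemma parity_set_mod_iff: "z mod total \<in> parity_set \<longleftrightarrow> even (card (closure_at z))"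
  using total_pos closure_at_mod[of z] by (simp add: parity_set_def del: One_nat_def)

text \<open>Let \<open>L\<close> be the lattice found by \<open>rational_circulant_auts\<close>. Its
  elements are weights: some automorphism fixes 0 and takes \<open>d\<close> to the weight of its
  closure, so each divides the other. All weights occur: if \<open>weight J\<close> were missing,
  let \<open>weight K\<close> be the largest element of \<open>L\<close> dividing it; adding one
  element of \<open>J\<close> to \<open>K\<close> changes the parity, while no element of
  \<open>L\<close> tells the two weights apart.\<close>

lemma parity_set_circulant:
  assumes n: "int n = total"
  shows "parity_set \<subseteq> {0..<int n}" "rational_circulant n parity_set"
    "digraph_auts (circulant n parity_set) = congruence_auts"
proof -
  have n0: "n > 0" using n total_pos by simp
  show S: "parity_set \<subseteq> {0..<int n}" by (auto simp: parity_set_def n)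
  show rat: "rational_circulant n parity_set"
  proof (rule gcd_closed_imp_rational_circulant[OF n0 S])
    fix x y assume "gcd x (int n) = gcd y (int n)"
    then have "closure_at x = closure_at y" unfolding n by (rule closure_at_cong)
    then show "x mod int n \<in> parity_set \<longleftrightarrow> y mod int n \<in> parity_set"
      by (simp only: n parity_set_mod_iff)
  qed
  obtain L where lattice: "divisor_lattice L (int n)"
    and auts: "digraph_auts (circulant n parity_set) = rel_auts {0..<int n} L (\<lambda>d x y. d dvd x - y)"
    and mem: "\<And>x y. (\<And>d. d \<in> L \<Longrightarrow> d dvd x \<longleftrightarrow> d dvd y) \<Longrightarrow>
      x mod int n \<in> parity_set \<longleftrightarrow> y mod int n \<in> parity_set"
    using rational_circulant_auts[OF n0 S rat] by blast
  interpret divisor_lattice L "int n" by (rule lattice)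
  have sub: "congruence_auts \<subseteq> digraph_auts (circulant n parity_set)"
    unfolding digraph_auts_circulant[OF n0 S]
  proof
    fix g assume g: "g \<in> congruence_auts"
    have "(g y - g x) mod int n \<in> parity_set \<longleftrightarrow> (y - x) mod int n \<in> parity_set"
      if xy: "x \<in> {0..<int n}" "y \<in> {0..<int n}" for x y
    proof -
      have "weight (insert j (over j)) dvd g y - g x \<longleftrightarrow> weight (insert j (over j)) dvd y - x"
        if "j \<in> {1..r}" for j
        using g up_set_insert_above[OF that] xy unfolding rel_auts_def n by blast
      then have "closure_at (g y - g x) = closure_at (y - x)" by (auto simp: closure_at_def)
      then show ?thesis by (simp only: n parity_set_mod_iff)
    qed
    then show "g \<in> rel_auts {0..<int n} {()} (\<lambda>_ x y. (y - x) mod int n \<in> parity_set)"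
      using g by (simp add: rel_auts_def n)
  qed
  have L_weight: "d = weight (closure_at d)" if d: "d \<in> L" for d
  proof -
    let ?w = "weight (closure_at d)"
    have dn: "d dvd int n" by (rule L_dvd[OF d])
    have wd: "?w dvd d" using weight_dvd_iff_closure_at[OF up_set_closure_at] by blast
    \<comment> \<open>Reduction is needed because \<open>d\<close> or the weight may equal
      \<open>n\<close>, whose residue is 0.\<close>
    have "closure_at (d mod total) = closure_at (?w mod total)"
      by (simp only: closure_at_mod closure_at_weight[OF up_set_closure_at])
    then obtain g where g: "g \<in> congruence_auts" "g 0 = 0" "g (d mod total) = ?w mod total"
      using congruence_auts_transitive[of "d mod total" "?w mod total"] total_pos by auto
    have "g \<in> rel_auts {0..<int n} L (\<lambda>d x y. d dvd x - y)" using sub g(1) auts by blast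
    then have "d dvd g (d mod total) - g 0 \<longleftrightarrow> d dvd d mod total - 0"
      using d total_pos unfolding rel_auts_def n by simp
    then have "d dvd ?w mod total \<longleftrightarrow> d dvd d mod total" by (simp only: g(2,3) diff_zero)
    then have "d dvd ?w" using dn unfolding n by (simp only: dvd_mod_iff dvd_refl)
    moreover have "?w > 0" by (rule weight_pos) (auto simp: closure_at_def)
    ultimately show ?thesis using wd L_pos[OF d] by (intro zdvd_antisym_nonneg) auto
  qed
  have weight_L: "weight J \<in> L" if J: "up_set J" for J
  proof (rule ccontr)
    assume "weight J \<notin> L"
    define c where "c = Lcm {d \<in> L. d dvd weight J}"
    define K where "K = closure_at c"
    have "c \<in> L" unfolding c_def by (rule Lcm_L) auto
    then have cK: "c = weight K" unfolding K_def by (rule L_weight)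
    have upK: "up_set K" unfolding K_def by (rule up_set_closure_at)
    have "c dvd weight J" unfolding c_def by (rule Lcm_least) auto
    then have "K \<subseteq> J"
      unfolding cK weight_dvd_iff_closure_at[OF upK] closure_at_weight[OF J] .
    have "K \<noteq> J" using cK \<open>c \<in> L\<close> \<open>weight J \<notin> L\<close> by auto
    have fin: "finite (J - K)" using finite_up_set[OF J] by simp
    \<comment> \<open>The largest index outside \<open>K\<close> is maximal in \<open>J - K\<close>,
      so \<open>insert j K\<close> is again an up-set.\<close>
    define j where "j = Max (J - K)"
    have "J - K \<noteq> {}" using \<open>K \<subseteq> J\<close> \<open>K \<noteq> J\<close> by blast
    then have j: "j \<in> J" "j \<notin> K" "\<And>i. i \<in> J - K \<Longrightarrow> i \<le> j"
      using Max_in[OF fin] Max_ge[OF fin] by (auto simp: j_def)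
    have "over j \<subseteq> K"
    proof
      fix i assume i: "i \<in> over j"
      have "i \<in> J" using i j(1) J unfolding up_set_def by blast
      then show "i \<in> K" using j(3)[of i] aboveD[OF i] by fastforce
    qed
    then have upK': "up_set (insert j K)" using upK j(1) J unfolding up_set_def by blast
    have "d dvd weight K \<longleftrightarrow> d dvd weight (insert j K)" if d: "d \<in> L" for d
    proof
      assume "d dvd weight K"
      then show "d dvd weight (insert j K)" using weight_dvd[OF upK', of K] dvd_trans by blast
    next
      assume "d dvd weight (insert j K)"
      then have "d dvd weight J" using weight_dvd[OF J, of "insert j K"] \<open>K \<subseteq> J\<close> j(1) dvd_trans by blast
      then have "d dvd c" unfolding c_def using d by (intro dvd_Lcm) simp
      then show "d dvd weight K" by (simp add: cK)
    qed
    then have "even (card K) \<longleftrightarrow> even (card (insert j K))"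
      using mem[of "weight K" "weight (insert j K)"]
      by (simp only: n parity_set_mod_iff closure_at_weight[OF upK] closure_at_weight[OF upK'])
    then show False using j(2) finite_up_set[OF upK] by simp
  qed
  have "digraph_auts (circulant n parity_set) \<subseteq> congruence_auts"
    unfolding auts rel_auts_def n using weight_L by blast
  then show "digraph_auts (circulant n parity_set) = congruence_auts" using sub by blast
qed

end

section \<open>Permutation isomorphism and the equivalence\<close>

lemma perm_isomorphic_sym:
  assumes "K \<subseteq> Bij Y" "perm_isomorphic Y K Y' K'"
  shows "perm_isomorphic Y' K' Y K"
proof -
  obtain \<phi> where \<phi>: "bij_betw \<phi> Y Y'" "K' = conj_perm Y Y' \<phi> ` K"
    using assms(2) by (auto simp: perm_isomorphic_iff)
  have inv: "bij_betw (inv_into Y \<phi>) Y' Y" by (rule bij_betw_inv_into[OF \<phi>(1)])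
  have "conj_perm Y' Y (inv_into Y \<phi>) (conj_perm Y Y' \<phi> g) = g" if g: "g \<in> K" for g
  proof
    fix x
    have gB: "g \<in> Bij Y" using assms(1) g by blast
    show "conj_perm Y' Y (inv_into Y \<phi>) (conj_perm Y Y' \<phi> g) x = g x"
    proof (cases "x \<in> Y")
      case True
      have "inv_into Y \<phi> (\<phi> x) = x" "\<phi> x \<in> Y'"
        using \<phi>(1) True by (auto simp: bij_betw_def)
      then have "conj_perm Y' Y (inv_into Y \<phi>) (conj_perm Y Y' \<phi> g) x =
          inv_into Y \<phi> (conj_perm Y Y' \<phi> g (\<phi> x))"
        using conj_perm_apply[OF inv, of "\<phi> x"] by simp
      also have "\<dots> = inv_into Y \<phi> (\<phi> (g x))" by (simp add: conj_perm_apply[OF \<phi>(1) True])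
      also have "\<dots> = g x" using Bij_mem[OF gB True] \<phi>(1) by (auto simp: bij_betw_def)
      finally show ?thesis .
    next
      case False
      then show ?thesis using gB by (simp add: conj_perm_def Bij_def extensional_def)
    qed
  qed
  then have "K = conj_perm Y' Y (inv_into Y \<phi>) ` K'" unfolding \<phi>(2) image_image by simp
  then show ?thesis unfolding perm_isomorphic_iff using inv by blast
qed

lemma perm_isomorphic_trans:
  assumes "K \<subseteq> Bij Y" "perm_isomorphic Y K Y' K'" "perm_isomorphic Y' K' Y'' K''"
  shows "perm_isomorphic Y K Y'' K''"
proof -
  obtain \<phi> \<psi> where \<phi>: "bij_betw \<phi> Y Y'" "K' = conj_perm Y Y' \<phi> ` K"
    and \<psi>: "bij_betw \<psi> Y' Y''" "K'' = conj_perm Y' Y'' \<psi> ` K'"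
    using assms(2,3) by (auto simp: perm_isomorphic_iff)
  have "K'' = conj_perm Y Y'' (\<psi> \<circ> \<phi>) ` K"
    unfolding \<psi>(2) \<phi>(2) image_image
    using conj_perm_compose[OF \<phi>(1) \<psi>(1)] assms(1) by (intro image_cong) auto
  then show ?thesis
    unfolding perm_isomorphic_iff using bij_betw_trans[OF \<phi>(1) \<psi>(1)] by blast
qed

lemma eigenvalue_relabel:
  fixes a b :: "int \<Rightarrow> int \<Rightarrow> complex"
  assumes \<theta>: "bij_betw \<theta> {0..<int n} {0..<int n}"
    and b: "\<And>x y. x \<in> {0..<int n} \<Longrightarrow> y \<in> {0..<int n} \<Longrightarrow> b (\<theta> x) (\<theta> y) = a x y"
    and ev: "eigenvalue (mat n n (\<lambda>(i, j). b (int i) (int j))) c"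
  shows "eigenvalue (mat n n (\<lambda>(i, j). a (int i) (int j))) c"
proof -
  obtain v x0 where x0: "x0 \<in> {0..<int n}" "v x0 \<noteq> 0"
    and v: "\<And>x. x \<in> {0..<int n} \<Longrightarrow> (\<Sum>y\<in>{0..<int n}. b x y * v y) = c * v x"
    using ev unfolding eigenvalue_int_indexed[of n b] by blast
  have mem: "\<theta> x \<in> {0..<int n}" if "x \<in> {0..<int n}" for x
    using \<theta> that by (auto simp: bij_betw_def)
  have "x0 \<in> \<theta> ` {0..<int n}" using \<theta> x0(1) by (simp add: bij_betw_def)
  then have "\<exists>x\<in>{0..<int n}. (v \<circ> \<theta>) x \<noteq> 0" using x0(2) by auto
  moreover have "(\<Sum>y\<in>{0..<int n}. a x y * (v \<circ> \<theta>) y) = c * (v \<circ> \<theta>) x" if x: "x \<in> {0..<int n}" for x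
  proof -
    have "(\<Sum>y\<in>{0..<int n}. a x y * (v \<circ> \<theta>) y) = (\<Sum>y\<in>{0..<int n}. b (\<theta> x) (\<theta> y) * v (\<theta> y))"
      by (intro sum.cong refl) (simp add: b[OF x])
    also have "\<dots> = (\<Sum>y\<in>{0..<int n}. b (\<theta> x) y * v y)"
      by (rule sum.reindex_bij_betw[OF \<theta>])
    finally show ?thesis using v[OF mem[OF x]] by simp
  qed
  ultimately show ?thesis unfolding eigenvalue_int_indexed[of n a] by blast
qed

text \<open>The arc relation carried along the bijection has automorphism group \<open>G\<close>. As
  \<open>G\<close> contains the translations, this relation depends only on \<open>y - x\<close> and
  so is again a circulant, with connection set the out-neighbours of 0. The adjacency matrices
  differ by a relabelling and have the same eigenvalues.\<close>

lemma rational_circulant_transport: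
  assumes n: "n > 0" and S: "S \<subseteq> {0..<int n}" and rat: "rational_circulant n S"
    and iso: "perm_isomorphic {0..<int n} (digraph_auts (circulant n S)) {0..<int n} G"
    and transl: "group_translations (integer_mod_group n) \<subseteq> G"
  obtains S' where "S' \<subseteq> {0..<int n}" "rational_circulant n S'" "G = digraph_auts (circulant n S')"
proof -
  let ?Z = "{0..<int n}"
  obtain \<theta> where \<theta>: "bij_betw \<theta> ?Z ?Z" and G: "G = conj_perm ?Z ?Z \<theta> ` digraph_auts (circulant n S)"
    using iso by (auto simp: perm_isomorphic_iff)
  let ?\<tau> = "inv_into ?Z \<theta>"
  define \<rho> where "\<rho> x y \<longleftrightarrow> (?\<tau> y - ?\<tau> x) mod int n \<in> S" for x y
  have \<tau>: "?\<tau> (\<theta> x) = x" if "x \<in> ?Z" for x using \<theta> that by (auto simp: bij_betw_def)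
  have G_eq: "G = rel_auts ?Z {()} (\<lambda>_. \<rho>)"
    unfolding G digraph_auts_circulant[OF n S]
    by (rule conj_perm_rel_auts[OF \<theta>]) (simp add: \<rho>_def \<tau>)
  define S' where "S' = {z \<in> ?Z. \<rho> 0 z}"
  have S': "S' \<subseteq> ?Z" by (auto simp: S'_def)
  have \<rho>_iff: "\<rho> x y \<longleftrightarrow> (y - x) mod int n \<in> S'" if xy: "x \<in> ?Z" "y \<in> ?Z" for x y
  proof -
    let ?t = "\<lambda>z\<in>?Z. (x + z) mod int n"
    have "?t \<in> group_translations (integer_mod_group n)"
      using n xy(1) by (auto simp: group_translations_def carrier_integer_mod_group)
    then have "?t \<in> rel_auts ?Z {()} (\<lambda>_. \<rho>)" using transl G_eq by blast
    moreover have "0 \<in> ?Z" "(y - x) mod int n \<in> ?Z" using n by simp_all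
    ultimately have "\<rho> (?t 0) (?t ((y - x) mod int n)) \<longleftrightarrow> \<rho> 0 ((y - x) mod int n)"
      unfolding rel_auts_def by blast
    moreover have "?t 0 = x" using n xy(1) by simp
    moreover have "?t ((y - x) mod int n) = y" using n xy(2) by (simp add: mod_add_right_eq)
    ultimately show ?thesis using n by (simp add: S'_def)
  qed
  have "rational_circulant n S'"
    unfolding rational_circulant_def
  proof (intro allI impI)
    fix c assume ev: "eigenvalue (adjacency_mat n (circulant n S')) c"
    have mat: "adjacency_mat n (circulant n T) =
        mat n n (\<lambda>(i, j). (\<lambda>x y. if (y - x) mod int n \<in> T then 1 else 0) (int i) (int j))"
      if "T \<subseteq> ?Z" for T
      unfolding adjacency_mat_def by (rule eq_matI) (auto simp: circulant_arc_iff[OF n that])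
    have "eigenvalue (adjacency_mat n (circulant n S)) c"
      unfolding mat[OF S]
    proof (rule eigenvalue_relabel[OF \<theta>])
      show "eigenvalue (mat n n (\<lambda>(i, j). (\<lambda>x y. if (y - x) mod int n \<in> S' then 1 else 0) (int i) (int j))) c"
        using ev unfolding mat[OF S'] .
      fix x y assume xy: "x \<in> ?Z" "y \<in> ?Z"
      have "\<theta> x \<in> ?Z" "\<theta> y \<in> ?Z" using \<theta> xy by (auto simp: bij_betw_def)
      then have "(\<theta> y - \<theta> x) mod int n \<in> S' \<longleftrightarrow> \<rho> (\<theta> x) (\<theta> y)" by (rule \<rho>_iff[symmetric])
      also have "\<dots> \<longleftrightarrow> (y - x) mod int n \<in> S" unfolding \<rho>_def \<tau>[OF xy(1)] \<tau>[OF xy(2)] ..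
      finally show "(if (\<theta> y - \<theta> x) mod int n \<in> S' then 1 else 0) =
          (if (y - x) mod int n \<in> S then 1 else (0 :: complex))" by simp
    qed
    then show "c \<in> \<rat>" using rat by (simp add: rational_circulant_def)
  qed
  moreover have "G = digraph_auts (circulant n S')"
    unfolding digraph_auts_circulant[OF n S'] G_eq by (rule rel_auts_cong) (rule \<rho>_iff)
  ultimately show ?thesis using that S' by blast
qed

lemma group_translations_digraph_auts:
  assumes n: "n > 0" and S: "S \<subseteq> {0..<int n}"
  shows "group_translations (integer_mod_group n) \<subseteq> digraph_auts (circulant n S)"
proof
  let ?Z = "{0..<int n}"
  fix t assume "t \<in> group_translations (integer_mod_group n)"
  then obtain s where t: "t = (\<lambda>x\<in>?Z. (s + x) mod int n)"
    using n by (auto simp: group_translations_def carrier_integer_mod_group)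
  have "bij_betw (\<lambda>x. (s + x) mod int n) ?Z ?Z" by (rule bij_betw_mod) (use n in auto)
  then have "bij_betw t ?Z ?Z" by (rule bij_betw_cong[THEN iffD1, rotated]) (simp add: t)
  moreover have "(t y - t x) mod int n = (y - x) mod int n" if "x \<in> ?Z" "y \<in> ?Z" for x y
    using that by (simp add: t mod_diff_eq)
  ultimately show "t \<in> digraph_auts (circulant n S)"
    unfolding digraph_auts_circulant[OF n S] rel_auts_def Bij_def by (simp add: t)
qed

text \<open>Being permutation isomorphic to a wreath product is unaffected by conjugation, whereas
  the automorphism group of a circulant contains the translations: for \<open>n = 4\<close>, a
  dihedral group of order 8 that lacks \<open>x + 1\<close> is of wreath type but is no such
  automorphism group. So equality is matched with the wreath condition together with the
  translations, and isomorphism with the wreath condition alone. Coprimality concerns incomparable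
  pairs. Asked whenever \<open>i\<close> is not below \<open>j\<close>, it would also bind
  comparable pairs read backwards and exclude the wreath product of S_2 with S_2, the group of the
  rational circulant on Z_4 with connection set {2}.\<close>

theorem theorem1p1:
  fixes n :: nat and G :: "(int \<Rightarrow> int) set"
  assumes "n \<ge> 2"
    and "subgroup G (BijGroup (carrier (integer_mod_group n)))"
  shows
    "let Z = carrier (integer_mod_group n);
         ii = (\<exists>(r::nat) (R::nat rel) (m::nat \<Rightarrow> nat).
                 increasing_poset r R \<and>
                 n = (\<Prod>i=1..r. m i) \<and>
                 (\<forall>i\<in>{1..r}. m i \<ge> 2) \<and>
                 (\<forall>i\<in>{1..r}. \<forall>j\<in>{1..r}. (i, j) \<notin> R \<and> (j, i) \<notin> R \<longrightarrow> gcd (m i) (m j) = 1) \<and>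
                 perm_isomorphic Z G
                   (gwp_domain r (\<lambda>i. {1..m i}))
                   (gen_wreath_product r R (\<lambda>i. {1..m i}) (\<lambda>i. carrier (BijGroup {1..m i}))))
     in
       ((\<exists>S\<subseteq>Z. rational_circulant n S \<and> G = digraph_auts (circulant n S))
          \<longleftrightarrow> group_translations (integer_mod_group n) \<subseteq> G \<and> ii)
       \<and>
       ((\<exists>S\<subseteq>Z. rational_circulant n S \<and> perm_isomorphic Z G Z (digraph_auts (circulant n S)))
          \<longleftrightarrow> ii)"
proof -
  have n: "n > 0" using assms(1) by simp
  let ?Z = "{0..<int n}"
  have Z: "carrier (integer_mod_group n) = ?Z" using n by (simp add: carrier_integer_mod_group)
  have GB: "G \<subseteq> Bij ?Z" using assms(2) unfolding Z subgroup_def BijGroup_def by simp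
  let ?iso = "\<lambda>r R m. perm_isomorphic ?Z G (gwp_domain r (\<lambda>i. {1..m i}))
      (gen_wreath_product r R (\<lambda>i. {1..m i}) (\<lambda>i. carrier (BijGroup {1..m i})))"
  define ii where "ii \<longleftrightarrow> (\<exists>(r::nat) (R::nat rel) (m::nat \<Rightarrow> nat).
      increasing_poset r R \<and> n = (\<Prod>i=1..r. m i) \<and> (\<forall>i\<in>{1..r}. m i \<ge> 2) \<and>
      (\<forall>i\<in>{1..r}. \<forall>j\<in>{1..r}. (i, j) \<notin> R \<and> (j, i) \<notin> R \<longrightarrow> gcd (m i) (m j) = 1) \<and> ?iso r R m)"
  have wp_iff: "weighted_poset r R m \<longleftrightarrow> increasing_poset r R \<and> (\<forall>i\<in>{1..r}. m i \<ge> 2) \<and>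
      (\<forall>i\<in>{1..r}. \<forall>j\<in>{1..r}. (i, j) \<notin> R \<and> (j, i) \<notin> R \<longrightarrow> gcd (m i) (m j) = 1)" for r R m
    unfolding weighted_poset_def coprime_iff_gcd_eq_1 by blast
  have ii: "ii \<longleftrightarrow> (\<exists>r R m. weighted_poset r R m \<and> n = (\<Prod>i=1..r. m i) \<and> ?iso r R m)"
    unfolding ii_def wp_iff by (intro arg_cong[where f = Ex] ext) blast
  have auts_Bij: "digraph_auts (circulant n S) \<subseteq> Bij ?Z" if "S \<subseteq> ?Z" for S
    unfolding digraph_auts_circulant[OF n that] by (auto simp: rel_auts_def)
  have iso_self: "perm_isomorphic ?Z K ?Z K" if "K \<subseteq> Bij ?Z" for K
    unfolding perm_isomorphic_iff
  proof (intro exI[of _ "\<lambda>x. x"] conjI)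
    have "conj_perm ?Z ?Z (\<lambda>x. x) g = g" if "g \<in> K" for g
    proof
      fix x
      show "conj_perm ?Z ?Z (\<lambda>x. x) g x = g x"
        using conj_perm_apply[of "\<lambda>x. x" ?Z ?Z x g] \<open>K \<subseteq> Bij ?Z\<close> that
        by (cases "x \<in> ?Z") (auto simp: bij_betw_def conj_perm_def Bij_def extensional_def)
    qed
    then show "K = conj_perm ?Z ?Z (\<lambda>x. x) ` K" by simp
  qed (simp add: bij_betw_def)
  have forward: ii
    if S: "S \<subseteq> ?Z" "rational_circulant n S" "perm_isomorphic ?Z G ?Z (digraph_auts (circulant n S))" for S
  proof -
    obtain r R m where "weighted_poset r R m" "n = (\<Prod>i=1..r. m i)"
      "perm_isomorphic ?Z (digraph_auts (circulant n S)) (gwp_domain r (\<lambda>i. {1..m i}))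
         (gen_wreath_product r R (\<lambda>i. {1..m i}) (\<lambda>i. carrier (BijGroup {1..m i})))"
      using rational_circulant_auts_wreath[OF n S(1,2)] .
    then show ii unfolding ii using perm_isomorphic_trans[OF GB S(3)] by blast
  qed
  have backward: "\<exists>S\<subseteq>?Z. rational_circulant n S \<and> perm_isomorphic ?Z G ?Z (digraph_auts (circulant n S))"
    if ii
  proof -
    obtain r R m where wp: "weighted_poset r R m" and prod: "n = (\<Prod>i=1..r. m i)" and iso: "?iso r R m"
      using \<open>ii\<close> unfolding ii by blast
    interpret weighted_poset r R m by (rule wp)
    have total: "int n = total" by (simp add: prod weight_def)
    note S = parity_set_circulant[OF total]
    have "perm_isomorphic ?Z (digraph_auts (circulant n parity_set)) digit_space
        (gen_wreath_product r R (\<lambda>i. {1..m i}) (\<lambda>i. carrier (BijGroup {1..m i})))"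
      unfolding S(3) total by (rule perm_isomorphic_congruence_auts)
    then have "perm_isomorphic digit_space
        (gen_wreath_product r R (\<lambda>i. {1..m i}) (\<lambda>i. carrier (BijGroup {1..m i})))
        ?Z (digraph_auts (circulant n parity_set))"
      by (rule perm_isomorphic_sym[OF auts_Bij[OF S(1)]])
    then have "perm_isomorphic ?Z G ?Z (digraph_auts (circulant n parity_set))"
      by (rule perm_isomorphic_trans[OF GB iso])
    then show ?thesis using S(1,2) by blast
  qed
  have "(\<exists>S\<subseteq>?Z. rational_circulant n S \<and> G = digraph_auts (circulant n S)) \<longleftrightarrow>
      group_translations (integer_mod_group n) \<subseteq> G \<and> ii"
  proof
    assume "\<exists>S\<subseteq>?Z. rational_circulant n S \<and> G = digraph_auts (circulant n S)"
    then obtain S where S: "S \<subseteq> ?Z" "rational_circulant n S" "G = digraph_auts (circulant n S)" by blast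
    then show "group_translations (integer_mod_group n) \<subseteq> G \<and> ii"
      using group_translations_digraph_auts[OF n S(1)] forward[OF S(1,2)] iso_self[OF GB] by simp
  next
    assume *: "group_translations (integer_mod_group n) \<subseteq> G \<and> ii"
    then obtain S where S: "S \<subseteq> ?Z" "rational_circulant n S"
      "perm_isomorphic ?Z G ?Z (digraph_auts (circulant n S))"
      using backward by blast
    obtain S' where "S' \<subseteq> ?Z" "rational_circulant n S'" "G = digraph_auts (circulant n S')"
      using rational_circulant_transport[OF n S(1,2) perm_isomorphic_sym[OF GB S(3)]] * by blast
    then show "\<exists>S\<subseteq>?Z. rational_circulant n S \<and> G = digraph_auts (circulant n S)" by blast
  qed
  moreover have "(\<exists>S\<subseteq>?Z. rational_circulant n S \<and> perm_isomorphic ?Z G ?Z (digraph_auts (circulant n S))) \<longleftrightarrow> ii"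
    using forward backward by blast
  ultimately show ?thesis unfolding Z Let_def ii_def by (rule conjI)
qed

end
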